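(* Let $\kappa>0$, $\tau\neq 0$, and let $\Sigma$ be a complete, connected surface in the Berger sphere $\mathbb{S}^3_b(\kappa,\tau)$, invariant under $\mathrm{Rot}$, with constant mean curvature $H\ge 0$ and energy $E$. Then $\Sigma$ is of one of the following types: (i) If $E=0$, then $\Sigma$ is a (possibly only immersed, i.e. not necessarily embedded) $2$-sphere. Moreover, if also $H=0$, then, up to a rotation $(z,w)\mapsto(e^{i\theta}z,w)$, $\Sigma$ is the great $2$-sphere $\{(z,w)\in\mathbb{S}^3:\ \mathrm{Im}(z)=0\}$, which is always embedded. (ii) If $E=\frac14\left(-2H\pm\sqrt{4H^2+\kappa}\right)$, then $\Sigma$ is the Clifford torus $\{(z,w)\in\mathbb{S}^3:\ |z|^2=r^2,\ |w|^2=1-r^2\}$ with $r=\sqrt{\frac12\pm\frac{H}{\sqrt{4H^2+\kappa}}}$ (same choice of sign). (iii) If $E>0$ or $E<-H$ (and $E$ is different from the values in (ii)), then $\Sigma$ is an unduloid-type surface. (iv) If $-H<E<0$, then $\Sigma$ is a nodoid-type surface. (v) If $E=-H\neq 0$, then $\Sigma$ is generated by a union of curves meeting at the north pole. Surfaces of types (iii), (iv) and (v) are compact if and only if $$T(H,E)=2\int_{x_1}^{x_2}\frac{(E+H\sin^2x)\sqrt{1+\frac{4\tau^2}{\kappa}\tan^2x}}{\tau\sqrt{\sin^2x\cos^2x-\frac4\kappa(E+H\sin^2x)^2}}\,dx$$ is a rational multiple of $\pi$, where $x_j=\arcsin\sqrt{t_j}$ and $$t_1=\frac{\kappa-8HE-\sqrt{\kappa^2-16\kappa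 E(H+E)}}{2(4H^2+\kappa)},\qquad t_2=\frac{\kappa-8HE+\sqrt{\kappa^2-16\kappa E(H+E)}}{2(4H^2+\kappa)}.$$ Moreover, surfaces of type (iii) are compact and embedded if and only if $T(H,E)=2\pi/k$ for some $k\in\mathbb{Z}$ (with $k\ne 0$).
   Context: Berger sphere: $\mathbb{S}^3_b(\kappa,\tau)$ is $\mathbb{S}^3=\{(z,w)\in\mathbb{C}^2:|z|^2+|w|^2=1\}$ with the metric $g(X,Y)=\frac4\kappa\left[\langle X,Y\rangle+\left(\frac{4\tau^2}{\kappa}-1\right)\langle X,V\rangle\langle Y,V\rangle\right]$, where $\langle\,,\rangle$ is the standard round metric and $V_{(z,w)}=(iz,iw)$. Put $E^1_{(z,w)}=(-\bar w,\bar z)$, $E^2_{(z,w)}=(-i\bar w,i\bar z)$. $\mathrm{Rot}=\{(z,w)\mapsto(z,e^{it}w):t\in\mathbb{R}\}$, a group of isometries fixing pointwise the axis $\ell=\{(z,0)\in\mathbb{S}^3\}$. Surfaces are immersed. "Mean curvature" is half the trace of the second fundamental form with respect to a unit normal. Generating curve: the orbit space $\mathbb{S}^3/\mathrm{Rot}$ is identified, via $(z,w)\mapsto(z,|w|)$, with the closed upper half of $\mathbb{S}^2=\{(z,a)\in\mathbb{C}\times\mathbb{R}:|z|^2+a^2=1\}$; its north pole is $(0,1)$. A $\mathrm{Rot}$-invariant surface is the preimage of a curve $\gamma$ in this half-sphere. Away from the axis and the north pole, write $\gamma(s)=(\cos x(s)e^{iy(s)},\sin x(s))$ with $0<x(s)<\pi/2$,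 parametrized by arc length for the round metric of $\mathbb{S}^2$, and let $\alpha$ be the angle function with $x'=\cos\alpha$, $y'=\sin\alpha/\cos x$. The immersion is $\Phi(s,t)=(\cos x(s)e^{iy(s)},\sin x(s)e^{it})$. Normal: $\Sigma$ is oriented by $$N=C\left\{-\tau\,\mathrm{Re}\left[\left(\tfrac{\tan\alpha}{\cos x}+i\tan x\right)e^{i(t+y)}\right]E^1_\Phi-\tau\,\mathrm{Im}\left[\left(\tfrac{\tan\alpha}{\cos x}+i\tan x\right)e^{i(t+y)}\right]E^2_\Phi+\tfrac{\kappa}{4\tau}V_\Phi\right\},$$ $$C=\frac{\cos x\cos\alpha}{\sqrt{\cos^2\alpha\left[\cos^2x+\frac{4\tau^2}{\kappa}\sin^2x\right]+\frac{4\tau^2}{\kappa}\sin^2\alpha}},$$ where expressions such as $C\tan\alpha$ are understood by continuous extension where $\cos\alpha=0$. The direction of parametrization of $\gamma$ is chosen so that the mean curvature with respect to $N$ is $H\ge0$. Energy: $E=\tau C\sin x\tan\alpha-H\sin^2x$, which is constant along the generating curve of a constant mean curvature $H$ surface. Unduloid-type: $\gamma$ (in the coordinates $(y,x)$, $y$ lifted to $\mathbb{R}$) is the graph of a non-constant periodic function $x=x(y)$, $y\in\mathbb{R}$, oscillating between $x_1$ (minimum) and $x_2$ (maximum), strictly monotone between consecutive critical points and symmetric under reflection across each line $y=\text{const}$ through a critical point. Nodoid-type: along $\gamma$ (with $y$ lifted to $\mathbb{R}$) $x$ oscillates between $x_1$ and $x_2$, $\gamma$ is symmetric under reflection across each line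 $y=\text{const}$ through a point where $x'=0$, and between two consecutive zeros of $x'$ the function $\sin\alpha$ changes sign exactly once (so $\gamma$ is not a graph over the $y$-axis; it is like a Euclidean nodoid). Generated by a union of curves meeting at the north pole: $\gamma$ is a union of arcs, each with both ends at the north pole $(0,1)$ and not containing it in its interior. Compactness of $\Sigma$ means that the complete generating curve closes up. *)

theory Defs
  imports "HOL-Analysis.Analysis"
begin

definition S3 :: "(complex \<times> complex) set" where
  "S3 = {(z, w). (cmod z)^2 + (cmod w)^2 = 1}"

definition V_field :: "complex \<times> complex \<Rightarrow> complex \<times> complex" where
  "V_field p = (\<i> * fst p, \<i> * snd p)"

definition E1_field :: "complex \<times> complex \<Rightarrow> complex \<times> complex" where
  "E1_field p = (- cnj (snd p), cnj (fst p))"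

definition E2_field :: "complex \<times> complex \<Rightarrow> complex \<times> complex" where
  "E2_field p = (- \<i> * cnj (snd p), \<i> * cnj (fst p))"

text \<open>
  The formula for the metric makes sense at every point of \<open>\<complex>\<^sup>2\<close>; its restriction to tangent
  vectors of \<^const>\<open>S3\<close> is the Berger metric.
\<close>

definition berger_metric ::
  "real \<Rightarrow> real \<Rightarrow> complex \<times> complex \<Rightarrow> complex \<times> complex \<Rightarrow> complex \<times> complex \<Rightarrow> real" where
  "berger_metric \<kappa> \<tau> p X Y =
     4 / \<kappa> * (X \<bullet> Y + (4 * \<tau>^2 / \<kappa> - 1) * (X \<bullet> V_field p) * (Y \<bullet> V_field p))"

text \<open>
  Christoffel symbols of the first kind, i.e. the Koszul formula for \<open>g(\<nabla>\<^sub>X Y, Z)\<close> with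
  constant vector fields \<open>X\<close>, \<open>Y\<close>, \<open>Z\<close> on a vector space.
\<close>

definition christoffel ::
  "('a \<Rightarrow> 'a \<Rightarrow> 'a \<Rightarrow> real) \<Rightarrow> 'a::real_normed_vector \<Rightarrow> 'a \<Rightarrow> 'a \<Rightarrow> 'a \<Rightarrow> real" where
  "christoffel g p X Y Z =
     (deriv (\<lambda>h. g (p + h *\<^sub>R X) Y Z) 0
      + deriv (\<lambda>h. g (p + h *\<^sub>R Y) X Z) 0
      - deriv (\<lambda>h. g (p + h *\<^sub>R Z) X Y) 0) / 2"

definition pd1 :: "(real \<Rightarrow> real \<Rightarrow> 'a::real_normed_vector) \<Rightarrow> real \<Rightarrow> real \<Rightarrow> 'a" where
  "pd1 F s t = vector_derivative (\<lambda>u. F u t) (at s)"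

definition pd2 :: "(real \<Rightarrow> real \<Rightarrow> 'a::real_normed_vector) \<Rightarrow> real \<Rightarrow> real \<Rightarrow> 'a" where
  "pd2 F s t = vector_derivative (\<lambda>u. F s u) (at t)"

text \<open>
  Half the trace, with respect to the induced metric, of the second fundamental form
  \<open>h(X,Y) = g(\<nabla>\<^sub>X Y, N)\<close> of a parametrised surface \<open>F\<close> with unit normal \<open>N\<close> at the point
  \<open>F s t\<close>.  Here \<open>g(\<nabla>\<^sub>\<partial>\<^sub>i \<partial>\<^sub>j F, N) = g(\<partial>\<^sub>i\<partial>\<^sub>j F, N) + \<Gamma>(\<partial>\<^sub>i F, \<partial>\<^sub>j F, N)\<close>.  When \<open>F\<close> takes values in
  \<^const>\<open>S3\<close> and \<open>N\<close> is tangent to \<^const>\<open>S3\<close>, this number only involves the Levi-Civita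
  connection of \<^const>\<open>S3\<close>, not the chosen extension of the metric to \<open>\<complex>\<^sup>2\<close>: by the Koszul
  formula, \<open>g(\<nabla>\<^sub>X Y, N)\<close> for fields tangent to a submanifold depends only on the restricted metric.
\<close>

definition mean_curvature ::
  "('a \<Rightarrow> 'a \<Rightarrow> 'a \<Rightarrow> real) \<Rightarrow> (real \<Rightarrow> real \<Rightarrow> 'a::real_normed_vector) \<Rightarrow> 'a
     \<Rightarrow> real \<Rightarrow> real \<Rightarrow> real" where
  "mean_curvature g F N s t =
    (let p = F s t; X = pd1 F s t; Y = pd2 F s t;
         g11 = g p X X; g12 = g p X Y; g22 = g p Y Y;
         h11 = g p (pd1 (pd1 F) s t) N + christoffel g p X X N;
         h12 = g p (pd1 (pd2 F) s t) N + christoffel g p X Y N;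
         h22 = g p (pd2 (pd2 F) s t) N + christoffel g p Y Y N
     in (g22 * h11 - 2 * g12 * h12 + g11 * h22) / (2 * (g11 * g22 - g12^2)))"

definition half_sphere :: "(complex \<times> real) set" where
  "half_sphere = {(z, a). (cmod z)^2 + a^2 = 1 \<and> a \<ge> 0}"

definition north_pole :: "complex \<times> real" where
  "north_pole = (0, 1)"

definition C2_on :: "(real \<Rightarrow> 'a::real_normed_vector) \<Rightarrow> real set \<Rightarrow> bool" where
  "C2_on \<gamma> I \<longleftrightarrow> (\<exists>\<gamma>1 \<gamma>2. continuous_on I \<gamma>2 \<and>
     (\<forall>s\<in>I. (\<gamma> has_vector_derivative \<gamma>1 s) (at s within I) \<and>
            (\<gamma>1 has_vector_derivative \<gamma>2 s) (at s within I)))"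

text \<open>
  \<open>\<gamma>\<close>, restricted to the interval \<open>I\<close>, is the generating curve (parametrised by arc length) of a
  connected immersed surface without boundary.  The curve can reach the axis \<open>a = 0\<close> only at an
  end point of \<open>I\<close>, and an end point belonging to \<open>I\<close> must lie on the axis.  There
  \<open>\<gamma>\<close> is orthogonal to the axis; together with the differentiability of \<open>\<gamma>\<close> up to the end point
  this is the condition for the rotated surface to be a \<open>C\<^sup>2\<close> immersed surface there.  Nothing
  special is required where \<open>\<gamma>\<close> goes through the north pole, whose orbit is a regular one.  A
  closed generating curve is described by a periodic \<open>\<gamma>\<close> on \<open>I = UNIV\<close>.
\<close>

definition invariant_surface :: "(real \<Rightarrow> complex \<times> real) \<Rightarrow> real set \<Rightarrow> bool" where
  "invariant_surface \<gamma> I \<longleftrightarrow>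
     is_interval I \<and> interior I \<noteq> {} \<and> \<gamma> ` I \<subseteq> half_sphere \<and> C2_on \<gamma> I \<and>
     (\<forall>s\<in>I. norm (vector_derivative \<gamma> (at s within I)) = 1) \<and>
     (\<forall>s\<in>I. snd (\<gamma> s) = 0 \<longleftrightarrow> s \<notin> interior I) \<and>
     (\<forall>s\<in>I - interior I. fst (vector_derivative \<gamma> (at s within I)) = 0)"

text \<open>The surface as a subset of \<^const>\<open>S3\<close>: the preimage of the curve under
  \<open>(z, w) \<mapsto> (z, |w|)\<close>.\<close>

definition surface_set :: "(real \<Rightarrow> complex \<times> real) \<Rightarrow> real set \<Rightarrow> (complex \<times> complex) set" where
  "surface_set \<gamma> I = {(z, w). (z, cmod w) \<in> \<gamma> ` I}"

text \<open>
  The abstract surface on which the immersion lives is \<open>I \<times> S\<^sup>1\<close> with the circles over end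
  points on the axis collapsed to points; it is realised as a surface of revolution in
  \<open>\<real> \<times> \<complex>\<close>.
\<close>

definition surface_domain :: "(real \<Rightarrow> complex \<times> real) \<Rightarrow> real set \<Rightarrow> (real \<times> complex) set" where
  "surface_domain \<gamma> I = {(s, w). s \<in> I \<and> cmod w = snd (\<gamma> s)}"

definition immersion :: "(real \<Rightarrow> complex \<times> real) \<Rightarrow> real \<times> complex \<Rightarrow> complex \<times> complex" where
  "immersion \<gamma> q = (fst (\<gamma> (fst q)), snd q)"

definition immersion_param :: "(real \<Rightarrow> complex \<times> real) \<Rightarrow> real \<Rightarrow> real \<Rightarrow> complex \<times> complex" where
  "immersion_param \<gamma> s t = immersion \<gamma> (s, of_real (snd (\<gamma> s)) * cis t)"

definition berger_length :: "real \<Rightarrow> real \<Rightarrow> (real \<Rightarrow> complex \<times> complex) \<Rightarrow> real" where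
  "berger_length \<kappa> \<tau> c = integral {0..1}
     (\<lambda>u. sqrt (berger_metric \<kappa> \<tau> (c u) (vector_derivative c (at u)) (vector_derivative c (at u))))"

definition surface_dist ::
  "real \<Rightarrow> real \<Rightarrow> (real \<Rightarrow> complex \<times> real) \<Rightarrow> real set \<Rightarrow> real \<times> complex \<Rightarrow> real \<times> complex \<Rightarrow> real"
  where
  "surface_dist \<kappa> \<tau> \<gamma> I p q = Inf {berger_length \<kappa> \<tau> (immersion \<gamma> \<circ> c) | c.
     c C1_differentiable_on {0..1} \<and> c ` {0..1} \<subseteq> surface_domain \<gamma> I \<and> c 0 = p \<and> c 1 = q}"

definition complete_surface ::
  "real \<Rightarrow> real \<Rightarrow> (real \<Rightarrow> complex \<times> real) \<Rightarrow> real set \<Rightarrow> bool" where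
  "complete_surface \<kappa> \<tau> \<gamma> I \<longleftrightarrow>
     (\<forall>\<sigma> :: nat \<Rightarrow> real \<times> complex.
        (\<forall>n. \<sigma> n \<in> surface_domain \<gamma> I) \<and>
        (\<forall>\<epsilon>>0. \<exists>K. \<forall>m\<ge>K. \<forall>n\<ge>K. surface_dist \<kappa> \<tau> \<gamma> I (\<sigma> m) (\<sigma> n) < \<epsilon>)
        \<longrightarrow> (\<exists>p\<in>surface_domain \<gamma> I. (\<lambda>n. surface_dist \<kappa> \<tau> \<gamma> I (\<sigma> n) p) \<longlonglongrightarrow> 0))"

definition compact_surface :: "(real \<Rightarrow> complex \<times> real) \<Rightarrow> real set \<Rightarrow> bool" where
  "compact_surface \<gamma> I \<longleftrightarrow> compact I \<or> (I = UNIV \<and> (\<exists>p>0. \<forall>s. \<gamma> (s + p) = \<gamma> s))"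

text \<open>
  Embeddedness (for compact surfaces): after a periodic curve has been divided by its periods, the
  immersion is injective.
\<close>

definition embedded_surface :: "(real \<Rightarrow> complex \<times> real) \<Rightarrow> real set \<Rightarrow> bool" where
  "embedded_surface \<gamma> I \<longleftrightarrow>
     (\<forall>s1\<in>I. \<forall>s2\<in>I. \<gamma> s1 = \<gamma> s2 \<longrightarrow>
        s1 = s2 \<or> (I = UNIV \<and> (\<forall>s. \<gamma> (s + (s2 - s1)) = \<gamma> s)))"

definition polar_coordinates ::
  "(real \<Rightarrow> complex \<times> real) \<Rightarrow> real set \<Rightarrow> (real \<Rightarrow> real) \<Rightarrow> (real \<Rightarrow> real) \<Rightarrow> (real \<Rightarrow> real) \<Rightarrow> bool"
  where
  "polar_coordinates \<gamma> J x y \<alpha> \<longleftrightarrow>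
     (\<forall>s\<in>J. \<gamma> s = (of_real (cos (x s)) * cis (y s), sin (x s)) \<and> 0 < x s \<and> x s < pi / 2 \<and>
        (x has_real_derivative cos (\<alpha> s)) (at s) \<and>
        (y has_real_derivative sin (\<alpha> s) / cos (x s)) (at s))"

definition normal_root :: "real \<Rightarrow> real \<Rightarrow> real \<Rightarrow> real \<Rightarrow> real" where
  "normal_root \<kappa> \<tau> x \<alpha> =
     sqrt ((cos \<alpha>)^2 * ((cos x)^2 + 4 * \<tau>^2 / \<kappa> * (sin x)^2) + 4 * \<tau>^2 / \<kappa> * (sin \<alpha>)^2)"

definition normal_C :: "real \<Rightarrow> real \<Rightarrow> real \<Rightarrow> real \<Rightarrow> real" where
  "normal_C \<kappa> \<tau> x \<alpha> = cos x * cos \<alpha> / normal_root \<kappa> \<tau> x \<alpha>"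

text \<open>The continuous extension of \<open>C tan \<alpha>\<close> to points with \<open>cos \<alpha> = 0\<close>.\<close>

definition normal_C_tan :: "real \<Rightarrow> real \<Rightarrow> real \<Rightarrow> real \<Rightarrow> real" where
  "normal_C_tan \<kappa> \<tau> x \<alpha> = cos x * sin \<alpha> / normal_root \<kappa> \<tau> x \<alpha>"

definition surface_normal ::
  "real \<Rightarrow> real \<Rightarrow> real \<Rightarrow> real \<Rightarrow> real \<Rightarrow> real \<Rightarrow> complex \<times> complex" where
  "surface_normal \<kappa> \<tau> x y \<alpha> t =
    (let p = (of_real (cos x) * cis y, of_real (sin x) * cis t);
         c = Complex (normal_C_tan \<kappa> \<tau> x \<alpha> / cos x) (normal_C \<kappa> \<tau> x \<alpha> * tan x) * cis (t + y)
     in (- \<tau> * Re c) *\<^sub>R E1_field p + (- \<tau> * Im c) *\<^sub>R E2_field p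
        + (normal_C \<kappa> \<tau> x \<alpha> * \<kappa> / (4 * \<tau>)) *\<^sub>R V_field p)"

text \<open>
  Local coordinates exist around every parameter whose point is neither on the axis nor the north
  pole, and the normal and the energy do not depend on their choice.  The mean curvature of a
  \<open>C\<^sup>2\<close> surface is continuous, so it is determined on the remaining orbits.
\<close>

definition has_mean_curvature ::
  "real \<Rightarrow> real \<Rightarrow> (real \<Rightarrow> complex \<times> real) \<Rightarrow> real set \<Rightarrow> real \<Rightarrow> bool" where
  "has_mean_curvature \<kappa> \<tau> \<gamma> I H \<longleftrightarrow>
     (\<forall>J x y \<alpha>. open J \<and> J \<subseteq> I \<and> polar_coordinates \<gamma> J x y \<alpha> \<longrightarrow>
        (\<forall>s\<in>J. \<forall>t. mean_curvature (berger_metric \<kappa> \<tau>) (immersion_param \<gamma>)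
                   (surface_normal \<kappa> \<tau> (x s) (y s) (\<alpha> s) t) s t = H))"

definition has_energy ::
  "real \<Rightarrow> real \<Rightarrow> (real \<Rightarrow> complex \<times> real) \<Rightarrow> real set \<Rightarrow> real \<Rightarrow> real \<Rightarrow> bool" where
  "has_energy \<kappa> \<tau> \<gamma> I H E \<longleftrightarrow>
     (\<forall>J x y \<alpha>. open J \<and> J \<subseteq> I \<and> polar_coordinates \<gamma> J x y \<alpha> \<longrightarrow>
        (\<forall>s\<in>J. \<tau> * sin (x s) * normal_C_tan \<kappa> \<tau> (x s) (\<alpha> s) - H * (sin (x s))^2 = E))"

definition sphere_type :: "(real \<Rightarrow> complex \<times> real) \<Rightarrow> real set \<Rightarrow> bool" where
  "sphere_type \<gamma> I \<longleftrightarrow> surface_domain \<gamma> I homeomorphic sphere (0::real^3) 1"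

definition clifford_torus :: "real \<Rightarrow> (complex \<times> complex) set" where
  "clifford_torus r = {(z, w) \<in> S3. (cmod z)^2 = r^2 \<and> (cmod w)^2 = 1 - r^2}"

definition unduloid_type ::
  "(real \<Rightarrow> complex \<times> real) \<Rightarrow> real set \<Rightarrow> real \<Rightarrow> real \<Rightarrow> bool" where
  "unduloid_type \<gamma> I x1 x2 \<longleftrightarrow> I = UNIV \<and>
    (\<exists>x y \<alpha> f. polar_coordinates \<gamma> UNIV x y \<alpha> \<and> bij y \<and> (\<forall>s. x s = f (y s)) \<and>
       (\<forall>u. f differentiable (at u)) \<and> (\<exists>p>0. \<forall>u. f (u + p) = f u) \<and>
       x1 < x2 \<and> range f = {x1..x2} \<and>
       (let K = {u. deriv f u = 0}
        in f ` K = {x1, x2} \<and> (\<forall>a b. finite (K \<inter> {a..b})) \<and>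
           (\<forall>a\<in>K. \<forall>b\<in>K. a < b \<and> K \<inter> {a<..<b} = {} \<longrightarrow>
              strict_mono_on {a..b} f \<or> strict_antimono_on {a..b} f) \<and>
           (\<forall>c\<in>K. \<forall>u. f (2 * c - u) = f u)))"

definition nodoid_type ::
  "(real \<Rightarrow> complex \<times> real) \<Rightarrow> real set \<Rightarrow> real \<Rightarrow> real \<Rightarrow> bool" where
  "nodoid_type \<gamma> I x1 x2 \<longleftrightarrow> I = UNIV \<and>
    (\<exists>x y \<alpha>. polar_coordinates \<gamma> UNIV x y \<alpha> \<and> x1 < x2 \<and> range x = {x1..x2} \<and>
       (let K = {s. deriv x s = 0}
        in x ` K = {x1, x2} \<and> (\<forall>a b. finite (K \<inter> {a..b})) \<and>
           (\<forall>c\<in>K. \<forall>h. x (c + h) = x (c - h) \<and> y (c + h) - y c = - (y (c - h) - y c)) \<and>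
           (\<forall>a\<in>K. \<forall>b\<in>K. a < b \<and> K \<inter> {a<..<b} = {} \<longrightarrow>
              (\<exists>c\<in>{a<..<b}.
                 (\<forall>s\<in>{a..<c}. sin (\<alpha> s) < 0) \<and> (\<forall>s\<in>{c<..b}. sin (\<alpha> s) > 0) \<or>
                 (\<forall>s\<in>{a..<c}. sin (\<alpha> s) > 0) \<and> (\<forall>s\<in>{c<..b}. sin (\<alpha> s) < 0)))))"

definition north_pole_type :: "(real \<Rightarrow> complex \<times> real) \<Rightarrow> real set \<Rightarrow> bool" where
  "north_pole_type \<gamma> I \<longleftrightarrow> I = UNIV \<and>
     (\<forall>s. \<exists>a b. a < b \<and> s \<in> {a..b} \<and> \<gamma> a = north_pole \<and> \<gamma> b = north_pole \<and>
        (\<forall>u\<in>{a<..<b}. \<gamma> u \<noteq> north_pole))"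

definition x_min :: "real \<Rightarrow> real \<Rightarrow> real \<Rightarrow> real" where
  "x_min \<kappa> H E = arcsin (sqrt
     ((\<kappa> - 8 * H * E - sqrt (\<kappa>^2 - 16 * \<kappa> * E * (H + E))) / (2 * (4 * H^2 + \<kappa>))))"

definition x_max :: "real \<Rightarrow> real \<Rightarrow> real \<Rightarrow> real" where
  "x_max \<kappa> H E = arcsin (sqrt
     ((\<kappa> - 8 * H * E + sqrt (\<kappa>^2 - 16 * \<kappa> * E * (H + E))) / (2 * (4 * H^2 + \<kappa>))))"

definition T_integral :: "real \<Rightarrow> real \<Rightarrow> real \<Rightarrow> real \<Rightarrow> real" where
  "T_integral \<kappa> \<tau> H E = 2 * integral {x_min \<kappa> H E..x_max \<kappa> H E}
     (\<lambda>x. (E + H * (sin x)^2) * sqrt (1 + 4 * \<tau>^2 / \<kappa> * (tan x)^2) /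
          (\<tau> * sqrt ((sin x)^2 * (cos x)^2 - 4 / \<kappa> * (E + H * (sin x)^2)^2)))"

definition torus_energy :: "real \<Rightarrow> real \<Rightarrow> real \<Rightarrow> real" where
  "torus_energy \<kappa> H \<sigma> = (- 2 * H + \<sigma> * sqrt (4 * H^2 + \<kappa>)) / 4"

end

theory Submission
  imports Defs
begin

text \<open>
  Write \<open>\<gamma> = (z, a)\<close> and \<open>t = a\<^sup>2 = sin\<^sup>2 x\<close>.  Squaring the energy equation gives
  \<open>t'\<^sup>2 = (t - t\<^sub>1) (t\<^sub>2 - t) R(t)\<close> with \<open>R > 0\<close> bounded away from \<open>0\<close>.  If \<open>t\<^sub>1 = t\<^sub>2\<close>, the latitude
  is constant and the surface is a Clifford torus.  Otherwise the constant mean curvature forbids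
  intervals on which \<open>t\<close> is constant, so that \<open>t = mid - rad cos \<phi>\<close> for a phase \<open>\<phi>\<close> with
  \<open>\<phi>' = \<surd>R(t) > 0\<close>.  The phase is a global parameter, in which \<open>x\<close>, \<open>ds/d\<phi>\<close> and \<open>dy/d\<phi>\<close> are even
  and \<open>2\<pi>\<close>-periodic; hence all reflection symmetries, and \<open>y\<close> grows by
  \<open>T = 2 \<integral>\<^sub>0\<^sup>\<pi> (dy/d\<phi>) d\<phi>\<close>, the integral of the theorem, when \<open>\<phi>\<close> grows by \<open>2\<pi>\<close>.  The type of the
  surface is read off the sign of \<open>dy/d\<phi>\<close>, which is that of \<open>\<tau> (E + H t)\<close>.  Since \<open>P \<ge> 0\<close> along
  the curve, where \<open>P(t) = t (1 - t) - 4 (E + H t)\<^sup>2 / \<kappa>\<close>, the curve reaches the axis only if \<open>E = 0\<close>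
  and the north pole only if \<open>E = -H\<close>; completeness makes the parameter interval closed, so that it
  is all of \<open>\<real>\<close> for \<open>E \<noteq> 0\<close>, and compact for \<open>E = 0\<close> because \<open>\<phi>\<close> may not reach multiples
  of \<open>2\<pi>\<close> away from the axis.
\<close>

section \<open>Lifts of curves to the circle and oscillations\<close>

text \<open>The equation for t' fixes t' only up to sign and also has the constant solutions t = t1
  and t = t2, so by the energy alone an arc could stall at a turning point and resume later. This is
  why the mean curvature of a latitude has to be computed: a torus with the right H and the right E
  sits at the vertex \<open>mid\<close> of \<open>P\<close> and has P = 0 there, which forces t1 =
  t2. Lifting to the circle gives one smooth phase and replaces the gluing of monotone pieces at
  turning points. The factor R is 4 t (4 H^2 + \<kappa>) / (\<kappa> Q t), where \<open>Q\<close>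
  arises when the squared energy is solved for sin^2 \<alpha>. Wherever P \<ge> 0, Q t is comparable
  with t, so R keeps a positive lower bound up to the axis. Polar angles exist only off the axis and
  off the north pole. Everything is therefore written as a function of t, which is C^2 along the
  whole curve, and the longitude returns as an antiderivative. At the pole the polar longitude jumps
  by \<pi>; there |z| gives way to a signed multiple of cos (\<phi> / 2), whose sign changes with
  every full turn of the phase.\<close>

lemma open_interval_antiderivative:
  fixes g :: "real \<Rightarrow> real"
  assumes "open J" "is_interval J" "continuous_on J g"
  shows "\<exists>G. \<forall>s\<in>J. (G has_real_derivative g s) (at s)"
proof (cases "J = {}")
  case False
  \<comment> \<open>The ends are taken in the extended reals, so that bounded and unbounded
    intervals fall under the same antiderivative theorem.\<close>
  define a b where "a = Inf (ereal ` J)" and "b = Sup (ereal ` J)"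
  have in_J: "s \<in> J" if "a < ereal s" "ereal s < b" for s
  proof -
    have "\<exists>l\<in>J. ereal l < ereal s" "\<exists>u\<in>J. ereal s < ereal u"
      using that by (auto simp: a_def b_def INF_less_iff less_SUP_iff simp del: less_ereal.simps)
    then obtain l u where "l \<in> J" "ereal l < ereal s" "u \<in> J" "ereal s < ereal u"
      by blast
    then show ?thesis
      using mem_is_interval_1_I[OF assms(2), of l u s] by auto
  qed
  have J_in: "a < ereal s \<and> ereal s < b" if s: "s \<in> J" for s
  proof -
    obtain d where d: "d > 0" "ball s d \<subseteq> J"
      using openE[OF assms(1) s] by blast
    have "s - d/2 \<in> J" "s + d/2 \<in> J"
      using d(1) by (auto intro!: subsetD[OF d(2)] simp: dist_real_def)
    then have le: "a \<le> ereal (s - d/2)" "ereal (s + d/2) \<le> b"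
      unfolding a_def b_def by (auto intro: INF_lower SUP_upper)
    have "ereal (s - d/2) < ereal s" "ereal s < ereal (s + d/2)"
      using d(1) by auto
    then show ?thesis
      using le order_le_less_trans order_less_le_trans by blast
  qed
  have "a < b"
    using False J_in by (meson ex_in_conv less_trans)
  moreover have "isCont g s" if "a < ereal s" "ereal s < b" for s
    using assms in_J[OF that] by (simp add: continuous_on_eq_continuous_at)
  ultimately obtain G where "\<forall>s. a < ereal s \<longrightarrow> ereal s < b \<longrightarrow> (G has_vector_derivative g s) (at s)"
    using einterval_antiderivative by blast
  then show ?thesis
    using J_in has_real_derivative_iff_has_vector_derivative by blast
qed simp

lemma has_vector_derivative_of_real:
  assumes "(f has_real_derivative d) F"
  shows "((\<lambda>s. complex_of_real (f s)) has_vector_derivative complex_of_real d) F"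
  using bounded_linear.has_vector_derivative[OF bounded_linear_of_real
      assms[unfolded has_real_derivative_iff_has_vector_derivative]] .

lemma has_vector_derivative_cis:
  assumes "(f has_real_derivative d) (at s within A)"
  shows "((\<lambda>s. cis (f s)) has_vector_derivative of_real d * \<i> * cis (f s)) (at s within A)"
proof -
  have "((\<lambda>s. exp (\<i> * complex_of_real (f s))) has_vector_derivative
           (\<i> * complex_of_real d) * exp (\<i> * complex_of_real (f s))) (at s within A)"
    by (rule field_vector_diff_chain_within[where f="\<lambda>s. \<i> * complex_of_real (f s)" and g=exp, unfolded o_def])
       (auto intro!: has_vector_derivative_of_real assms derivative_intros has_vector_derivative_mult_right
         intro: DERIV_subset[OF DERIV_exp])
  then show ?thesis
    by (simp add: cis_conv_exp mult_ac)
qed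

lemma Im_has_real_derivative:
  assumes "(f has_vector_derivative d) F"
  shows "((\<lambda>s. Im (f s)) has_real_derivative Im d) F"
  using bounded_linear.has_vector_derivative[OF bounded_linear_Im assms]
  by (simp add: has_real_derivative_iff_has_vector_derivative)

lemma Re_has_real_derivative:
  assumes "(f has_vector_derivative d) F"
  shows "((\<lambda>s. Re (f s)) has_real_derivative Re d) F"
  using bounded_linear.has_vector_derivative[OF bounded_linear_Re assms]
  by (simp add: has_real_derivative_iff_has_vector_derivative)

lemma open_interval_derivative_zero_constant:
  fixes f :: "real \<Rightarrow> 'a::real_normed_vector"
  assumes "open J" "is_interval J" "\<And>s. s \<in> J \<Longrightarrow> (f has_vector_derivative 0) (at s)"
    and "a \<in> J" "b \<in> J"
  shows "f a = f b"
proof -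
  have "\<exists>c. \<forall>s\<in>J. f s = c"
  proof (rule has_vector_derivative_zero_constant)
    show "convex J"
      using assms(2) is_interval_convex by blast
    show "(f has_vector_derivative 0) (at x within J)" if "x \<in> J" for x
      using assms(3)[OF that] has_vector_derivative_at_within by blast
  qed blast
  then show ?thesis
    using assms(4,5) by metis
qed

text \<open>Differentiating |u|^2 = 1 shows that cnj u * u' is purely imaginary, so u' = i g u with
  g its imaginary part. For an antiderivative \<theta> of g the product u * cis (- \<theta>) has
  derivative 0, and the constant of integration is fixed by \<open>Arg\<close> at one point.\<close>

lemma circle_lift:
  fixes u :: "real \<Rightarrow> complex"
  assumes J: "open J" "is_interval J"
    and u: "\<And>s. s \<in> J \<Longrightarrow> (u has_vector_derivative u' s) (at s)"
    and cont: "continuous_on J u'"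
    and norm: "\<And>s. s \<in> J \<Longrightarrow> norm (u s) = 1"
  shows "\<exists>\<theta>. \<forall>s\<in>J. u s = cis (\<theta> s) \<and> (\<theta> has_real_derivative Im (cnj (u s) * u' s)) (at s)"
proof (cases "J = {}")
  case False
  then obtain s0 where s0: "s0 \<in> J"
    by blast
  define g where "g s = Im (cnj (u s) * u' s)" for s
  have "continuous_on J u"
    using u by (meson continuous_at_imp_continuous_on has_vector_derivative_continuous)
  then have "continuous_on J g"
    unfolding g_def by (intro continuous_intros cont)
  then obtain G where G: "\<And>s. s \<in> J \<Longrightarrow> (G has_real_derivative g s) (at s)"
    using open_interval_antiderivative[OF J] by blast
  define \<theta> where "\<theta> s = G s - G s0 + Arg (u s0)" for s
  have \<theta>: "(\<theta> has_real_derivative g s) (at s)" if "s \<in> J" for s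
    unfolding \<theta>_def by (auto intro!: derivative_eq_intros G that)
  have u'_eq: "u' s = \<i> * of_real (g s) * u s" if s: "s \<in> J" for s
  proof -
    have ur: "((\<lambda>s. Re (u s)) has_real_derivative Re (u' s)) (at s)"
      and ui: "((\<lambda>s. Im (u s)) has_real_derivative Im (u' s)) (at s)"
      using u[OF s] by (auto intro: Re_has_real_derivative Im_has_real_derivative)
    have 1: "((\<lambda>s. (Re (u s))^2 + (Im (u s))^2) has_real_derivative
        2 * (Re (u s) * Re (u' s) + Im (u s) * Im (u' s))) (at s)"
      using DERIV_add[OF DERIV_power[OF ur, of 2] DERIV_power[OF ui, of 2]]
      by (simp add: algebra_simps)
    have "((\<lambda>s. 1) has_real_derivative 0) (at s)"
      by simp
    then have 2: "((\<lambda>s. (Re (u s))^2 + (Im (u s))^2) has_real_derivative 0) (at s)"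
      using has_field_derivative_transform_within_open[OF _ J(1) s, of "\<lambda>s. 1" 0] norm
      by (simp add: cmod_power2[symmetric])
    have orth: "Re (u s) * Re (u' s) + Im (u s) * Im (u' s) = 0"
      using DERIV_unique[OF 1 2] by simp
    have "u s * cnj (u s) = 1"
      using norm[OF s] complex_norm_square[of "u s"] by simp
    moreover have "cnj (u s) * u' s = \<i> * of_real (g s)"
      using orth by (simp add: complex_eq_iff g_def)
    ultimately show ?thesis
      by (metis mult.assoc mult.commute mult.right_neutral)
  qed
  define h where "h s = u s * cis (- \<theta> s)" for s
  have "h s = h s0" if "s \<in> J" for s
  proof (rule open_interval_derivative_zero_constant[OF J _ that s0])
    fix r assume r: "r \<in> J"
    have "((\<lambda>s. - \<theta> s) has_real_derivative - g r) (at r)"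
      by (intro derivative_intros \<theta> r)
    from has_vector_derivative_mult[OF u[OF r] has_vector_derivative_cis[OF this]]
    show "(h has_vector_derivative 0) (at r)"
      unfolding h_def using u'_eq[OF r] by (simp add: algebra_simps)
  qed
  moreover have "h s0 = 1"
  proof -
    have "u s0 = cis (Arg (u s0))"
      using norm[OF s0] rcis_cmod_Arg[of "u s0"] by (simp add: rcis_def)
    then have "h s0 = cis (Arg (u s0)) * cis (- Arg (u s0))"
      unfolding h_def \<theta>_def by simp
    then show ?thesis
      by (simp only: cis_mult) simp
  qed
  ultimately have "u s = cis (\<theta> s)" if "s \<in> J" for s
  proof -
    have "u s = h s * cis (\<theta> s)"
      by (simp add: h_def mult.assoc cis_mult)
    then show ?thesis
      using \<open>h s0 = 1\<close> \<open>\<And>s. s \<in> J \<Longrightarrow> h s = h s0\<close>[OF that] by simp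
  qed
  then show ?thesis
    using \<theta> g_def by (intro exI[of _ \<theta>]) auto
qed simp

text \<open>The phase is a lift of \<open>((mid - t) + i t' / \<rho>) / rad\<close>.  Where \<open>t' \<noteq> 0\<close>, differentiating
  \<open>t = mid - rad cos \<phi>\<close> gives \<open>\<phi>' = \<rho>\<close>, and these points are dense.\<close>

lemma oscillation_phase:
  fixes t t' t'' \<rho> \<rho>' :: "real \<Rightarrow> real"
  assumes J: "open J" "is_interval J"
    and t: "\<And>s. s \<in> J \<Longrightarrow> (t has_real_derivative t' s) (at s)"
    and t': "\<And>s. s \<in> J \<Longrightarrow> (t' has_real_derivative t'' s) (at s)"
    and t'': "continuous_on J t''"
    and \<rho>: "\<And>s. s \<in> J \<Longrightarrow> (\<rho> has_real_derivative \<rho>' s) (at s)"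
    and \<rho>': "continuous_on J \<rho>'"
    and pos: "\<And>s. s \<in> J \<Longrightarrow> \<rho> s > 0" "rad > 0"
    and ode: "\<And>s. s \<in> J \<Longrightarrow> (t' s)^2 = (rad^2 - (t s - mid)^2) * (\<rho> s)^2"
    and nonconst: "\<And>U. open U \<Longrightarrow> U \<subseteq> J \<Longrightarrow> U \<noteq> {} \<Longrightarrow> \<exists>s\<in>U. t' s \<noteq> 0"
  shows "\<exists>\<phi>. \<forall>s\<in>J. t s = mid - rad * cos (\<phi> s) \<and> t' s = rad * \<rho> s * sin (\<phi> s) \<and>
           (\<phi> has_real_derivative \<rho> s) (at s)"
proof -
  define u where "u s = Complex ((mid - t s) / rad) (t' s / (rad * \<rho> s))" for s
  define u' where "u' s = Complex (- t' s / rad) ((t'' s * \<rho> s - t' s * \<rho>' s) / (rad * (\<rho> s)^2))" for s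
  have cont: "continuous_on J t'" "continuous_on J \<rho>"
    using t' \<rho> by (meson DERIV_isCont continuous_at_imp_continuous_on)+
  have cont_u': "continuous_on J u'"
    unfolding u'_def using pos
    by (intro continuous_intros cont t'' \<rho>' continuous_on_Complex) (auto, metis less_irrefl)
  have u: "(u has_vector_derivative u' s) (at s)" if s: "s \<in> J" for s
  proof -
    have re: "((\<lambda>s. (mid - t s) / rad) has_real_derivative - t' s / rad) (at s)"
      using pos(2) by (auto intro!: derivative_eq_intros t s)
    have im: "((\<lambda>s. t' s / (rad * \<rho> s)) has_real_derivative (t'' s * \<rho> s - t' s * \<rho>' s) / (rad * (\<rho> s)^2)) (at s)"
      using pos(1)[OF s] pos(2)
      by (auto intro!: derivative_eq_intros t' \<rho> s simp: field_simps power2_eq_square)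
    have "((\<lambda>s. of_real ((mid - t s) / rad) + \<i> * of_real (t' s / (rad * \<rho> s))) has_vector_derivative
        of_real (- t' s / rad) + \<i> * of_real ((t'' s * \<rho> s - t' s * \<rho>' s) / (rad * (\<rho> s)^2))) (at s)"
      by (intro has_vector_derivative_add has_vector_derivative_mult_right has_vector_derivative_of_real re im)
    then show ?thesis
      unfolding u_def u'_def Complex_eq .
  qed
  have norm_u: "norm (u s) = 1" if s: "s \<in> J" for s
  proof -
    have "((mid - t s) / rad)^2 + (t' s / (rad * \<rho> s))^2 = 1"
      using ode[OF s] pos(1)[OF s] pos(2)
      by (simp add: power_divide power_mult_distrib divide_simps) (simp add: algebra_simps power2_eq_square)
    then show ?thesis
      by (simp add: u_def cmod_def)
  qed
  obtain \<phi> where \<phi>: "\<And>s. s \<in> J \<Longrightarrow> u s = cis (\<phi> s)"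
    "\<And>s. s \<in> J \<Longrightarrow> (\<phi> has_real_derivative Im (cnj (u s) * u' s)) (at s)"
    using circle_lift[OF J u cont_u' norm_u] by blast
  define d where "d s = Im (cnj (u s) * u' s)" for s
  have cont_u: "continuous_on J u"
    using u by (meson continuous_at_imp_continuous_on has_vector_derivative_continuous)
  have cont_d: "continuous_on J d"
    unfolding d_def by (intro continuous_intros cont_u cont_u')
  have t_eq: "t s = mid - rad * cos (\<phi> s)" and t'_eq: "t' s = rad * \<rho> s * sin (\<phi> s)" if "s \<in> J" for s
    using \<phi>(1)[OF that] pos(1)[OF that] pos(2) by (simp_all add: u_def complex_eq_iff field_simps)
  have off: "d s = \<rho> s" if s: "s \<in> J" and "t' s \<noteq> 0" for s
  proof -
    have "((\<lambda>s. mid - rad * cos (\<phi> s)) has_real_derivative rad * (sin (\<phi> s) * d s)) (at s)"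
      using \<phi>(2)[OF s] by (auto intro!: derivative_eq_intros simp: d_def)
    moreover have "((\<lambda>s. mid - rad * cos (\<phi> s)) has_real_derivative t' s) (at s)"
      using has_field_derivative_transform_within_open[OF t[OF s] J(1) s t_eq] .
    ultimately have "rad * (sin (\<phi> s) * d s) = rad * \<rho> s * sin (\<phi> s)"
      using DERIV_unique t'_eq[OF s] by metis
    then show ?thesis
      using \<open>t' s \<noteq> 0\<close> t'_eq[OF s] by auto
  qed
  have d_eq: "d s = \<rho> s" if s: "s \<in> J" for s
  proof (rule ccontr)
    assume ne: "d s \<noteq> \<rho> s"
    define U where "U = J \<inter> (\<lambda>s. d s - \<rho> s) -` (- {0})"
    have "open U"
      unfolding U_def
      by (rule continuous_open_preimage) (auto intro!: continuous_intros cont_d cont J)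
    moreover have "s \<in> U" "U \<subseteq> J"
      using ne s by (auto simp: U_def)
    ultimately obtain r where "r \<in> U" "t' r \<noteq> 0"
      using nonconst[of U] by blast
    then show False
      using off[of r] by (auto simp: U_def)
  qed
  show ?thesis
    using t_eq t'_eq \<phi>(2) d_eq unfolding d_def by (intro exI[of _ \<phi>]) auto
qed

text \<open>The differences F (\<phi> + 2 \<pi>) - F \<phi> and the sums F h + F (- h) have
  derivative 0. Reflection in an arbitrary multiple of \<pi> is reflection in 0 followed by a shift.
  Applied to arc length and to longitude as functions of the phase, this yields all symmetries of
  the generating curve.\<close>

lemma even_periodic_primitive:
  fixes F g :: "real \<Rightarrow> real"
  assumes F: "\<And>\<phi>. (F has_real_derivative g \<phi>) (at \<phi>)"
    and per: "\<And>\<phi>. g (\<phi> + 2 * pi) = g \<phi>" and even: "\<And>\<phi>. g (- \<phi>) = g \<phi>"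
  shows even_periodic_primitive_shift: "F (\<phi> + 2 * pi * of_int n) = F \<phi> + of_int n * (2 * (F pi - F 0))"
    and even_periodic_primitive_reflect: "F (of_int n * pi + h) + F (of_int n * pi - h) = 2 * F (of_int n * pi)"
proof -
  have shift1: "F (\<phi> + 2 * pi) = F \<phi> + (F (2 * pi) - F 0)" for \<phi>
  proof -
    have "((\<lambda>\<phi>. F (\<phi> + 2 * pi) - F \<phi>) has_real_derivative 0) (at x)" for x
    proof -
      have "((\<lambda>\<phi>. F (\<phi> + 2 * pi)) has_real_derivative g (x + 2 * pi) * 1) (at x)"
        by (rule DERIV_chain2[of F]) (auto intro!: F derivative_eq_intros)
      from DERIV_diff[OF this F[of x]] show ?thesis
        by (simp add: per)
    qed
    from DERIV_isconst_all[of "\<lambda>\<phi>. F (\<phi> + 2 * pi) - F \<phi>", of \<phi> 0] this show ?thesis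
      by simp
  qed
  have refl0: "F h + F (- h) = 2 * F 0" for h
  proof -
    have "((\<lambda>h. F h + F (- h)) has_real_derivative 0) (at x)" for x
    proof -
      have "((\<lambda>h. F (- h)) has_real_derivative g (- x) * (-1)) (at x)"
        by (rule DERIV_chain2[of F]) (auto intro!: F derivative_eq_intros)
      from DERIV_add[OF F[of x] this] show ?thesis
        by (simp add: even)
    qed
    from DERIV_isconst_all[of "\<lambda>h. F h + F (- h)", of h 0] this show ?thesis
      by simp
  qed
  define T where "T = F (2 * pi) - F 0"
  have shiftn: "F (\<phi> + 2 * pi * real n) = F \<phi> + real n * T" for n :: nat and \<phi>
  proof (induction n)
    case (Suc n)
    have "F (\<phi> + 2 * pi * real (Suc n)) = F ((\<phi> + 2 * pi * real n) + 2 * pi)"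
      by (simp add: algebra_simps)
    also have "\<dots> = F \<phi> + real (Suc n) * T"
      using Suc by (simp only: shift1) (simp add: T_def algebra_simps)
    finally show ?case .
  qed simp
  have shift: "F (\<phi> + 2 * pi * of_int n) = F \<phi> + of_int n * T" for n :: int and \<phi>
  proof (cases "n \<ge> 0")
    case True
    then show ?thesis
      using shiftn[of \<phi> "nat n"] by simp
  next
    case False
    have "F ((\<phi> + 2 * pi * of_int n) + 2 * pi * real (nat (- n))) = F (\<phi> + 2 * pi * of_int n) + real (nat (- n)) * T"
      by (rule shiftn)
    then show ?thesis
      using False by (simp add: algebra_simps)
  qed
  \<comment> \<open>Shifting from - \<pi> to \<pi> and reflecting in 0 shows that a full period is
    twice a half period.\<close>
  have T: "T = 2 * (F pi - F 0)"
    using shift[of "- pi" 1] refl0[of pi] by simp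
  show "F (\<phi> + 2 * pi * of_int n) = F \<phi> + of_int n * (2 * (F pi - F 0))"
    using shift T by simp
  show "F (of_int n * pi + h) + F (of_int n * pi - h) = 2 * F (of_int n * pi)"
  proof -
    have "F (of_int n * pi + h) = F ((- of_int n * pi + h) + 2 * pi * of_int n)"
      by (simp add: algebra_simps)
    also have "\<dots> = F (- of_int n * pi + h) + of_int n * T"
      by (rule shift)
    also have "F (- of_int n * pi + h) = 2 * F 0 - F (of_int n * pi - h)"
      using refl0[of "of_int n * pi - h"] by simp
    finally have 1: "F (of_int n * pi + h) + F (of_int n * pi - h) = 2 * F 0 + of_int n * T"
      by simp
    have "F (of_int n * pi) = F ((- of_int n * pi) + 2 * pi * of_int n)"
      by (simp add: algebra_simps)
    also have "\<dots> = F (- of_int n * pi) + of_int n * T"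
      by (rule shift)
    also have "F (- of_int n * pi) = 2 * F 0 - F (of_int n * pi)"
      using refl0[of "of_int n * pi"] by simp
    finally show ?thesis
      using 1 by simp
  qed
qed

section \<open>Lengths and completeness\<close>

lemmas has_vector_derivative_fst = bounded_linear.has_vector_derivative[OF bounded_linear_fst]
lemmas has_vector_derivative_snd = bounded_linear.has_vector_derivative[OF bounded_linear_snd]

lemma continuous_on_vector_derivative_within:
  assumes "\<And>x. x \<in> S \<Longrightarrow> (f has_vector_derivative f' x) (at x within S)"
  shows "continuous_on S f"
  using assms has_vector_derivative_continuous continuous_on_eq_continuous_within by blast

text \<open>\<open>V_field p\<close> is a unit vector, so |X|^2 splits into the part v along it,
  which the metric weights by 4 \<tau>^2 / \<kappa>, and a nonnegative rest of weight 1. Both bounds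
  express that the Berger and Euclidean norms are equivalent on the sphere.\<close>

lemma berger_metric_bounds:
  assumes "\<kappa> > 0" "p \<in> S3"
  shows "4 / \<kappa> * min 1 (4 * \<tau>^2 / \<kappa>) * (norm X)^2 \<le> berger_metric \<kappa> \<tau> p X X"
    and "berger_metric \<kappa> \<tau> p X X \<le> 4 / \<kappa> * max 1 (4 * \<tau>^2 / \<kappa>) * (norm X)^2"
proof -
  define \<beta> where "\<beta> = 4 * \<tau>^2 / \<kappa>"
  define v where "v = (X \<bullet> V_field p)^2"
  have "norm (V_field p) = 1"
    using assms(2) by (auto simp: V_field_def S3_def norm_Pair norm_mult)
  then have v: "0 \<le> v" "v \<le> (norm X)^2"
    using Cauchy_Schwarz_ineq2[of X "V_field p"] by (auto simp: v_def abs_le_square_iff[symmetric])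
  have g: "berger_metric \<kappa> \<tau> p X X = 4 / \<kappa> * ((norm X)^2 - v + \<beta> * v)"
    unfolding power2_norm_eq_inner
    by (simp add: berger_metric_def v_def \<beta>_def power2_eq_square algebra_simps)
  have "min 1 \<beta> * (norm X)^2 = min 1 \<beta> * ((norm X)^2 - v) + min 1 \<beta> * v"
    by (simp add: algebra_simps)
  also have "\<dots> \<le> 1 * ((norm X)^2 - v) + \<beta> * v"
    using v by (intro add_mono mult_right_mono) auto
  finally have lo: "min 1 \<beta> * (norm X)^2 \<le> (norm X)^2 - v + \<beta> * v"
    by simp
  have "1 * ((norm X)^2 - v) + \<beta> * v \<le> max 1 \<beta> * ((norm X)^2 - v) + max 1 \<beta> * v"
    using v by (intro add_mono mult_right_mono) auto
  then have hi: "(norm X)^2 - v + \<beta> * v \<le> max 1 \<beta> * (norm X)^2"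
    by (simp add: algebra_simps)
  show "4 / \<kappa> * min 1 (4 * \<tau>^2 / \<kappa>) * (norm X)^2 \<le> berger_metric \<kappa> \<tau> p X X"
    unfolding g mult.assoc using lo assms(1) by (intro mult_left_mono) (auto simp: \<beta>_def)
  show "berger_metric \<kappa> \<tau> p X X \<le> 4 / \<kappa> * max 1 (4 * \<tau>^2 / \<kappa>) * (norm X)^2"
    unfolding g mult.assoc using hi assms(1) by (intro mult_left_mono) (auto simp: \<beta>_def)
qed

lemma berger_length_nonneg:
  assumes "\<kappa> > 0" "\<And>u. u \<in> {0..1} \<Longrightarrow> c u \<in> S3"
  shows "berger_length \<kappa> \<tau> c \<ge> 0"
proof -
  have "berger_metric \<kappa> \<tau> (c u) (vector_derivative c (at u)) (vector_derivative c (at u)) \<ge> 0"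
    if "u \<in> {0..1}" for u
    using assms(1) by (intro order_trans[OF _ berger_metric_bounds(1)] assms that mult_nonneg_nonneg) auto
  \<comment> \<open>A non-integrable integrand has integral 0 by convention, which settles the
    irregular curves.\<close>
  then show ?thesis
    unfolding berger_length_def using assms(2)
    by (cases "(\<lambda>u. sqrt (berger_metric \<kappa> \<tau> (c u) (vector_derivative c (at u)) (vector_derivative c (at u))))
          integrable_on {0..1}")
       (auto simp: not_integrable_integral intro!: Henstock_Kurzweil_Integration.integral_nonneg)
qed

section \<open>Surfaces of rotation: regularity of the generating curve, and distance compared with
  the parameter\<close>

locale rot_surface =
  fixes \<gamma> :: "real \<Rightarrow> complex \<times> real" and I :: "real set"
  assumes surface: "invariant_surface \<gamma> I"
begin

text \<open>Derivatives are taken within I, so that end points on the axis have a velocity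
  too.\<close>

definition velocity :: "real \<Rightarrow> complex \<times> real" where
  "velocity s = vector_derivative \<gamma> (at s within I)"

definition acceleration :: "real \<Rightarrow> complex \<times> real" where
  "acceleration s = vector_derivative velocity (at s within I)"

lemma interval_I: "is_interval I" "convex I" and interior_I: "interior I \<noteq> {}"
  using surface is_interval_convex unfolding invariant_surface_def by auto

text \<open>I has interior points, hence is a nondegenerate interval and each of its points is a
  limit point. Derivatives within I are therefore unique.\<close>

lemma at_within_I: "s \<in> I \<Longrightarrow> at s within I \<noteq> bot"
proof -
  assume "s \<in> I"
  moreover obtain p where "p \<in> interior I"
    using interior_I by blast
  then obtain d where d: "d > 0" "ball p d \<subseteq> I"
    using mem_interior by blast
  have "p \<in> I" "p + d/2 \<in> I"
    using d(1) by (auto intro!: subsetD[OF d(2)] simp: dist_real_def)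
  then have "I \<noteq> {s}"
    using d(1) by auto
  moreover have "connected I"
    using interval_I is_interval_connected by blast
  ultimately have "s islimpt I"
    using connected_imp_perfect by blast
  then show ?thesis
    by (simp add: trivial_limit_within)
qed

text \<open>\<open>C2_on\<close> only asserts that some derivative functions exist; uniqueness
  within I identifies them with \<open>velocity\<close> and \<open>acceleration\<close>.\<close>

lemma derivatives:
  assumes "s \<in> I"
  shows velocity_derivative: "(\<gamma> has_vector_derivative velocity s) (at s within I)"
    and acceleration_derivative: "(velocity has_vector_derivative acceleration s) (at s within I)"
    and continuous_acceleration_aux: "continuous_on I acceleration"
proof -
  obtain \<gamma>1 \<gamma>2 where c: "continuous_on I \<gamma>2"
    and d: "\<And>s. s \<in> I \<Longrightarrow> (\<gamma> has_vector_derivative \<gamma>1 s) (at s within I)"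
      "\<And>s. s \<in> I \<Longrightarrow> (\<gamma>1 has_vector_derivative \<gamma>2 s) (at s within I)"
    using surface unfolding invariant_surface_def C2_on_def by blast
  have v: "velocity s = \<gamma>1 s" if "s \<in> I" for s
    unfolding velocity_def using vector_derivative_within[OF at_within_I[OF that] d(1)[OF that]] .
  have v': "(velocity has_vector_derivative \<gamma>2 s) (at s within I)" if "s \<in> I" for s
    using has_vector_derivative_transform[OF that v d(2)[OF that]] .
  have a: "acceleration s = \<gamma>2 s" if "s \<in> I" for s
    unfolding acceleration_def using vector_derivative_within[OF at_within_I[OF that] v'[OF that]] .
  show "(\<gamma> has_vector_derivative velocity s) (at s within I)"
    using d(1)[OF assms] v[OF assms] by simp
  show "(velocity has_vector_derivative acceleration s) (at s within I)"
    using v'[OF assms] a[OF assms] by simp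
  show "continuous_on I acceleration"
    using c a by (simp cong: continuous_on_cong)
qed

lemma continuous_acceleration: "continuous_on I acceleration"
  using continuous_acceleration_aux interior_I interior_subset by blast

lemma continuous_gamma: "continuous_on I \<gamma>" and continuous_velocity: "continuous_on I velocity"
  using velocity_derivative acceleration_derivative
  by (auto intro!: continuous_on_vector_derivative_within)

lemma norm_velocity: "s \<in> I \<Longrightarrow> norm (velocity s) = 1"
  using surface unfolding invariant_surface_def velocity_def by blast

lemma gamma_in:
  assumes "s \<in> I"
  shows "(cmod (fst (\<gamma> s)))^2 + (snd (\<gamma> s))^2 = 1" "snd (\<gamma> s) \<ge> 0"
  using surface assms unfolding invariant_surface_def half_sphere_def by auto

lemma axis_iff: "s \<in> I \<Longrightarrow> snd (\<gamma> s) = 0 \<longleftrightarrow> s \<notin> interior I"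
  using surface unfolding invariant_surface_def by blast

lemma interior_derivatives:
  assumes "s \<in> interior I"
  shows "(\<gamma> has_vector_derivative velocity s) (at s)"
    and "(velocity has_vector_derivative acceleration s) (at s)"
  using velocity_derivative acceleration_derivative assms interior_subset at_within_interior
  by (metis subsetD)+

lemma immersion_in_S3: "q \<in> surface_domain \<gamma> I \<Longrightarrow> immersion \<gamma> q \<in> S3"
  using gamma_in(1) by (auto simp: surface_domain_def immersion_def S3_def)

text \<open>The map from a surface point to its parameter s does not increase Euclidean length: the
  profile has unit speed, and the change of |w| accounts for the height component of its velocity.
  The constant comes from \<open>berger_metric_bounds\<close>. Hence a distance on the surface
  controls the distance of the parameters.\<close>

lemma berger_length_ge:
  assumes \<kappa>: "\<kappa> > 0"
    and c: "c C1_differentiable_on {0..1}" "c ` {0..1} \<subseteq> surface_domain \<gamma> I"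
  shows "sqrt (4 / \<kappa> * min 1 (4 * \<tau>^2 / \<kappa>)) * \<bar>fst (c 1) - fst (c 0)\<bar> \<le> berger_length \<kappa> \<tau> (immersion \<gamma> \<circ> c)"
proof -
  define m where "m = 4 / \<kappa> * min 1 (4 * \<tau>^2 / \<kappa>)"
  have m: "m \<ge> 0"
    using \<kappa> by (simp add: m_def)
  obtain D where D: "\<And>u. u \<in> {0..1} \<Longrightarrow> (c has_vector_derivative D u) (at u)" and contD: "continuous_on {0..1} D"
    using c(1) unfolding C1_differentiable_on_def by blast
  define \<sigma> w where "\<sigma> u = fst (c u)" and "w u = snd (c u)" for u
  have \<sigma>: "(\<sigma> has_vector_derivative fst (D u)) (at u)" and w: "(w has_vector_derivative snd (D u)) (at u)"
    if "u \<in> {0..1}" for u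
    unfolding \<sigma>_def[abs_def] w_def[abs_def]
    using has_vector_derivative_fst[OF D[OF that]] has_vector_derivative_snd[OF D[OF that]] by auto
  have dom: "\<sigma> u \<in> I" "cmod (w u) = snd (\<gamma> (\<sigma> u))" if "u \<in> {0..1}" for u
    using c(2) that by (auto simp: surface_domain_def \<sigma>_def w_def image_subset_iff case_prod_beta)
  define X where "X u = (fst (D u) *\<^sub>R fst (velocity (\<sigma> u)), snd (D u))" for u
  have deriv: "((immersion \<gamma> \<circ> c) has_vector_derivative X u) (at u within {0..1})" if u: "u \<in> {0..1}" for u
  proof -
    have "((\<gamma> \<circ> \<sigma>) has_vector_derivative fst (D u) *\<^sub>R velocity (\<sigma> u)) (at u within {0..1})"
    proof (rule vector_diff_chain_within)
      show "(\<sigma> has_vector_derivative fst (D u)) (at u within {0..1})"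
        using \<sigma>[OF u] has_vector_derivative_at_within by blast
      show "(\<gamma> has_vector_derivative velocity (\<sigma> u)) (at (\<sigma> u) within \<sigma> ` {0..1})"
        using velocity_derivative[OF dom(1)[OF u]] dom(1)
        by (auto intro: has_vector_derivative_within_subset)
    qed
    from has_vector_derivative_Pair[OF has_vector_derivative_fst[OF this]
        has_vector_derivative_at_within[OF w[OF u]]]
    show ?thesis
      by (simp add: immersion_def[abs_def] o_def \<sigma>_def w_def X_def)
  qed
  define f where "f u = sqrt (berger_metric \<kappa> \<tau> ((immersion \<gamma> \<circ> c) u) (X u) (X u))" for u
  have "continuous_on {0..1} \<sigma>"
    using \<sigma> by (meson continuous_at_imp_continuous_on has_vector_derivative_continuous)
  then have "continuous_on {0..1} X"
    unfolding X_def
    by (intro continuous_intros contD continuous_on_compose2[OF continuous_velocity]) (auto simp: dom)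
  moreover have "continuous_on {0..1} (immersion \<gamma> \<circ> c)"
    using deriv by (rule continuous_on_vector_derivative_within)
  moreover define \<zeta> where "\<zeta> = immersion \<gamma> \<circ> c"
  ultimately have cont: "continuous_on {0..1} X" "continuous_on {0..1} \<zeta>"
    by simp_all
  have "continuous_on {0..1} f"
    unfolding f_def \<zeta>_def[symmetric] berger_metric_def V_field_def
    by (intro continuous_on_real_sqrt continuous_on_mult continuous_on_add continuous_on_inner continuous_on_Pair
        continuous_on_fst continuous_on_snd continuous_on_const cont)
  then have f_int: "f integrable_on {0..1}"
    by (rule integrable_continuous_interval)
  have len: "berger_length \<kappa> \<tau> (immersion \<gamma> \<circ> c) = integral {0..1} f"
    unfolding berger_length_def
  proof (rule integral_spike)
    show "negligible {0::real, 1}"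
      by simp
    fix u :: real assume "u \<in> {0..1} - {0, 1}"
    then have u: "u \<in> {0<..<1}"
      by auto
    then have "(immersion \<gamma> \<circ> c has_vector_derivative X u) (at u)"
      using deriv[of u] at_within_interior[of u "{0..1::real}"] by simp
    then show "f u = sqrt (berger_metric \<kappa> \<tau> ((immersion \<gamma> \<circ> c) u)
        (vector_derivative (immersion \<gamma> \<circ> c) (at u)) (vector_derivative (immersion \<gamma> \<circ> c) (at u)))"
      by (simp add: f_def vector_derivative_at)
  qed
  have key: "\<bar>fst (D u)\<bar> \<le> norm (X u)" if u: "u \<in> {0<..<1}" for u
  proof -
    define d where "d = fst (D u)"
    have u': "u \<in> {0..1}"
      using u by auto
    \<comment> \<open>Off the axis this follows by differentiating |w|^2 = a(\<sigma>)^2, applying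
      Cauchy-Schwarz and dividing by the positive height.\<close>
    have "\<bar>snd (velocity (\<sigma> u)) * d\<bar> \<le> cmod (snd (D u))"
    proof (cases "\<sigma> u \<in> interior I")
      case True
      then have a_pos: "snd (\<gamma> (\<sigma> u)) > 0"
        using axis_iff[OF dom(1)[OF u']] gamma_in(2)[OF dom(1)[OF u']] by auto
      have 1: "((\<lambda>u. (cmod (w u))^2) has_vector_derivative 2 * (w u \<bullet> snd (D u))) (at u)"
      proof -
        have "((\<lambda>u. w u \<bullet> w u) has_vector_derivative w u \<bullet> snd (D u) + snd (D u) \<bullet> w u) (at u)"
          using bounded_bilinear.has_vector_derivative[OF bounded_bilinear_inner w[OF u'] w[OF u']] .
        then show ?thesis
          by (simp add: power2_norm_eq_inner inner_commute)
      qed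
      have "((\<gamma> \<circ> \<sigma>) has_vector_derivative d *\<^sub>R velocity (\<sigma> u)) (at u)"
        using vector_diff_chain_at[OF \<sigma>[OF u'] interior_derivatives(1)[OF True]] by (simp add: d_def)
      then have "((\<lambda>u. snd (\<gamma> (\<sigma> u))) has_vector_derivative d * snd (velocity (\<sigma> u))) (at u)"
        using has_vector_derivative_snd by (fastforce simp: o_def)
      then have 2: "((\<lambda>u. (snd (\<gamma> (\<sigma> u)))^2) has_vector_derivative 2 * (snd (\<gamma> (\<sigma> u)) * (d * snd (velocity (\<sigma> u))))) (at u)"
        unfolding has_real_derivative_iff_has_vector_derivative[symmetric]
        by (auto intro!: derivative_eq_intros)
      have 3: "((\<lambda>u. (cmod (w u))^2) has_vector_derivative 2 * (snd (\<gamma> (\<sigma> u)) * (d * snd (velocity (\<sigma> u))))) (at u)"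
        by (rule has_vector_derivative_transform_within_open[OF 2 open_greaterThanLessThan u])
           (use dom(2) in auto)
      have "w u \<bullet> snd (D u) = snd (\<gamma> (\<sigma> u)) * (d * snd (velocity (\<sigma> u)))"
        using vector_derivative_unique_at[OF 1 3] by simp
      then have "snd (\<gamma> (\<sigma> u)) * \<bar>snd (velocity (\<sigma> u)) * d\<bar> = \<bar>w u \<bullet> snd (D u)\<bar>"
        using a_pos by (simp add: abs_mult mult_ac)
      also have "\<dots> \<le> snd (\<gamma> (\<sigma> u)) * cmod (snd (D u))"
        using Cauchy_Schwarz_ineq2[of "w u" "snd (D u)"] dom(2)[OF u'] by simp
      finally show ?thesis
        using a_pos by simp
    next
      case False
      \<comment> \<open>A point on the axis lies over an end point of I, so \<sigma> has a local
        extremum at u and its derivative d vanishes.\<close>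
      have "(\<forall>r\<in>I. \<sigma> u \<le> r) \<or> (\<forall>r\<in>I. r \<le> \<sigma> u)"
      proof (rule ccontr)
        assume "\<not> ?thesis"
        then obtain r1 r2 where r: "r1 \<in> I" "r2 \<in> I" "r1 < \<sigma> u" "\<sigma> u < r2"
          by (metis linorder_not_le)
        then have "{r1<..<r2} \<subseteq> I"
          using mem_is_interval_1_I[OF interval_I(1) r(1,2)] by auto
        then show False
          using False r interior_maximal[of "{r1<..<r2}" I] by auto
      qed
      moreover have \<sigma>': "(\<sigma> has_real_derivative d) (at u)"
        using \<sigma>[OF u'] by (simp add: d_def has_real_derivative_iff_has_vector_derivative)
      define e where "e = min u (1 - u)"
      have e: "e > 0" "\<And>v. \<bar>u - v\<bar> < e \<Longrightarrow> \<sigma> v \<in> I"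
        using u dom(1) by (auto simp: e_def abs_less_iff)
      ultimately have "d = 0"
        using DERIV_local_min[OF \<sigma>' e(1)] DERIV_local_max[OF \<sigma>' e(1)] e(2) by blast
      then show ?thesis
        by simp
    qed
    then have "(snd (velocity (\<sigma> u)) * d)^2 \<le> (cmod (snd (D u)))^2"
      by (metis abs_le_square_iff abs_of_nonneg norm_ge_zero)
    moreover have "(cmod (fst (velocity (\<sigma> u))))^2 + (snd (velocity (\<sigma> u)))^2 = 1"
      using norm_velocity[OF dom(1)[OF u']] by (cases "velocity (\<sigma> u)") (simp add: norm_Pair)
    then have "d^2 * (cmod (fst (velocity (\<sigma> u))))^2 + (snd (velocity (\<sigma> u)) * d)^2 = d^2"
      by (simp add: power_mult_distrib) (metis distrib_left mult.commute mult.right_neutral)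
    ultimately have "d^2 \<le> (norm (X u))^2"
      by (simp add: X_def norm_Pair power_mult_distrib d_def)
    then show ?thesis
      by (simp add: abs_le_square_iff[symmetric] d_def)
  qed
  have f_ge: "\<bar>sqrt m * fst (D u)\<bar> \<le> f u" if u: "u \<in> {0<..<1}" for u
  proof -
    have "m * (fst (D u))^2 \<le> m * (norm (X u))^2"
      using key[OF u] m by (intro mult_left_mono) (auto simp: abs_le_square_iff[symmetric])
    also have "\<dots> \<le> berger_metric \<kappa> \<tau> ((immersion \<gamma> \<circ> c) u) (X u) (X u)"
      unfolding m_def using c(2) u \<kappa> by (intro berger_metric_bounds(1)) (auto intro!: immersion_in_S3)
    finally have "sqrt (m * (fst (D u))^2) \<le> f u"
      unfolding f_def by (rule real_sqrt_le_mono)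
    then show ?thesis
      using m by (simp add: real_sqrt_mult abs_mult)
  qed
  have D_int: "((\<lambda>u. fst (D u)) has_integral (\<sigma> 1 - \<sigma> 0)) {0..1}"
    by (rule fundamental_theorem_of_calculus) (auto intro!: has_vector_derivative_at_within \<sigma>)
  \<comment> \<open>The pointwise estimate is available only inside the unit interval, so h is
    altered at the two ends before comparing.\<close>
  have interior: "integral {0..1} h \<le> integral {0..1} f"
    if "h integrable_on {0..1}" "\<And>u. u \<in> {0<..<1} \<Longrightarrow> h u \<le> f u" for h :: "real \<Rightarrow> real"
  proof -
    define h' where "h' u = (if u \<in> {0<..<1} then h u else f u)" for u
    have "h' integrable_on {0..1}"
      by (rule integrable_spike[OF that(1), of "{0,1}"]) (auto simp: h'_def)
    moreover have "integral {0..1} h = integral {0..1} h'"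
      by (rule integral_spike[of "{0,1}"]) (auto simp: h'_def)
    ultimately show ?thesis
      using that(2) f_int by (auto intro!: integral_le simp: h'_def)
  qed
  have signed: "k * (\<sigma> 1 - \<sigma> 0) \<le> integral {0..1} f" if k: "\<bar>k\<bar> = sqrt m" for k
  proof -
    have int: "((\<lambda>u. k * fst (D u)) has_integral k * (\<sigma> 1 - \<sigma> 0)) {0..1}"
      by (rule has_integral_mult_right[OF D_int])
    have "k * fst (D u) \<le> f u" if "u \<in> {0<..<1}" for u
    proof -
      have "k * fst (D u) \<le> \<bar>sqrt m * fst (D u)\<bar>"
        using k by (metis abs_ge_self abs_mult abs_idempotent)
      then show ?thesis
        using f_ge[OF that] by linarith
    qed
    from interior[OF has_integral_integrable[OF int] this] show ?thesis
      by (simp only: integral_unique[OF int])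
  qed
  have "sqrt m * (\<sigma> 1 - \<sigma> 0) \<le> integral {0..1} f" "- sqrt m * (\<sigma> 1 - \<sigma> 0) \<le> integral {0..1} f"
    by (rule signed, simp add: m)+
  then have "\<bar>sqrt m * (\<sigma> 1 - \<sigma> 0)\<bar> \<le> integral {0..1} f"
    by (simp add: abs_le_iff)
  then show ?thesis
    using m len by (simp add: abs_mult m_def \<sigma>_def)
qed

text \<open>The quadratic \<sigma> arrives at s1 with speed 0 and turns back into I when continued
  past u = 1. The path is thereby two-sided differentiable at both ends, as
  \<open>C1_differentiable_on\<close> demands, even if s1 is an end point of I. The angle \<theta>
  reaches every point of the orbit over s1.\<close>

lemma surface_path:
  fixes \<theta> :: real
  assumes s0: "s0 \<in> interior I" and s1: "s1 \<in> I"
  defines "\<sigma> \<equiv> \<lambda>u. s1 - (1 - u)^2 * (s1 - s0)"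
  defines "c \<equiv> \<lambda>u. (\<sigma> u, of_real (snd (\<gamma> (\<sigma> u))) * cis (\<theta> * u))"
  shows "c C1_differentiable_on {0..1}" "c ` {0..1} \<subseteq> surface_domain \<gamma> I"
    and "c 0 = (s0, of_real (snd (\<gamma> s0)))" "c 1 = (s1, of_real (snd (\<gamma> s1)) * cis \<theta>)"
    and "\<And>u. u \<in> {0..1} \<Longrightarrow> ((\<lambda>u. \<gamma> (\<sigma> u)) has_vector_derivative (2 * (1 - u) * (s1 - s0)) *\<^sub>R velocity (\<sigma> u)) (at u)"
proof -
  have \<sigma>: "(\<sigma> has_real_derivative 2 * (1 - u) * (s1 - s0)) (at u)" for u
    unfolding \<sigma>_def by (auto intro!: derivative_eq_intros simp: algebra_simps)
  have int: "\<sigma> u \<in> interior I" if "u \<in> {0..<1}" for u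
  proof -
    have "(1 - u)^2 \<le> 1"
      using that by (intro power_le_one) auto
    then show ?thesis
      using mem_interior_convex_shrink[OF interval_I(2) s0 s1, of "(1 - u)^2"] that
      by (simp add: \<sigma>_def)
  qed
  have "\<exists>V. open V \<and> u \<in> V \<and> \<sigma> ` V \<subseteq> I" if u: "u \<in> {0..1}" for u
  proof (cases "u < 1")
    case True
    have "continuous_on UNIV \<sigma>"
      unfolding \<sigma>_def by (intro continuous_intros)
    then have "open (\<sigma> -` interior I)"
      by (simp add: open_vimage)
    then show ?thesis
      using int[of u] True u interior_subset by (intro exI[of _ "\<sigma> -` interior I"]) auto
  next
    case False
    have "\<sigma> v \<in> I" if v: "v \<in> {1/2<..<3/2}" for v
    proof -
      have "\<bar>1 - v\<bar> \<le> 1"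
        using v by auto
      then have "(1 - v)^2 \<le> 1"
        by (simp add: abs_square_le_1)
      moreover have "s0 \<in> I"
        using s0 interior_subset by blast
      ultimately have "(1 - (1 - v)^2) *\<^sub>R s1 + (1 - v)^2 *\<^sub>R s0 \<in> I"
        using s1 interval_I(2) by (intro convexD) auto
      then show ?thesis
        by (simp add: \<sigma>_def algebra_simps)
    qed
    then show ?thesis
      using False u by (intro exI[of _ "{1/2<..<3/2}"]) auto
  qed
  then obtain V where V: "\<And>u. u \<in> {0..1} \<Longrightarrow> open (V u) \<and> u \<in> V u \<and> \<sigma> ` V u \<subseteq> I"
    by metis
  have \<sigma>_I: "\<sigma> u \<in> I" if "u \<in> {0..1}" for u
    using V[OF that] by blast
  show \<gamma>\<sigma>: "((\<lambda>u. \<gamma> (\<sigma> u)) has_vector_derivative (2 * (1 - u) * (s1 - s0)) *\<^sub>R velocity (\<sigma> u)) (at u)"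
    if u: "u \<in> {0..1}" for u
  proof -
    have "((\<gamma> \<circ> \<sigma>) has_vector_derivative (2 * (1 - u) * (s1 - s0)) *\<^sub>R velocity (\<sigma> u)) (at u within V u)"
    proof (rule vector_diff_chain_within)
      show "(\<sigma> has_vector_derivative 2 * (1 - u) * (s1 - s0)) (at u within V u)"
        using \<sigma> has_real_derivative_iff_has_vector_derivative has_vector_derivative_at_within by blast
      show "(\<gamma> has_vector_derivative velocity (\<sigma> u)) (at (\<sigma> u) within \<sigma> ` V u)"
        using velocity_derivative[OF \<sigma>_I[OF u]] V[OF u] has_vector_derivative_within_subset by blast
    qed
    moreover have "at u within V u = at u"
      using V[OF u] at_within_open by blast
    ultimately show ?thesis
      by (simp only: o_def)
  qed
  show "c C1_differentiable_on {0..1}"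
    unfolding C1_differentiable_on_def
  proof (intro exI conjI ballI)
    fix u :: real assume u: "u \<in> {0..1}"
    have a: "((\<lambda>u. snd (\<gamma> (\<sigma> u))) has_real_derivative 2 * (1 - u) * (s1 - s0) * snd (velocity (\<sigma> u))) (at u)"
      using has_vector_derivative_snd[OF \<gamma>\<sigma>[OF u]] by (simp add: has_real_derivative_iff_has_vector_derivative)
    have th: "((\<lambda>u. \<theta> * u) has_real_derivative \<theta>) (at u)"
      by (auto intro!: derivative_eq_intros)
    show "(c has_vector_derivative (2 * (1 - u) * (s1 - s0),
        of_real (snd (\<gamma> (\<sigma> u))) * (of_real \<theta> * \<i> * cis (\<theta> * u))
          + of_real (2 * (1 - u) * (s1 - s0) * snd (velocity (\<sigma> u))) * cis (\<theta> * u))) (at u)"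
      unfolding c_def
      using \<sigma>[of u, unfolded has_real_derivative_iff_has_vector_derivative]
      by (intro has_vector_derivative_Pair has_vector_derivative_mult has_vector_derivative_of_real
          has_vector_derivative_cis a th)
  next
    have cont_\<sigma>: "continuous_on {0..1} \<sigma>"
      unfolding \<sigma>_def by (intro continuous_intros)
    have "continuous_on {0..1} (\<lambda>u. velocity (\<sigma> u))" "continuous_on {0..1} (\<lambda>u. \<gamma> (\<sigma> u))"
      using \<sigma>_I by (auto intro!: continuous_on_compose2[OF continuous_velocity cont_\<sigma>]
          continuous_on_compose2[OF continuous_gamma cont_\<sigma>])
    then show "continuous_on {0..1} (\<lambda>u. (2 * (1 - u) * (s1 - s0),
        of_real (snd (\<gamma> (\<sigma> u))) * (of_real \<theta> * \<i> * cis (\<theta> * u))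
          + of_real (2 * (1 - u) * (s1 - s0) * snd (velocity (\<sigma> u))) * cis (\<theta> * u)))"
      by (intro continuous_intros)
  qed
  show "c ` {0..1} \<subseteq> surface_domain \<gamma> I"
    using \<sigma>_I gamma_in(2) by (auto simp: c_def surface_domain_def norm_mult)
  show "c 0 = (s0, of_real (snd (\<gamma> s0)))" "c 1 = (s1, of_real (snd (\<gamma> s1)) * cis \<theta>)"
    by (auto simp: c_def \<sigma>_def)
qed

text \<open>Below, every competing path satisfies \<open>berger_length_ge\<close>. Above, the path
  of \<open>surface_path\<close> with \<theta> = 0 is a competitor; the factor 2 bounds the
  derivative 2 (1 - u) of its parametrisation.\<close>

lemma surface_dist_bounds:
  assumes \<kappa>: "\<kappa> > 0" and s0: "s0 \<in> interior I"
  shows surface_dist_ge: "q \<in> surface_domain \<gamma> I \<Longrightarrow>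
      sqrt (4 / \<kappa> * min 1 (4 * \<tau>^2 / \<kappa>)) * \<bar>fst q - s0\<bar>
        \<le> surface_dist \<kappa> \<tau> \<gamma> I (s0, of_real (snd (\<gamma> s0))) q" (is "_ \<Longrightarrow> ?ge q")
    and surface_dist_le: "s1 \<in> I \<Longrightarrow>
      surface_dist \<kappa> \<tau> \<gamma> I (s0, of_real (snd (\<gamma> s0))) (s1, of_real (snd (\<gamma> s1)))
        \<le> 2 * sqrt (4 / \<kappa> * max 1 (4 * \<tau>^2 / \<kappa>)) * \<bar>s1 - s0\<bar>" (is "_ \<Longrightarrow> ?le s1")
proof -
  define paths where "paths q = {c. c C1_differentiable_on {0..1} \<and> c ` {0..1} \<subseteq> surface_domain \<gamma> I \<and>
      c 0 = (s0, complex_of_real (snd (\<gamma> s0))) \<and> c 1 = q}" for q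
  have dist: "surface_dist \<kappa> \<tau> \<gamma> I (s0, of_real (snd (\<gamma> s0))) q
      = Inf ((\<lambda>c. berger_length \<kappa> \<tau> (immersion \<gamma> \<circ> c)) ` paths q)" for q
    unfolding surface_dist_def paths_def by (rule arg_cong[of _ _ Inf]) blast
  show "?ge q" if q: "q \<in> surface_domain \<gamma> I"
  proof -
    have q1: "fst q \<in> I" "snd q = of_real (snd (\<gamma> (fst q))) * cis (Arg (snd q))"
      using q rcis_cmod_Arg[of "snd q"] by (auto simp: surface_domain_def rcis_def)
    then have q2: "q = (fst q, of_real (snd (\<gamma> (fst q))) * cis (Arg (snd q)))"
      by (simp add: prod_eq_iff)
    \<comment> \<open>An infimum of reals bounds nothing if the set is empty, so some connecting
      path must be exhibited.\<close>
    have "paths q \<noteq> {}"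
    proof -
      note path = surface_path(1-4)[OF s0 q1(1), where \<theta>="Arg (snd q)"]
      show ?thesis
        using path(1-3) path(4)[folded q2] unfolding paths_def by blast
    qed
    then show ?thesis
      unfolding dist
    proof (intro cINF_greatest)
      fix c assume "c \<in> paths q"
      then have "c C1_differentiable_on {0..1}" "c ` {0..1} \<subseteq> surface_domain \<gamma> I" "fst (c 0) = s0" "c 1 = q"
        by (auto simp: paths_def)
      then show "sqrt (4 / \<kappa> * min 1 (4 * \<tau>^2 / \<kappa>)) * \<bar>fst q - s0\<bar> \<le> berger_length \<kappa> \<tau> (immersion \<gamma> \<circ> c)"
        using berger_length_ge[OF \<kappa>, of c \<tau>] by simp
    qed auto
  qed
  show "?le s1" if s1: "s1 \<in> I"
  proof -
    define \<sigma> where "\<sigma> u = s1 - (1 - u)^2 * (s1 - s0)" for u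
    define c where "c u = (\<sigma> u, complex_of_real (snd (\<gamma> (\<sigma> u))))" for u
    define M where "M = 4 / \<kappa> * max 1 (4 * \<tau>^2 / \<kappa>)"
    have M: "M \<ge> 0"
      using \<kappa> by (simp add: M_def)
    note path = surface_path(1-4)[OF s0 s1, where \<theta>=0] and path_deriv = surface_path(5)[OF s0 s1]
    have c: "c \<in> paths (s1, of_real (snd (\<gamma> s1)))"
      using path(1-4) by (simp add: paths_def c_def[abs_def] \<sigma>_def)
    have "bdd_below ((\<lambda>c. berger_length \<kappa> \<tau> (immersion \<gamma> \<circ> c)) ` paths (s1, of_real (snd (\<gamma> s1))))"
      using \<kappa> by (intro bdd_belowI2[of _ 0] berger_length_nonneg) (auto simp: paths_def intro!: immersion_in_S3)
    then have "surface_dist \<kappa> \<tau> \<gamma> I (s0, of_real (snd (\<gamma> s0))) (s1, of_real (snd (\<gamma> s1)))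
        \<le> berger_length \<kappa> \<tau> (immersion \<gamma> \<circ> c)"
      unfolding dist using c by (rule cINF_lower)
    also have "\<dots> \<le> 2 * sqrt M * \<bar>s1 - s0\<bar>"
    proof -
      define f where "f u = sqrt (berger_metric \<kappa> \<tau> ((immersion \<gamma> \<circ> c) u)
          (vector_derivative (immersion \<gamma> \<circ> c) (at u)) (vector_derivative (immersion \<gamma> \<circ> c) (at u)))" for u
      have "f u \<le> 2 * sqrt M * \<bar>s1 - s0\<bar>" if u: "u \<in> {0..1}" for u
      proof -
        define k where "k = 2 * (1 - u) * (s1 - s0)"
        define X where "X = (k *\<^sub>R fst (velocity (\<sigma> u)), complex_of_real (k * snd (velocity (\<sigma> u))))"
        have d: "((\<lambda>u. \<gamma> (\<sigma> u)) has_vector_derivative k *\<^sub>R velocity (\<sigma> u)) (at u)"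
          using path_deriv[OF u] by (simp add: \<sigma>_def[abs_def] k_def)
        have "((\<lambda>u. complex_of_real (snd (\<gamma> (\<sigma> u)))) has_vector_derivative of_real (k * snd (velocity (\<sigma> u)))) (at u)"
          using has_vector_derivative_snd[OF d]
          by (intro has_vector_derivative_of_real) (simp add: has_real_derivative_iff_has_vector_derivative)
        from has_vector_derivative_Pair[OF has_vector_derivative_fst[OF d] this]
        have "((immersion \<gamma> \<circ> c) has_vector_derivative X) (at u)"
          by (simp add: o_def immersion_def c_def X_def)
        then have f: "f u = sqrt (berger_metric \<kappa> \<tau> ((immersion \<gamma> \<circ> c) u) X X)"
          by (simp add: f_def vector_derivative_at)
        have c_dom: "c u \<in> surface_domain \<gamma> I"
          using c u by (auto simp: paths_def)
        then have "\<sigma> u \<in> I"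
          by (auto simp: surface_domain_def c_def)
        have "(norm X)^2 = k^2 * ((cmod (fst (velocity (\<sigma> u))))^2 + (snd (velocity (\<sigma> u)))^2)"
          unfolding X_def norm_Pair norm_scaleR norm_of_real
          by (simp add: power_mult_distrib algebra_simps)
        also have "\<dots> = k^2"
          using norm_velocity[OF \<open>\<sigma> u \<in> I\<close>] by (cases "velocity (\<sigma> u)") (simp add: norm_Pair)
        also have "\<dots> \<le> (2 * \<bar>s1 - s0\<bar>)^2"
          using u by (subst abs_le_square_iff[symmetric]) (auto simp: k_def abs_mult intro!: mult_right_mono)
        finally have X: "(norm X)^2 \<le> (2 * \<bar>s1 - s0\<bar>)^2" .
        have "berger_metric \<kappa> \<tau> ((immersion \<gamma> \<circ> c) u) X X \<le> M * (norm X)^2"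
          unfolding M_def using immersion_in_S3[OF c_dom] by (intro berger_metric_bounds \<kappa>) simp
        also have "\<dots> \<le> M * (2 * \<bar>s1 - s0\<bar>)^2"
          by (rule mult_left_mono[OF X M])
        finally have "f u \<le> sqrt (M * (2 * \<bar>s1 - s0\<bar>)^2)"
          unfolding f by (rule real_sqrt_le_mono)
        then show ?thesis
          by (simp add: real_sqrt_mult)
      qed
      then have "integral {0..1} f \<le> 2 * sqrt M * \<bar>s1 - s0\<bar>" if "f integrable_on {0..1}"
        using integral_le[OF that integrable_const_ivl, of "2 * sqrt M * \<bar>s1 - s0\<bar>"] by simp
      moreover have "0 \<le> 2 * sqrt M * \<bar>s1 - s0\<bar>"
        using M by simp
      ultimately show ?thesis
        unfolding berger_length_def f_def[symmetric] using not_integrable_integral[of f "{0..1}"] by fastforce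
    qed
    finally show ?thesis
      by (simp add: M_def)
  qed
qed

text \<open>Parameters converging to a boundary point of I lift to a Cauchy sequence by the upper
  distance bound. Its limit on the surface lies over the limit parameter by the lower bound, so that
  parameter belongs to I.\<close>

lemma complete_imp_closed:
  assumes \<kappa>: "\<kappa> > 0" "\<tau> \<noteq> 0" and complete: "complete_surface \<kappa> \<tau> \<gamma> I"
  shows "closed I"
proof -
  have "l \<in> I" if l: "l \<in> closure I" for l
  proof -
    obtain s0 where s0: "s0 \<in> interior I"
      using interior_I by blast
    \<comment> \<open>Approaching l along the segment from s0 keeps every term in the interior of I,
      where the distance bounds have their base point.\<close>
    define r where "r n = l - inverse (real (Suc n)) * (l - s0)" for n
    have r_int: "r n \<in> interior I" for n
      using mem_interior_closure_convex_shrink[OF interval_I(2) s0 l, of "inverse (real (Suc n))"]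
      by (simp add: r_def inverse_le_1_iff)
    then have r_I: "r n \<in> I" for n
      using interior_subset by blast
    have r_lim: "r \<longlonglongrightarrow> l"
    proof -
      have "(\<lambda>n. l - inverse (real (Suc n)) * (l - s0)) \<longlonglongrightarrow> l - 0 * (l - s0)"
        by (intro tendsto_intros LIMSEQ_inverse_real_of_nat)
      then show ?thesis
        by (simp add: r_def[abs_def])
    qed
    define p where "p n = (r n, complex_of_real (snd (\<gamma> (r n))))" for n
    define M where "M = 2 * sqrt (4 / \<kappa> * max 1 (4 * \<tau>^2 / \<kappa>))"
    have M: "M > 0"
      using \<kappa> by (simp add: M_def)
    have p_dom: "p n \<in> surface_domain \<gamma> I" for n
      using r_I gamma_in(2) by (simp add: p_def surface_domain_def)
    have cauchy: "\<exists>K. \<forall>m\<ge>K. \<forall>n\<ge>K. surface_dist \<kappa> \<tau> \<gamma> I (p m) (p n) < \<epsilon>" if "\<epsilon> > 0" for \<epsilon>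
    proof -
      have "Cauchy r"
        using r_lim LIMSEQ_imp_Cauchy by blast
      then obtain K where K: "\<And>m n. m \<ge> K \<Longrightarrow> n \<ge> K \<Longrightarrow> dist (r m) (r n) < \<epsilon> / M"
        using metric_CauchyD[of r "\<epsilon> / M"] M \<open>\<epsilon> > 0\<close> by (metis divide_pos_pos)
      have "surface_dist \<kappa> \<tau> \<gamma> I (p m) (p n) < \<epsilon>" if "m \<ge> K" "n \<ge> K" for m n
      proof -
        have "surface_dist \<kappa> \<tau> \<gamma> I (p m) (p n) \<le> M * \<bar>r n - r m\<bar>"
          using surface_dist_le[OF \<kappa>(1) r_int r_I] by (simp add: p_def M_def)
        also have "\<dots> < \<epsilon>"
          using K[OF that] M by (simp add: dist_real_def field_simps abs_minus_commute)
        finally show ?thesis .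
      qed
      then show ?thesis
        by blast
    qed
    obtain q where q: "q \<in> surface_domain \<gamma> I" "(\<lambda>n. surface_dist \<kappa> \<tau> \<gamma> I (p n) q) \<longlonglongrightarrow> 0"
      using complete p_dom cauchy unfolding complete_surface_def by blast
    define m where "m = sqrt (4 / \<kappa> * min 1 (4 * \<tau>^2 / \<kappa>))"
    have m: "m > 0"
      using \<kappa> by (simp add: m_def)
    have "(\<lambda>n. m * \<bar>fst q - r n\<bar>) \<longlonglongrightarrow> 0"
    proof (rule tendsto_sandwich[OF _ _ tendsto_const q(2)])
      show "\<forall>\<^sub>F n in sequentially. 0 \<le> m * \<bar>fst q - r n\<bar>"
        using m by simp
      show "\<forall>\<^sub>F n in sequentially. m * \<bar>fst q - r n\<bar> \<le> surface_dist \<kappa> \<tau> \<gamma> I (p n) q"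
        using surface_dist_ge[OF \<kappa>(1) r_int q(1)] by (simp add: p_def m_def)
    qed
    moreover have "(\<lambda>n. m * \<bar>fst q - r n\<bar>) \<longlonglongrightarrow> m * \<bar>fst q - l\<bar>"
      by (intro tendsto_intros r_lim)
    ultimately have "m * \<bar>fst q - l\<bar> = 0"
      using LIMSEQ_unique by blast
    then show ?thesis
      using m q(1) by (auto simp: surface_domain_def)
  qed
  then show ?thesis
    using closure_subset_eq by blast
qed

end

section \<open>The energy in polar coordinates\<close>

locale cmc_params =
  fixes \<kappa> \<tau> H E :: real
  assumes \<kappa>: "\<kappa> > 0" and \<tau>: "\<tau> \<noteq> 0" and H: "H \<ge> 0"
begin

text \<open>With \<open>t = sin\<^sup>2 x\<close>, the equation of the energy turns into
  \<open>(1 - t) Q t cos\<^sup>2 \<alpha> = P t\<close>.  The zeros of \<open>P\<close> are \<open>mid \<plusminus> rad\<close>.\<close>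

definition \<beta> :: real where "\<beta> = 4 * \<tau>^2 / \<kappa>"
definition e :: "real \<Rightarrow> real" where "e t = E + H * t"
definition P :: "real \<Rightarrow> real" where "P t = t * (1 - t) - 4 / \<kappa> * (e t)^2"
definition Q :: "real \<Rightarrow> real" where "Q t = t - (\<beta> - 1) * (e t)^2 / \<tau>^2"
definition disc :: real where "disc = \<kappa>^2 - 16 * \<kappa> * E * (H + E)"
definition mid :: real where "mid = (\<kappa> - 8 * H * E) / (2 * (4 * H^2 + \<kappa>))"
definition rad :: real where "rad = sqrt disc / (2 * (4 * H^2 + \<kappa>))"

lemma \<beta>: "\<beta> > 0"
  using \<kappa> \<tau> by (simp add: \<beta>_def)

lemma \<tau>2: "\<tau>^2 = \<beta> * \<kappa> / 4"
  using \<kappa> by (simp add: \<beta>_def)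

lemma lead_pos: "4 * H^2 + \<kappa> > 0"
  using \<kappa> by (simp add: add_nonneg_pos)

text \<open>Completing the square. The constant is written with \<open>disc\<close> rather than
  \<open>rad\<close>, since the sign of \<open>disc\<close> becomes known only from the existence of
  a point with P \<ge> 0.\<close>

lemma P_disc: "P t = (4 * H^2 + \<kappa>) / \<kappa> * (disc / (4 * (4 * H^2 + \<kappa>)^2) - (t - mid)^2)"
proof -
  define A where "A = 4 * H^2 + \<kappa>"
  have A: "A > 0"
    using lead_pos by (simp add: A_def)
  have "\<kappa> * P t * A = disc / 4 - A^2 * (t - mid)^2"
  proof -
    define b where "b = (\<kappa> - 8 * H * E) / 2"
    have "A * (t - mid) = A * t - b"
      unfolding mid_def A_def[symmetric] b_def using A by (simp add: field_simps)
    then have sq: "A^2 * (t - mid)^2 = (A * t - b)^2"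
      by (metis power_mult_distrib)
    have "\<kappa> * P t = \<kappa> * t * (1 - t) - 4 * (E + H * t)^2"
      using \<kappa> by (simp add: P_def e_def field_simps)
    then have \<kappa>P: "\<kappa> * P t = 2 * b * t - A * t^2 - 4 * E^2"
      by (simp add: A_def b_def power2_eq_square algebra_simps)
    have "disc / 4 - b^2 = - 4 * E^2 * A"
      by (simp add: disc_def b_def A_def power2_eq_square field_simps)
    then have d4: "disc / 4 = b^2 - 4 * E^2 * A"
      by simp
    show ?thesis
      unfolding \<kappa>P d4 sq by (simp add: power2_eq_square algebra_simps)
  qed
  then have "P t = (disc / 4 - A^2 * (t - mid)^2) / (\<kappa> * A)"
    using A \<kappa> by (metis less_irrefl mult.assoc mult.commute mult_eq_0_iff nonzero_mult_div_cancel_left)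
  also have "\<dots> = A / \<kappa> * (disc / (4 * A^2) - (t - mid)^2)"
    using A \<kappa> by (simp add: right_diff_distrib diff_divide_distrib power2_eq_square)
  finally show ?thesis
    unfolding A_def .
qed

lemma P_rad:
  assumes "disc \<ge> 0"
  shows "P t = (4 * H^2 + \<kappa>) / \<kappa> * (rad^2 - (t - mid)^2)"
  using assms by (simp add: P_disc rad_def power_divide) (simp add: power2_eq_square algebra_simps)

lemma P_nonneg_disc: "P t \<ge> 0 \<Longrightarrow> disc \<ge> 0"
proof (rule ccontr)
  assume "P t \<ge> 0" "\<not> disc \<ge> 0"
  then have "disc / (4 * (4 * H^2 + \<kappa>)^2) - (t - mid)^2 < 0"
    using divide_neg_pos[of disc "4 * (4 * H^2 + \<kappa>)^2"] lead_pos zero_le_power2[of "t - mid"]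
    by (smt (verit) zero_less_power mult_pos_pos)
  then have "P t < 0"
    unfolding P_disc using lead_pos \<kappa> by (intro mult_pos_neg) auto
  then show False
    using \<open>P t \<ge> 0\<close> by simp
qed

lemma P_nonneg_iff:
  assumes "disc \<ge> 0"
  shows "P t \<ge> 0 \<longleftrightarrow> t \<in> {mid - rad..mid + rad}"
proof -
  have "P t \<ge> 0 \<longleftrightarrow> (t - mid)^2 \<le> rad^2"
  proof -
    have "(4 * H^2 + \<kappa>) / \<kappa> > 0"
      using lead_pos \<kappa> by simp
    then show ?thesis
      unfolding P_rad[OF assms] by (simp only: zero_le_mult_iff) auto
  qed
  moreover have "rad \<ge> 0"
    using assms lead_pos by (simp add: rad_def)
  ultimately show ?thesis
    using abs_le_square_iff[of "t - mid" rad] by auto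
qed

text \<open>With q = (e t)^2 / \<tau>^2, the condition P \<ge> 0 says \<beta> q \<le> t (1 - t),
  hence 0 \<le> q \<le> t / \<beta>. The two forms Q = t + (1 - \<beta>) q and Q = t / \<beta> +
  (\<beta> - 1) (t / \<beta> - q) then give the bounds according to the sign of \<beta> - 1. So t /
  Q t stays between positive constants near the axis.\<close>

lemma Q_bounds:
  assumes "t \<in> {0..1}" "P t \<ge> 0"
  shows "t * min 1 (1 / \<beta>) \<le> Q t" "Q t \<le> t * max 1 (1 / \<beta>)"
proof -
  define q where "q = (e t)^2 / \<tau>^2"
  have q0: "q \<ge> 0"
    by (simp add: q_def)
  have "(e t)^2 \<le> \<kappa> / 4 * (t * (1 - t))"
    using assms(2) \<kappa> by (simp add: P_def field_simps)
  then have "\<beta> * q \<le> t * (1 - t)"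
    unfolding q_def \<tau>2 using \<kappa> \<beta> by (simp add: field_simps)
  also have "\<dots> \<le> t"
    using assms(1) by (simp add: mult_left_le)
  finally have q: "\<beta> * q \<le> t" .
  then have q': "q \<le> t / \<beta>"
    using \<beta> by (simp add: field_simps)
  have Q: "Q t = t - \<beta> * q + q"
    by (simp add: Q_def q_def) (simp add: algebra_simps diff_divide_distrib)
  have "(\<beta> - 1) * (t / \<beta> - q) = t - t / \<beta> - \<beta> * q + q"
    using \<beta> by (simp add: field_simps)
  then have Q2: "Q t = t / \<beta> + (\<beta> - 1) * (t / \<beta> - q)"
    using Q by simp
  have Q3: "Q t = t + (1 - \<beta>) * q"
    using Q by (simp add: algebra_simps)
  have t: "t \<ge> 0"
    using assms(1) by simp
  show "t * min 1 (1 / \<beta>) \<le> Q t"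
  proof (cases "\<beta> \<ge> 1")
    case True
    then have "Q t \<ge> t / \<beta>"
      using Q2 q' by simp
    moreover have "t * min 1 (1 / \<beta>) \<le> t * (1 / \<beta>)"
      using t by (intro mult_left_mono) auto
    ultimately show ?thesis
      by simp
  next
    case False
    then have "Q t \<ge> t"
      using Q3 q0 by simp
    moreover have "t * min 1 (1 / \<beta>) \<le> t * 1"
      using t by (intro mult_left_mono) auto
    ultimately show ?thesis
      by simp
  qed
  show "Q t \<le> t * max 1 (1 / \<beta>)"
  proof (cases "\<beta> \<ge> 1")
    case True
    then have "(1 - \<beta>) * q \<le> 0"
      using q0 by (intro mult_nonpos_nonneg) auto
    moreover have "t * 1 \<le> t * max 1 (1 / \<beta>)"
      using t by (intro mult_left_mono) auto
    ultimately show ?thesis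
      using Q3 by simp
  next
    case False
    then have "(\<beta> - 1) * (t / \<beta> - q) \<le> 0"
      using q' by (intro mult_nonpos_nonneg) auto
    moreover have "t * (1 / \<beta>) \<le> t * max 1 (1 / \<beta>)"
      using t by (intro mult_left_mono) auto
    ultimately show ?thesis
      using Q2 by simp
  qed
qed

lemma Q_pos: "t \<in> {0<..1} \<Longrightarrow> P t \<ge> 0 \<Longrightarrow> Q t > 0"
  using Q_bounds(1)[of t] \<beta> by (smt (verit) atLeastAtMost_iff divide_pos_pos greaterThanAtMost_iff mult_pos_pos)

definition energy_at :: "real \<Rightarrow> real \<Rightarrow> bool" where
  "energy_at x \<alpha> \<longleftrightarrow> \<tau> * sin x * normal_C_tan \<kappa> \<tau> x \<alpha> - H * (sin x)^2 = E"

context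
  fixes x \<alpha> :: real
  assumes x: "0 < x" "x < pi / 2" and en: "energy_at x \<alpha>"
begin

private abbreviation (input) t where "t \<equiv> (sin x)^2"

private lemma trig: "sin x > 0" "cos x > 0" "t > 0" "t < 1" "(cos x)^2 = 1 - t"
proof -
  show 1: "sin x > 0" "cos x > 0"
    using x by (auto intro: sin_gt_zero cos_gt_zero)
  show c: "(cos x)^2 = 1 - t"
    by (rule cos_squared_eq)
  have "(cos x)^2 > 0"
    using 1 by (intro zero_less_power)
  then show "t < 1"
    unfolding c by linarith
  show "t > 0"
    using 1 by simp
qed

text \<open>Clears the denominator of the energy. The last bound drops the cos^2 \<alpha> term under
  the root and is what turns the energy into P \<ge> 0.\<close>

private lemma root:
  defines "r \<equiv> normal_root \<kappa> \<tau> x \<alpha>"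
  shows root_pos: "r > 0" and root_sq: "r^2 = (1 - t + \<beta> * t) + (sin \<alpha>)^2 * (1 - t) * (\<beta> - 1)"
    and energy_root: "e t * r = \<tau> * sin x * cos x * sin \<alpha>"
    and root_ge: "\<beta> * (sin \<alpha>)^2 \<le> r^2"
proof -
  define r2 where "r2 = (cos \<alpha>)^2 * ((cos x)^2 + \<beta> * t) + \<beta> * (sin \<alpha>)^2"
  have r: "r = sqrt r2"
    unfolding r_def normal_root_def r2_def \<beta>_def by simp
  have pos: "(cos x)^2 + \<beta> * t > 0"
    using trig \<beta> by (simp add: add_pos_pos)
  have r2: "r2 > 0"
  proof (cases "sin \<alpha> = 0")
    case True
    then have "(cos \<alpha>)^2 = 1"
      using sin_cos_squared_add[of \<alpha>] by simp
    then show ?thesis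
      using pos True by (simp add: r2_def)
  next
    case False
    then show ?thesis
      unfolding r2_def using pos \<beta> by (intro add_nonneg_pos) auto
  qed
  then show "r > 0"
    using r by simp
  have rsq: "r^2 = r2"
    using r r2 by simp
  then show "r^2 = (1 - t + \<beta> * t) + (sin \<alpha>)^2 * (1 - t) * (\<beta> - 1)"
    unfolding r2_def trig(5) by (simp add: cos_squared_eq[of \<alpha>] algebra_simps)
  show "\<beta> * (sin \<alpha>)^2 \<le> r^2"
    unfolding rsq r2_def using pos by simp
  have "\<tau> * sin x * (cos x * sin \<alpha> / r) = e t"
    using en unfolding energy_at_def normal_C_tan_def r_def[symmetric] e_def by simp
  then show "e t * r = \<tau> * sin x * cos x * sin \<alpha>"
    using \<open>r > 0\<close> by (simp add: field_simps)
qed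

private lemma energy_sq: "(e t)^2 * (normal_root \<kappa> \<tau> x \<alpha>)^2 = \<tau>^2 * t * (1 - t) * (sin \<alpha>)^2"
  using arg_cong[OF energy_root, of "\<lambda>u. u^2"] trig(5) by (simp add: power_mult_distrib)

text \<open>Positivity of \<open>Q\<close> is itself deduced from this inequality, so it is taken
  directly from \<beta> sin^2 \<alpha> \<le> r^2 rather than from the formula for cos^2 \<alpha>. If
  sin \<alpha> = 0, the energy gives e = 0.\<close>

lemma polar_P_nonneg: "P ((sin x)^2) \<ge> 0"
proof (cases "sin \<alpha> = 0")
  case True
  then have "e t = 0"
    using energy_root root_pos by auto
  then show ?thesis
    using trig by (simp add: P_def)
next
  case False
  have "(e t)^2 * (\<beta> * (sin \<alpha>)^2) \<le> \<tau>^2 * t * (1 - t) * (sin \<alpha>)^2"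
    unfolding energy_sq[symmetric] by (intro mult_left_mono root_ge) auto
  then have "(e t)^2 * \<beta> \<le> \<tau>^2 * t * (1 - t)"
    using False by (simp add: mult.assoc[symmetric] mult_le_cancel_right)
  then have "(e t)^2 \<le> \<kappa> / 4 * (t * (1 - t))"
    unfolding \<tau>2 using \<beta> by (simp add: mult_ac)
  then show ?thesis
    using \<kappa> by (simp add: P_def field_simps)
qed

lemma polar_Q_pos: "Q ((sin x)^2) > 0"
  using Q_pos polar_P_nonneg trig by simp

text \<open>After expanding r^2 the squared energy is linear in sin^2 \<alpha>; collecting its terms
  produces \<open>Q\<close>.\<close>

private lemma sin_sq: "(e t)^2 * (1 - t + \<beta> * t) = (sin \<alpha>)^2 * (1 - t) * \<tau>^2 * Q t"
proof -
  have "(e t)^2 * ((1 - t + \<beta> * t) + (sin \<alpha>)^2 * (1 - t) * (\<beta> - 1)) = \<tau>^2 * t * (1 - t) * (sin \<alpha>)^2"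
    using energy_sq root_sq by simp
  moreover have "\<tau>^2 * Q t = \<tau>^2 * t - (\<beta> - 1) * (e t)^2"
    using \<tau> by (simp add: Q_def field_simps)
  ultimately show ?thesis
    by (simp add: mult.assoc) (simp add: algebra_simps)
qed

lemma polar_cos_sq: "(cos \<alpha>)^2 * (1 - (sin x)^2) * Q ((sin x)^2) = P ((sin x)^2)"
proof -
  have "\<tau>^2 * ((cos \<alpha>)^2 * (1 - t) * Q t) = \<tau>^2 * (1 - t) * Q t - (e t)^2 * (1 - t + \<beta> * t)"
    unfolding sin_sq by (simp add: cos_squared_eq[of \<alpha>] algebra_simps)
  also have "\<dots> = \<tau>^2 * t * (1 - t) - \<beta> * (e t)^2"
  proof -
    have "\<tau>^2 * Q t = \<tau>^2 * t - (\<beta> - 1) * (e t)^2"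
      using \<tau> by (simp add: Q_def field_simps)
    then have "\<tau>^2 * (1 - t) * Q t = (1 - t) * (\<tau>^2 * t - (\<beta> - 1) * (e t)^2)"
      by (metis mult.assoc mult.commute)
    then show ?thesis
      by (simp add: algebra_simps)
  qed
  also have "\<dots> = \<tau>^2 * P t"
    using \<kappa> unfolding P_def \<tau>2 by (simp add: field_simps)
  finally show ?thesis
    using \<tau> by simp
qed

text \<open>\<open>sin_sq\<close> determines sin \<alpha> up to sign, and the unsquared energy fixes
  the sign as that of \<tau> e. Thus y' is a function of the height alone.\<close>

lemma polar_sin:
  "sin \<alpha> / cos x = e ((sin x)^2) * sqrt (1 - (sin x)^2 + \<beta> * (sin x)^2) / (\<tau> * (1 - (sin x)^2) * sqrt (Q ((sin x)^2)))"
proof -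
  define r where "r = normal_root \<kappa> \<tau> x \<alpha>"
  define k where "k = r / (\<tau> * sin x * cos x)"
  have s: "sin \<alpha> = e t * k"
    using energy_root trig \<tau> by (simp add: k_def r_def field_simps)
  define g where "g = sqrt (1 - t + \<beta> * t) / (\<tau> * cos x * sqrt (Q t))"
  have pos: "1 - t + \<beta> * t > 0"
    using trig \<beta> by (intro add_pos_pos) auto
  have "sin \<alpha> = e t * g"
  proof (cases "e t = 0")
    case False
    have "(e t)^2 * (g^2 * (1 - t) * \<tau>^2 * Q t) = (e t)^2 * (1 - t + \<beta> * t)"
      using trig polar_Q_pos pos \<tau> by (simp add: g_def power_divide power_mult_distrib)
    then have "(e t)^2 * g^2 * ((1 - t) * \<tau>^2 * Q t) = (e t)^2 * k^2 * ((1 - t) * \<tau>^2 * Q t)"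
      using sin_sq by (simp add: s power_mult_distrib mult_ac)
    then have "(e t)^2 * g^2 = (e t)^2 * k^2"
      using trig(4) \<tau> polar_Q_pos by (subst (asm) mult_cancel_right) auto
    then have "g^2 = k^2"
      using False by simp
    \<comment> \<open>Both carry the sign of \<tau>, every other factor being positive.\<close>
    moreover have "sgn g = sgn k"
      using trig root_pos polar_Q_pos pos by (simp add: g_def k_def r_def sgn_mult sgn_divide)
    ultimately have "g = k"
      by (metis abs_sgn power2_eq_iff abs_minus_cancel mult.commute power2_abs sgn_mult_abs abs_eq_iff)
    then show ?thesis
      using s by simp
  qed (simp add: s)
  moreover have "g / cos x = sqrt (1 - t + \<beta> * t) / (\<tau> * (1 - t) * sqrt (Q t))"
    using trig(5) by (simp add: g_def power2_eq_square mult_ac)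
  ultimately show ?thesis
    by (metis times_divide_eq_right)
qed

end

end

section \<open>Existence of polar coordinates off the axis and the north pole\<close>

context rot_surface
begin

lemma component_derivatives:
  assumes "s \<in> interior I"
  shows "((\<lambda>s. fst (\<gamma> s)) has_vector_derivative fst (velocity s)) (at s)"
    and "((\<lambda>s. snd (\<gamma> s)) has_real_derivative snd (velocity s)) (at s)"
    and "((\<lambda>s. fst (velocity s)) has_vector_derivative fst (acceleration s)) (at s)"
    and "((\<lambda>s. snd (velocity s)) has_real_derivative snd (acceleration s)) (at s)"
  using interior_derivatives[OF assms]
  by (auto simp: has_real_derivative_iff_has_vector_derivative
      intro: has_vector_derivative_fst has_vector_derivative_snd)

lemma height_le_1: "s \<in> I \<Longrightarrow> snd (\<gamma> s) \<le> 1"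
  using gamma_in[of s] by (metis abs_square_le_1 add.commute le_add_same_cancel1 zero_le_power2 abs_le_iff)

lemma north_pole_iff: "s \<in> I \<Longrightarrow> \<gamma> s = north_pole \<longleftrightarrow> snd (\<gamma> s) = 1"
  using gamma_in(1)[of s] by (auto simp: north_pole_def prod_eq_iff)

text \<open>The angles are lifts of the unit vectors \<open>z / |z|\<close> and \<open>(a' + i Im (z\<^sup>* z')) / |z|\<close>, where
  \<open>\<gamma> = (z, a)\<close>.\<close>

lemma polar_coordinates_exist:
  assumes J: "open J" "is_interval J" "J \<subseteq> interior I" and pole: "\<And>s. s \<in> J \<Longrightarrow> snd (\<gamma> s) \<noteq> 1"
  shows "\<exists>x y \<alpha>. polar_coordinates \<gamma> J x y \<alpha>"
proof -
  define z z1 z2 where "z s = fst (\<gamma> s)" and "z1 s = fst (velocity s)" and "z2 s = fst (acceleration s)" for s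
  define a a1 a2 where "a s = snd (\<gamma> s)" and "a1 s = snd (velocity s)" and "a2 s = snd (acceleration s)" for s
  have J_I: "s \<in> I" if "s \<in> J" for s
    using that J(3) interior_subset by blast
  have der: "(z has_vector_derivative z1 s) (at s)" "(z1 has_vector_derivative z2 s) (at s)"
    "(a has_real_derivative a1 s) (at s)" "(a1 has_real_derivative a2 s) (at s)" if "s \<in> J" for s
    using component_derivatives[of s] that J(3)
    by (auto simp: z_def[abs_def] z1_def[abs_def] z2_def a_def[abs_def] a1_def[abs_def] a2_def)
  have J_I': "J \<subseteq> I"
    using J_I by blast
  have cont: "continuous_on J z" "continuous_on J z1" "continuous_on J z2"
    "continuous_on J a" "continuous_on J a1" "continuous_on J a2"
    unfolding z_def z1_def z2_def a_def a1_def a2_def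
    using J_I' continuous_gamma continuous_velocity continuous_acceleration
    by (auto intro!: continuous_intros intro: continuous_on_subset)
  have a: "0 < a s" "a s < 1" "0 < 1 - (a s)^2" if "s \<in> J" for s
  proof -
    show "0 < a s" "a s < 1"
      using axis_iff[OF J_I[OF that]] gamma_in(2)[OF J_I[OF that]] height_le_1[OF J_I[OF that]] pole[OF that] J(3) that
      by (auto simp: a_def less_le)
    then show "0 < 1 - (a s)^2"
      by (simp add: power_less_one_iff)
  qed
  have norm_z: "(cmod (z s))^2 = 1 - (a s)^2" if "s \<in> J" for s
    using gamma_in(1)[OF J_I[OF that]] by (simp add: z_def a_def)
  define c c' where "c s = 1 / sqrt (1 - (a s)^2)" and "c' s = a s * a1 s / (sqrt (1 - (a s)^2))^3" for s
  have c_pos: "c s > 0" and c_sq: "(c s)^2 * (1 - (a s)^2) = 1" if "s \<in> J" for s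
    using a[OF that] by (auto simp: c_def power_divide)
  have c: "(c has_real_derivative c' s) (at s)" if "s \<in> J" for s
  proof -
    have "((\<lambda>s. 1 - (a s)^2) has_real_derivative - 2 * a s * a1 s) (at s)"
      by (auto intro!: derivative_eq_intros der that)
    from DERIV_chain2[OF DERIV_real_sqrt[OF a(3)[OF that]] this]
    have "((\<lambda>s. sqrt (1 - (a s)^2)) has_real_derivative inverse (sqrt (1 - (a s)^2)) / 2 * (- 2 * a s * a1 s)) (at s)" .
    moreover have "sqrt (1 - (a s)^2) \<noteq> 0"
      using a(3)[OF that] by simp
    ultimately have "((\<lambda>s. inverse (sqrt (1 - (a s)^2))) has_real_derivative
        - (inverse (sqrt (1 - (a s)^2)) * (inverse (sqrt (1 - (a s)^2)) / 2 * (- 2 * a s * a1 s)) * inverse (sqrt (1 - (a s)^2)))) (at s)"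
      by (rule DERIV_inverse')
    then have d: "((\<lambda>s. 1 / sqrt (1 - (a s)^2)) has_real_derivative
        - (inverse (sqrt (1 - (a s)^2)) * (inverse (sqrt (1 - (a s)^2)) / 2 * (- 2 * a s * a1 s)) * inverse (sqrt (1 - (a s)^2)))) (at s)"
      by (rule has_field_derivative_transform_within_open[of _ _ _ UNIV]) (auto simp: inverse_eq_divide)
    have e: "- (inverse r * (inverse r / 2 * (- 2 * p * q)) * inverse r) = p * q / r^3" for r p q :: real
      by (cases "r = 0") (auto simp: power3_eq_cube field_simps)
    show ?thesis
      using d unfolding c_def[abs_def] c'_def e .
  qed
  have cont_c: "continuous_on J c" "continuous_on J c'"
  proof -
    have "sqrt (1 - (a s)^2) \<noteq> 0" "(sqrt (1 - (a s)^2))^3 \<noteq> 0" if "s \<in> J" for s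
      using a(3)[OF that] by auto
    then show "continuous_on J c" "continuous_on J c'"
      unfolding c_def c'_def
      by (intro continuous_on_divide continuous_on_mult continuous_on_power continuous_on_real_sqrt
          continuous_on_diff continuous_on_const cont ballI; blast)+
  qed
  \<comment> \<open>\<open>m\<close> is |z|^2 times the angular velocity of z. In its derivative the
    product cnj z' * z' is real and drops out, so only z'' is involved.\<close>
  define m where "m s = Im (cnj (z s) * z1 s)" for s
  have m: "(m has_real_derivative Im (cnj (z s) * z2 s)) (at s)" if "s \<in> J" for s
  proof -
    have cnj: "((\<lambda>s. cnj (z s)) has_vector_derivative cnj (z1 s)) (at s)"
      using bounded_linear.has_vector_derivative[OF bounded_linear_cnj der(1)[OF that]] .
    have "((\<lambda>s. cnj (z s) * z1 s) has_vector_derivative cnj (z s) * z2 s + cnj (z1 s) * z1 s) (at s)"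
      by (rule has_vector_derivative_mult[OF cnj der(2)[OF that]])
    from Im_has_real_derivative[OF this] show ?thesis
      by (simp add: m_def[abs_def])
  qed
  define u u1 where "u s = of_real (c s) * z s" and "u1 s = of_real (c s) * z1 s + of_real (c' s) * z s" for s
  have "\<exists>y. \<forall>s\<in>J. u s = cis (y s) \<and> (y has_real_derivative Im (cnj (u s) * u1 s)) (at s)"
  proof (rule circle_lift[OF J(1,2)])
    show "(u has_vector_derivative u1 s) (at s)" if "s \<in> J" for s
      unfolding u_def[abs_def] u1_def
      by (intro has_vector_derivative_mult has_vector_derivative_of_real c der that)
    show "continuous_on J u1"
      unfolding u1_def by (intro continuous_intros cont cont_c)
    show "norm (u s) = 1" if "s \<in> J" for s
    proof -
      have "(norm (u s))^2 = 1"
        using c_sq[OF that] norm_z[OF that] by (simp add: u_def norm_mult power_mult_distrib)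
      then show ?thesis
        by (simp add: power2_eq_1_iff) (smt (verit) norm_ge_zero)
    qed
  qed
  then obtain y where y: "\<And>s. s \<in> J \<Longrightarrow> u s = cis (y s)"
    "\<And>s. s \<in> J \<Longrightarrow> (y has_real_derivative Im (cnj (u s) * u1 s)) (at s)"
    by blast
  have "Im (cnj (u s) * u1 s) = (c s)^2 * m s" for s
    by (simp add: u_def u1_def m_def power2_eq_square algebra_simps)
  then have y': "(y has_real_derivative (c s)^2 * m s) (at s)" if "s \<in> J" for s
    using y(2)[OF that] by simp
  define v v1 where "v s = Complex (c s * a1 s) (c s * m s)"
    and "v1 s = Complex (c s * a2 s + c' s * a1 s) (c s * Im (cnj (z s) * z2 s) + c' s * m s)" for s
  have "\<exists>\<alpha>. \<forall>s\<in>J. v s = cis (\<alpha> s) \<and> (\<alpha> has_real_derivative Im (cnj (v s) * v1 s)) (at s)"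
  proof (rule circle_lift[OF J(1,2)])
    fix s assume s: "s \<in> J"
    have "((\<lambda>s. of_real (c s * a1 s) + \<i> * of_real (c s * m s)) has_vector_derivative
        of_real (c s * a2 s + c' s * a1 s) + \<i> * of_real (c s * Im (cnj (z s) * z2 s) + c' s * m s)) (at s)"
      using DERIV_mult[OF c[OF s] der(4)[OF s]] DERIV_mult[OF c[OF s] m[OF s]]
      by (intro has_vector_derivative_add has_vector_derivative_mult_right has_vector_derivative_of_real)
         (auto simp: algebra_simps)
    then show "(v has_vector_derivative v1 s) (at s)"
      unfolding v_def v1_def Complex_eq .
    have i1: "z s \<bullet> z1 s = - (a s * a1 s)"
    proof -
      have 1: "((\<lambda>s. z s \<bullet> z s + a s * a s) has_vector_derivative (z s \<bullet> z1 s + z1 s \<bullet> z s) + (a s * a1 s + a1 s * a s)) (at s)"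
        using der(3)[OF s] unfolding has_real_derivative_iff_has_vector_derivative
        by (intro has_vector_derivative_add has_vector_derivative_mult
            bounded_bilinear.has_vector_derivative[OF bounded_bilinear_inner] der(1) s)
      have 2: "((\<lambda>s. z s \<bullet> z s + a s * a s) has_vector_derivative 0) (at s)"
      proof (rule has_vector_derivative_transform_within_open[OF has_vector_derivative_const J(1) s])
        show "1 = z s \<bullet> z s + a s * a s" if "s \<in> J" for s
          using norm_z[OF that] unfolding power2_norm_eq_inner by (simp add: power2_eq_square)
      qed
      from vector_derivative_unique_at[OF 1 2] show ?thesis
        by (simp add: inner_commute mult.commute)
    qed
    \<comment> \<open>Lagrange's identity for z and z'. Together with \<open>i1\<close> and the unit
      speed it gives a'^2 + m^2 = |z|^2, so that v is a unit vector.\<close>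
    have i2: "(z s \<bullet> z1 s)^2 + (m s)^2 = (cmod (z s))^2 * (cmod (z1 s))^2"
      unfolding cmod_power2 by (simp add: m_def inner_complex_def power2_eq_square algebra_simps)
    have "(cmod (z1 s))^2 + (a1 s)^2 = 1"
      using norm_velocity[OF J_I[OF s]] by (cases "velocity s") (simp add: norm_Pair z1_def a1_def)
    then have i3: "(cmod (z1 s))^2 = 1 - (a1 s)^2"
      by simp
    have "(a s * a1 s)^2 + (m s)^2 = (1 - (a s)^2) * (1 - (a1 s)^2)"
      using i2 unfolding i1 i3 norm_z[OF s] by simp
    then have "(a1 s)^2 + (m s)^2 = 1 - (a s)^2"
      by (simp add: algebra_simps power_mult_distrib)
    then have "(norm (v s))^2 = 1"
      using c_sq[OF s] by (simp add: v_def cmod_power2 power_mult_distrib distrib_left[symmetric])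
    then show "norm (v s) = 1"
      by (simp add: power2_eq_1_iff) (smt (verit) norm_ge_zero)
  next
    show "continuous_on J v1"
      unfolding v1_def m_def
      by (intro continuous_on_Complex continuous_intros cont cont_c)
  qed
  then obtain \<alpha> where \<alpha>: "\<And>s. s \<in> J \<Longrightarrow> v s = cis (\<alpha> s)"
    by blast
  define x where "x s = arcsin (a s)" for s
  have "polar_coordinates \<gamma> J x y \<alpha>"
    unfolding polar_coordinates_def
  proof (intro ballI conjI)
    fix s assume s: "s \<in> J"
    have "-1 \<le> a s" "a s \<le> 1"
      using a[OF s] by auto
    then have sin_x: "sin (x s) = a s" and cos_x: "cos (x s) = sqrt (1 - (a s)^2)"
      by (auto simp: x_def cos_arcsin)
    have cos_c: "cos (x s) * c s = 1" "cos (x s) = 1 / c s"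
      using a[OF s] by (auto simp: cos_x c_def)
    have "of_real (cos (x s)) * cis (y s) = of_real (cos (x s) * c s) * z s"
      using y(1)[OF s] by (simp add: u_def)
    then have "of_real (cos (x s)) * cis (y s) = z s"
      using cos_c by simp
    then show "\<gamma> s = (of_real (cos (x s)) * cis (y s), sin (x s))"
      using sin_x by (simp add: prod_eq_iff z_def a_def)
    have "arcsin 0 < arcsin (a s)" "arcsin (a s) < arcsin 1"
      using a[OF s] by (intro arcsin_less_mono[THEN iffD2]; simp)+
    then show "0 < x s" "x s < pi / 2"
      by (auto simp: x_def)
    have "(x has_real_derivative inverse (sqrt (1 - (a s)^2)) * a1 s) (at s)"
      unfolding x_def[abs_def] using a[OF s] by (intro DERIV_chain2[OF DERIV_arcsin] der s) auto
    then show "(x has_real_derivative cos (\<alpha> s)) (at s)"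
      using \<alpha>[OF s] by (simp add: v_def c_def complex_eq_iff inverse_eq_divide)
    have "sin (\<alpha> s) = c s * m s"
      using \<alpha>[OF s] by (simp add: v_def complex_eq_iff)
    then show "(y has_real_derivative sin (\<alpha> s) / cos (x s)) (at s)"
      using y'[OF s] c_pos[OF s] by (simp add: cos_c(2) power2_eq_square mult_ac)
  qed
  then show ?thesis
    by blast
qed

end

section \<open>The mean curvature of tori\<close>

text \<open>\<open>V_field\<close> is real linear, so along a line the metric is a quadratic
  polynomial in h whose linear coefficient can be read off. This makes the Christoffel symbols
  explicit.\<close>

lemma deriv_berger_metric:
  "deriv (\<lambda>h. berger_metric \<kappa> \<tau> (p + h *\<^sub>R X) Y Z) 0 =
     4 / \<kappa> * (4 * \<tau>^2 / \<kappa> - 1) * ((Y \<bullet> V_field X) * (Z \<bullet> V_field p) + (Y \<bullet> V_field p) * (Z \<bullet> V_field X))"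
proof -
  have V: "V_field (p + h *\<^sub>R X) = V_field p + h *\<^sub>R V_field X" for h
    by (simp add: V_field_def algebra_simps)
  define A B where "A = 4 / \<kappa>" and "B = 4 * \<tau>^2 / \<kappa> - 1"
  show ?thesis
    unfolding berger_metric_def V inner_add_right inner_scaleR_right A_def[symmetric] B_def[symmetric]
    by (rule DERIV_imp_deriv) (auto intro!: derivative_eq_intros simp: algebra_simps)
qed

text \<open>A latitude is an orbit under rotations of the first factor, so in the moving frame (Y,
  W) = (cis y, cis t) all coefficients are constant and the computation becomes scalar algebra in b
  = sin x, c = cos x and \<epsilon> = sin \<alpha>. The second derivatives of F need its formula on
  a whole neighbourhood of s, hence the open set J.\<close>

lemma mean_curvature_torus:
  assumes \<kappa>: "\<kappa> > 0" and \<tau>: "\<tau> \<noteq> 0" and x: "0 < x" "x < pi / 2"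
    and cos0: "cos \<alpha> = 0" and J: "open J" "s \<in> J"
    and F: "\<And>s t. s \<in> J \<Longrightarrow> F s t = (of_real (cos x) * cis (y s), of_real (sin x) * cis t)"
    and y: "\<And>s. s \<in> J \<Longrightarrow> (y has_real_derivative sin \<alpha> / cos x) (at s)"
  shows "mean_curvature (berger_metric \<kappa> \<tau>) F (surface_normal \<kappa> \<tau> x (y s) \<alpha> t) s t
      * (4 * sin x * cos x) = sgn \<tau> * sin \<alpha> * sqrt \<kappa> * ((cos x)^2 - (sin x)^2)"
proof -
  define c b where "c = cos x" and "b = sin x"
  have pos: "c > 0" "b > 0"
    using x by (auto simp: c_def b_def intro: sin_gt_zero cos_gt_zero)
  have cb: "c^2 + b^2 = 1"
    by (simp add: c_def b_def)
  define \<epsilon> where "\<epsilon> = sin \<alpha>"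
  have \<epsilon>: "\<epsilon>^2 = 1"
    using cos0 sin_cos_squared_add[of \<alpha>] by (simp add: \<epsilon>_def)
  define Y where "Y = cis (y s)"
  define W where "W = cis t"
  have pd2: "pd2 F r t' = (0, \<i> * of_real b * cis t')" if "r \<in> J" for r t'
  proof -
    have "((\<lambda>u. (of_real c * cis (y r), of_real b * cis u)) has_vector_derivative (0, of_real b * (of_real 1 * \<i> * cis t'))) (at t')"
      by (intro has_vector_derivative_Pair has_vector_derivative_const has_vector_derivative_mult_right
          has_vector_derivative_cis DERIV_ident)
    moreover have "(\<lambda>u. F r u) = (\<lambda>u. (of_real c * cis (y r), of_real b * cis u))"
      using F[OF that] by (auto simp: c_def b_def)
    ultimately have "pd2 F r t' = (0, of_real b * (of_real 1 * \<i> * cis t'))"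
      unfolding pd2_def by (simp only: vector_derivative_at)
    then show ?thesis
      by (simp add: mult_ac)
  qed
  have pd1: "pd1 F r t' = (\<i> * of_real \<epsilon> * cis (y r), 0)" if r: "r \<in> J" for r t'
  proof -
    have "((\<lambda>u. (of_real c * cis (y u), of_real b * cis t')) has_vector_derivative
        (of_real c * (of_real (\<epsilon> / c) * \<i> * cis (y r)), 0)) (at r)"
      using y[OF r] unfolding \<epsilon>_def[symmetric] c_def[symmetric]
      by (intro has_vector_derivative_Pair has_vector_derivative_const has_vector_derivative_mult_right
          has_vector_derivative_cis)
    then have "((\<lambda>u. F u t') has_vector_derivative (of_real c * (of_real (\<epsilon> / c) * \<i> * cis (y r)), 0)) (at r)"
      by (rule has_vector_derivative_transform_within_open[OF _ J(1) r]) (auto simp: c_def b_def F)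
    then show ?thesis
      unfolding pd1_def using pos by (simp add: vector_derivative_at mult_ac)
  qed
  have pd11: "pd1 (pd1 F) s t = (- of_real (1 / c) * Y, 0)"
  proof -
    have "((\<lambda>u. (\<i> * of_real \<epsilon> * cis (y u), 0::complex)) has_vector_derivative
        (\<i> * of_real \<epsilon> * (of_real (\<epsilon> / c) * \<i> * cis (y s)), 0)) (at s)"
      using y[OF J(2)] unfolding \<epsilon>_def[symmetric] c_def[symmetric]
      by (intro has_vector_derivative_Pair has_vector_derivative_const has_vector_derivative_mult_right
          has_vector_derivative_cis)
    then have "((\<lambda>u. pd1 F u t) has_vector_derivative (\<i> * of_real \<epsilon> * (of_real (\<epsilon> / c) * \<i> * cis (y s)), 0)) (at s)"
      by (rule has_vector_derivative_transform_within_open[OF _ J]) (simp add: pd1)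
    moreover have "\<i> * of_real \<epsilon> * (of_real (\<epsilon> / c) * \<i> * cis (y s)) = - of_real (1 / c) * Y"
      using \<epsilon> by (simp add: Y_def power2_eq_square mult_ac flip: of_real_mult)
    ultimately show ?thesis
      unfolding pd1_def[of "pd1 F"] by (simp add: vector_derivative_at)
  qed
  have pd12: "pd1 (pd2 F) s t = 0"
  proof -
    have "((\<lambda>u. (0::complex, \<i> * of_real b * cis t)) has_vector_derivative 0) (at s)"
      by simp
    then have "((\<lambda>u. pd2 F u t) has_vector_derivative 0) (at s)"
      by (rule has_vector_derivative_transform_within_open[OF _ J]) (simp add: pd2)
    then show ?thesis
      unfolding pd1_def[of "pd2 F"] by (simp add: vector_derivative_at)
  qed
  have pd22: "pd2 (pd2 F) s t = (0, - of_real b * W)"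
  proof -
    have "((\<lambda>u. (0::complex, \<i> * of_real b * cis u)) has_vector_derivative
        (0, \<i> * of_real b * (of_real 1 * \<i> * cis t))) (at t)"
      by (intro has_vector_derivative_Pair has_vector_derivative_const has_vector_derivative_mult_right
          has_vector_derivative_cis DERIV_ident)
    moreover have "(\<lambda>u. pd2 F s u) = (\<lambda>u. (0::complex, \<i> * of_real b * cis u))"
      using pd2[OF J(2)] by auto
    ultimately have "pd2 (pd2 F) s t = (0, \<i> * of_real b * (of_real 1 * \<i> * cis t))"
      unfolding pd2_def[of "pd2 F"] by (simp only: vector_derivative_at)
    then show ?thesis
      by (simp add: W_def mult_ac)
  qed
  \<comment> \<open>For cos \<alpha> = 0 the root in the normal equals 2 |\<tau>| / sqrt \<kappa>,
    so \<tau> C tan \<alpha> / cos x reduces to \<open>k\<close>, and the \<open>V_field\<close>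
    part of the normal disappears.\<close>
  define k where "k = \<epsilon> * sgn \<tau> * sqrt \<kappa> / 2"
  have N: "surface_normal \<kappa> \<tau> x (y s) \<alpha> t = (of_real (k * b) * Y, - of_real (k * c) * W)"
  proof -
    have "normal_root \<kappa> \<tau> x \<alpha> = sqrt (4 * \<tau>^2 / \<kappa>)"
      using cos0 \<epsilon> by (simp add: normal_root_def \<epsilon>_def)
    also have "\<dots> = 2 * \<bar>\<tau>\<bar> / sqrt \<kappa>"
      by (simp add: real_sqrt_divide real_sqrt_mult)
    finally have root: "normal_root \<kappa> \<tau> x \<alpha> = 2 * \<bar>\<tau>\<bar> / sqrt \<kappa>" .
    have "normal_C_tan \<kappa> \<tau> x \<alpha> / cos x = \<epsilon> * sqrt \<kappa> / (2 * \<bar>\<tau>\<bar>)"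
      unfolding normal_C_tan_def root using pos by (simp add: \<epsilon>_def c_def)
    moreover define g where "g = \<epsilon> * sqrt \<kappa> / (2 * \<bar>\<tau>\<bar>)"
    moreover have "\<tau> * g = k"
      using \<tau> by (cases "\<tau> > 0") (auto simp: g_def k_def field_simps)
    then have "\<tau> * (g * q) = k * q" for q
      by (simp only: mult.assoc[symmetric])
    moreover have "normal_C \<kappa> \<tau> x \<alpha> = 0"
      using cos0 by (simp add: normal_C_def)
    ultimately have "surface_normal \<kappa> \<tau> x (y s) \<alpha> t =
        (- k * cos (t + y s)) *\<^sub>R E1_field (of_real c * Y, of_real b * W)
        + (- k * sin (t + y s)) *\<^sub>R E2_field (of_real c * Y, of_real b * W)"
      by (simp add: surface_normal_def Let_def c_def b_def Y_def W_def)
    also have "\<dots> = (of_real (k * b) * (cis (t + y s) * cnj W), - of_real (k * c) * (cis (t + y s) * cnj Y))"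
      by (simp add: E1_field_def E2_field_def complex_eq_iff algebra_simps)
    also have "cis (t + y s) * cnj W = Y"
      by (simp add: W_def Y_def cis_cnj cis_mult)
    also have "cis (t + y s) * cnj Y = W"
      by (simp add: W_def Y_def cis_cnj cis_mult)
    finally show ?thesis .
  qed
  define B where "B = 4 * \<tau>^2 / \<kappa> - 1"
  have X1: "pd1 F s t = (\<i> * of_real \<epsilon> * Y, 0)" and X2: "pd2 F s t = (0, \<i> * of_real b * W)"
    and p: "F s t = (of_real c * Y, of_real b * W)"
    using pd1[OF J(2)] pd2[OF J(2)] F[OF J(2)] by (auto simp: Y_def W_def c_def b_def)
  obtain y1 y2 where Yc: "Y = Complex y1 y2" "y1^2 + y2^2 = 1"
    by (metis Y_def cis.code sin_cos_squared_add2 cis.sel complex.collapse sin_cos_squared_add3 power2_eq_square)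
  obtain w1 w2 where Wc: "W = Complex w1 w2" "w1^2 + w2^2 = 1"
    by (metis W_def cis.code sin_cos_squared_add2 cis.sel complex.collapse sin_cos_squared_add3 power2_eq_square)
  have inn: "(of_real a1 * Y, of_real a2 * W) \<bullet> (of_real b1 * Y, of_real b2 * W) = a1 * b1 + a2 * b2"
    "(of_real a1 * Y, of_real a2 * W) \<bullet> (\<i> * of_real b1 * Y, \<i> * of_real b2 * W) = 0"
    "(\<i> * of_real a1 * Y, \<i> * of_real a2 * W) \<bullet> (of_real b1 * Y, of_real b2 * W) = 0"
    "(\<i> * of_real a1 * Y, \<i> * of_real a2 * W) \<bullet> (\<i> * of_real b1 * Y, \<i> * of_real b2 * W) = a1 * b1 + a2 * b2"
    for a1 a2 b1 b2
  proof -
    have q: "a1 * b1 * (y1^2 + y2^2) + a2 * b2 * (w1^2 + w2^2) = a1 * b1 + a2 * b2"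
      by (simp only: Yc Wc mult_1_right)
    show "(of_real a1 * Y, of_real a2 * W) \<bullet> (of_real b1 * Y, of_real b2 * W) = a1 * b1 + a2 * b2"
      "(\<i> * of_real a1 * Y, \<i> * of_real a2 * W) \<bullet> (\<i> * of_real b1 * Y, \<i> * of_real b2 * W) = a1 * b1 + a2 * b2"
      unfolding q[symmetric] by (simp_all add: Yc Wc inner_complex_def power2_eq_square algebra_simps)
    show "(of_real a1 * Y, of_real a2 * W) \<bullet> (\<i> * of_real b1 * Y, \<i> * of_real b2 * W) = 0"
      "(\<i> * of_real a1 * Y, \<i> * of_real a2 * W) \<bullet> (of_real b1 * Y, of_real b2 * W) = 0"
      by (simp_all add: Yc Wc inner_complex_def algebra_simps)
  qed
  \<comment> \<open>Position, normal and second derivatives lie in the plane of the \<open>R\<close>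
    vectors, the first derivatives in that of the \<open>S\<close> vectors. The planes are
    orthogonal, and \<open>V_field\<close> exchanges them.\<close>
  define R where "R a1 a2 = (of_real a1 * Y, of_real a2 * W)" for a1 a2
  define S where "S a1 a2 = (\<i> * of_real a1 * Y, \<i> * of_real a2 * W)" for a1 a2
  have VR: "V_field (R a1 a2) = S a1 a2" and VS: "V_field (S a1 a2) = R (- a1) (- a2)" for a1 a2
    by (simp_all add: V_field_def R_def S_def mult.assoc)
  have inner: "R a1 a2 \<bullet> R b1 b2 = a1 * b1 + a2 * b2" "R a1 a2 \<bullet> S b1 b2 = 0"
    "S a1 a2 \<bullet> R b1 b2 = 0" "S a1 a2 \<bullet> S b1 b2 = a1 * b1 + a2 * b2" for a1 a2 b1 b2
    unfolding R_def S_def by (rule inn)+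
  have vecs: "F s t = R c b" "pd1 F s t = S \<epsilon> 0" "pd2 F s t = S 0 b"
    "surface_normal \<kappa> \<tau> x (y s) \<alpha> t = R (k * b) (- k * c)"
    "pd1 (pd1 F) s t = R (- 1 / c) 0" "pd1 (pd2 F) s t = R 0 0" "pd2 (pd2 F) s t = R 0 (- b)"
    by (simp_all add: R_def S_def p X1 X2 N pd11 pd12 pd22 zero_prod_def)
  have g: "berger_metric \<kappa> \<tau> (R c b) (S a1 a2) (S b1 b2) = 4 / \<kappa> * (a1 * b1 + a2 * b2 + B * (a1 * c + a2 * b) * (b1 * c + b2 * b))"
    "berger_metric \<kappa> \<tau> (R c b) (R a1 a2) (R b1 b2) = 4 / \<kappa> * (a1 * b1 + a2 * b2)" for a1 a2 b1 b2
    unfolding berger_metric_def VR inner B_def by simp_all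
  have chr: "christoffel (berger_metric \<kappa> \<tau>) (R c b) (S a1 a2) (S b1 b2) (R n1 n2) =
      - (4 / \<kappa> * B * ((b1 * n1 + b2 * n2) * (a1 * c + a2 * b) + (a1 * n1 + a2 * n2) * (b1 * c + b2 * b)))"
    for a1 a2 b1 b2 n1 n2
  proof -
    define A where "A = 4 / \<kappa>"
    show ?thesis
      unfolding christoffel_def deriv_berger_metric VR VS inner B_def[symmetric] A_def[symmetric]
      by (simp add: field_simps)
  qed
  define h11 where "h11 = 4 / \<kappa> * k * (- (b / c) - 2 * B * b * c)"
  define h22 where "h22 = 4 / \<kappa> * k * (b * c + 2 * B * b^3 * c)"
  define h12 where "h12 = 4 / \<kappa> * k * \<epsilon> * b * B * (c^2 - b^2)"
  have \<epsilon>\<epsilon>: "\<epsilon> * \<epsilon> = 1"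
    using \<epsilon> by (simp add: power2_eq_square)
  have H: "mean_curvature (berger_metric \<kappa> \<tau>) F (surface_normal \<kappa> \<tau> x (y s) \<alpha> t) s t =
      (4 / \<kappa> * (b^2 + B * b^4) * h11 - 2 * (4 / \<kappa> * (B * \<epsilon> * b^2 * c)) * h12 + 4 / \<kappa> * (1 + B * c^2) * h22)
        / (2 * ((4 / \<kappa> * (1 + B * c^2)) * (4 / \<kappa> * (b^2 + B * b^4)) - (4 / \<kappa> * (B * \<epsilon> * b^2 * c))^2))"
  proof -
    have 1: "4 / \<kappa> * (\<epsilon> * \<epsilon> + 0 * 0 + B * (\<epsilon> * c + 0 * b) * (\<epsilon> * c + 0 * b)) = 4 / \<kappa> * (1 + B * c^2)"
    proof -
      have "B * (\<epsilon> * c + 0 * b) * (\<epsilon> * c + 0 * b) = B * c^2 * (\<epsilon> * \<epsilon>)"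
        by (simp add: power2_eq_square)
      then show ?thesis
        by (simp add: \<epsilon>\<epsilon>)
    qed
    have 2: "4 / \<kappa> * (\<epsilon> * 0 + 0 * b + B * (\<epsilon> * c + 0 * b) * (0 * c + b * b)) = 4 / \<kappa> * (B * \<epsilon> * b^2 * c)"
      by (simp add: power2_eq_square)
    have 3: "4 / \<kappa> * (0 * 0 + b * b + B * (0 * c + b * b) * (0 * c + b * b)) = 4 / \<kappa> * (b^2 + B * b^4)"
      by (simp add: power2_eq_square power4_eq_xxxx)
    have 4: "4 / \<kappa> * (- 1 / c * (k * b) + 0 * (- k * c)) +
        - (4 / \<kappa> * B * ((\<epsilon> * (k * b) + 0 * (- k * c)) * (\<epsilon> * c + 0 * b) + (\<epsilon> * (k * b) + 0 * (- k * c)) * (\<epsilon> * c + 0 * b))) = h11"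
    proof -
      have "(\<epsilon> * (k * b) + 0 * (- k * c)) * (\<epsilon> * c + 0 * b) = k * b * c * (\<epsilon> * \<epsilon>)"
        by simp
      then show ?thesis
        unfolding h11_def \<epsilon>\<epsilon> by (simp add: algebra_simps)
    qed
    have 5: "4 / \<kappa> * (0 * (k * b) + 0 * (- k * c)) +
        - (4 / \<kappa> * B * ((0 * (k * b) + b * (- k * c)) * (\<epsilon> * c + 0 * b) + (\<epsilon> * (k * b) + 0 * (- k * c)) * (0 * c + b * b))) = h12"
      unfolding h12_def by (simp add: algebra_simps power2_eq_square diff_divide_distrib)
    have 6: "4 / \<kappa> * (0 * (k * b) + - b * (- k * c)) +
        - (4 / \<kappa> * B * ((0 * (k * b) + b * (- k * c)) * (0 * c + b * b) + (0 * (k * b) + b * (- k * c)) * (0 * c + b * b))) = h22"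
      unfolding h22_def by (simp add: algebra_simps power3_eq_cube add_divide_distrib)
    show ?thesis
      unfolding mean_curvature_def Let_def vecs g chr 1 2 3 4 5 6 ..
  qed
  have B1: "1 + B > 0"
    using \<kappa> \<tau> by (simp add: B_def)
  \<comment> \<open>The squared area element; c^2 + b^2 = 1 removes its dependence on c.\<close>
  have det: "(4 / \<kappa> * (1 + B * c^2)) * (4 / \<kappa> * (b^2 + B * b^4)) - (4 / \<kappa> * (B * \<epsilon> * b^2 * c))^2
      = (4 / \<kappa>)^2 * b^2 * (1 + B)"
  proof -
    have "(4 / \<kappa> * (1 + B * c^2)) * (4 / \<kappa> * (b^2 + B * b^4)) - (4 / \<kappa> * (B * \<epsilon> * b^2 * c))^2
        = (4 / \<kappa>)^2 * b^2 * ((1 + B * c^2) * (1 + B * b^2) - (\<epsilon> * \<epsilon>) * B^2 * b^2 * c^2)"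
      by (simp add: power_mult_distrib power_divide algebra_simps power2_eq_square power4_eq_xxxx)
    also have "(1 + B * c^2) * (1 + B * b^2) - (\<epsilon> * \<epsilon>) * B^2 * b^2 * c^2 = 1 + B * (c^2 + b^2)"
      unfolding \<epsilon>\<epsilon> by (simp add: algebra_simps power2_eq_square)
    finally show ?thesis
      unfolding cb by simp
  qed
  \<comment> \<open>Multiplied by c, the bracketed numerator is a polynomial in b^2 and c^2;
    substituting c^2 = 1 - b^2 makes it collapse to (1 + B) (c^2 - b^2).\<close>
  have num: "4 / \<kappa> * (b^2 + B * b^4) * h11 - 2 * (4 / \<kappa> * (B * \<epsilon> * b^2 * c)) * h12 + 4 / \<kappa> * (1 + B * c^2) * h22
      = (4 / \<kappa>)^2 * k * b * (1 + B) * (c^2 - b^2) / c"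
  proof -
    define b2 c2 where "b2 = b^2" and "c2 = c^2"
    have c2: "c2 = 1 - b2"
      using cb by (simp add: b2_def c2_def)
    have "c * (4 / \<kappa> * (b^2 + B * b^4) * h11 - 2 * (4 / \<kappa> * (B * \<epsilon> * b^2 * c)) * h12 + 4 / \<kappa> * (1 + B * c^2) * h22)
        = (4 / \<kappa>)^2 * k * b * (b2 * (1 + B * b2) * (- 1 - 2 * B * c2)
            - 2 * (\<epsilon> * \<epsilon>) * B^2 * b2 * c2 * (c2 - b2) + (1 + B * c2) * c2 * (1 + 2 * B * b2))"
    proof -
      have 1: "c * h11 = 4 / \<kappa> * k * (- b - 2 * B * b * c2)"
      proof -
        have "c * (- (b / c) - 2 * B * b * c) = - b - 2 * B * b * c2"
          using pos by (simp add: right_diff_distrib c2_def power2_eq_square)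
        then show ?thesis
          unfolding h11_def by (metis mult.left_commute)
      qed
      have 2: "c * h22 = 4 / \<kappa> * k * c2 * (b + 2 * B * b * b2)"
        by (simp add: h22_def c2_def b2_def power2_eq_square power3_eq_cube algebra_simps)
      have 3: "c * h12 = 4 / \<kappa> * k * \<epsilon> * b * B * c * (c2 - b2)"
        by (simp add: h12_def c2_def b2_def)
      have "c * (4 / \<kappa> * (b^2 + B * b^4) * h11 - 2 * (4 / \<kappa> * (B * \<epsilon> * b^2 * c)) * h12 + 4 / \<kappa> * (1 + B * c^2) * h22)
        = 4 / \<kappa> * (b2 + B * (b2 * b2)) * (c * h11) - 2 * (4 / \<kappa> * (B * \<epsilon> * b2 * c)) * (c * h12) + 4 / \<kappa> * (1 + B * c2) * (c * h22)"
        by (simp add: algebra_simps b2_def c2_def power2_eq_square power4_eq_xxxx)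
      also have "\<dots> = (4 / \<kappa>)^2 * k * b * ((b2 + B * (b2 * b2)) * (- 1 - 2 * B * c2)
            - 2 * (\<epsilon> * \<epsilon>) * B^2 * b2 * (c * c) * (c2 - b2) + (1 + B * c2) * c2 * (1 + 2 * B * b2))"
      proof -
        define A where "A = 4 / \<kappa>"
        show ?thesis
          unfolding 1 2 3 A_def[symmetric] by (simp add: algebra_simps power2_eq_square)
      qed
      also have "c * c = c2"
        by (simp add: c2_def power2_eq_square)
      finally show ?thesis
        by (simp add: algebra_simps)
    qed
    also have "\<dots> = (4 / \<kappa>)^2 * k * b * ((1 + B) * (c2 - b2))"
      unfolding \<epsilon>\<epsilon> c2 by (rule arg_cong[of _ _ "\<lambda>u. (4 / \<kappa>)^2 * k * b * u"]) (simp add: algebra_simps power2_eq_square)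
    finally have "c * (4 / \<kappa> * (b^2 + B * b^4) * h11 - 2 * (4 / \<kappa> * (B * \<epsilon> * b^2 * c)) * h12 + 4 / \<kappa> * (1 + B * c^2) * h22)
        = (4 / \<kappa>)^2 * k * b * (1 + B) * (c^2 - b^2)"
      by (simp only: b2_def c2_def mult.assoc)
    then show ?thesis
      using pos(1) by (metis less_irrefl nonzero_mult_div_cancel_left)
  qed
  have "mean_curvature (berger_metric \<kappa> \<tau>) F (surface_normal \<kappa> \<tau> x (y s) \<alpha> t) s t
      = k * (c^2 - b^2) / (2 * b * c)"
  proof -
    have "A^2 * k * b * D * d / c / (2 * (A^2 * b^2 * D)) = k * d / (2 * b * c)" if "A \<noteq> 0" "D \<noteq> 0" for A D d
      using that pos by (simp add: power2_eq_square)
    from this[of "4 / \<kappa>" "1 + B" "c^2 - b^2"] show ?thesis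
      unfolding H num det using \<kappa> B1 by simp
  qed
  then show ?thesis
    unfolding c_def[symmetric] b_def[symmetric] \<epsilon>_def[symmetric] using pos by (simp add: k_def field_simps)
qed

section \<open>The phase of the generating curve\<close>

context cmc_params
begin

text \<open>Chosen so that 4 t P t / Q t, the value of t'^2, equals (rad^2 - (t - mid)^2) times the
  square of \<open>speed t\<close>.\<close>

definition speed :: "real \<Rightarrow> real" where
  "speed t = sqrt (4 * t * (4 * H^2 + \<kappa>) / (\<kappa> * Q t))"

text \<open>Obtained by replacing Q t with its upper bound t max 1 (1 / \<beta>): the factor t
  cancels, so the bound is uniform up to the axis.\<close>

definition speed_bound :: real where
  "speed_bound = sqrt (4 * (4 * H^2 + \<kappa>) / (\<kappa> * max 1 (1 / \<beta>)))"

lemma speed_bound_pos: "speed_bound > 0"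
proof -
  have "max 1 (1 / \<beta>) > 0"
    by simp
  then show ?thesis
    unfolding speed_bound_def using \<kappa> lead_pos by (simp del: max_less_iff_conj)
qed

lemma speed_ge:
  assumes t: "t \<in> {0<..1}" and "P t \<ge> 0"
  shows "speed t \<ge> speed_bound"
proof -
  define M where "M = max 1 (1 / \<beta>)"
  have M: "M > 0"
    by (simp add: M_def)
  have Q: "0 < Q t" "Q t \<le> t * M"
    using Q_pos[OF assms] Q_bounds(2)[of t] assms by (auto simp: M_def)
  have "4 * (4 * H^2 + \<kappa>) / (\<kappa> * M) = 4 * t * (4 * H^2 + \<kappa>) / (\<kappa> * (t * M))"
    using t by simp
  also have "\<dots> \<le> 4 * t * (4 * H^2 + \<kappa>) / (\<kappa> * Q t)"
    using Q t M \<kappa> lead_pos by (intro divide_left_mono mult_left_mono mult_nonneg_nonneg mult_pos_pos) auto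
  finally show ?thesis
    unfolding speed_def speed_bound_def M_def[symmetric] by (rule real_sqrt_le_mono)
qed

text \<open>The energy counterpart of \<open>mean_curvature_torus\<close>, with the same root 2
  |\<tau>| / sqrt \<kappa>. The two relations together determine the latitude.\<close>

lemma energy_at_torus:
  assumes "energy_at x \<alpha>" "cos \<alpha> = 0"
  shows "2 * e ((sin x)^2) = sgn \<tau> * sin \<alpha> * sqrt \<kappa> * (sin x * cos x)"
proof -
  have "(sin \<alpha>)^2 = 1"
    using assms(2) sin_cos_squared_add[of \<alpha>] by simp
  then have "normal_root \<kappa> \<tau> x \<alpha> = sqrt (4 * \<tau>^2 / \<kappa>)"
    using assms(2) by (simp add: normal_root_def)
  also have "\<dots> = 2 * \<bar>\<tau>\<bar> / sqrt \<kappa>"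
    by (simp add: real_sqrt_divide real_sqrt_mult)
  finally have "normal_C_tan \<kappa> \<tau> x \<alpha> = cos x * sin \<alpha> * sqrt \<kappa> / (2 * \<bar>\<tau>\<bar>)"
    by (simp add: normal_C_tan_def)
  then have "e ((sin x)^2) = \<tau> / (2 * \<bar>\<tau>\<bar>) * (sin \<alpha> * sqrt \<kappa> * (sin x * cos x))"
    using assms(1) by (simp add: energy_at_def e_def mult_ac)
  then show ?thesis
    using \<tau> by (cases "\<tau> > 0") auto
qed

end

section \<open>The squared height along the curve; completeness enters as closedness of I\<close>

locale cmc_surface = rot_surface \<gamma> I + cmc_params \<kappa> \<tau> H E
  for \<gamma> I \<kappa> \<tau> H E +
  assumes closed_I: "closed I"
    and mean_curv: "has_mean_curvature \<kappa> \<tau> \<gamma> I H"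
    and energy: "has_energy \<kappa> \<tau> \<gamma> I H E"
begin

definition hsq :: "real \<Rightarrow> real" where "hsq s = (snd (\<gamma> s))^2"
definition hsq' :: "real \<Rightarrow> real" where "hsq' s = 2 * snd (\<gamma> s) * snd (velocity s)"
definition hsq'' :: "real \<Rightarrow> real" where
  "hsq'' s = 2 * (snd (velocity s))^2 + 2 * snd (\<gamma> s) * snd (acceleration s)"

lemma interior_in_I: "s \<in> interior I \<Longrightarrow> s \<in> I"
  using interior_subset by blast

lemma interior_interval: "is_interval (interior I)"
  using interval_I(2) convex_interior is_interval_convex_1 by blast

lemma height_pos: "s \<in> interior I \<Longrightarrow> snd (\<gamma> s) > 0"
  using axis_iff[OF interior_in_I] gamma_in(2)[OF interior_in_I] by (simp add: less_le)

lemma hsq_in: "s \<in> I \<Longrightarrow> hsq s \<in> {0..1}"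
  using gamma_in[of s] by (auto simp: hsq_def) (metis le_add_same_cancel2 zero_le_power2)

lemma hsq_pos: "s \<in> interior I \<Longrightarrow> hsq s \<in> {0<..1}"
  using hsq_in[OF interior_in_I, of s] height_pos[of s] by (auto simp: hsq_def)

lemma hsq_eq_1_iff: "s \<in> I \<Longrightarrow> hsq s = 1 \<longleftrightarrow> \<gamma> s = north_pole"
  using gamma_in(2)[of s] by (auto simp: hsq_def north_pole_iff power2_eq_1_iff)

lemma hsq_derivatives:
  assumes "s \<in> interior I"
  shows "(hsq has_real_derivative hsq' s) (at s)" "(hsq' has_real_derivative hsq'' s) (at s)"
  unfolding hsq_def[abs_def] hsq'_def[abs_def] hsq''_def
  using component_derivatives(2,4)[OF assms]
  by (auto intro!: derivative_eq_intros simp: power2_eq_square)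

lemma continuous_hsq: "continuous_on I hsq" "continuous_on I hsq'" "continuous_on I hsq''"
  unfolding hsq_def hsq'_def hsq''_def
  by (intro continuous_intros continuous_gamma continuous_velocity continuous_acceleration)+

lemma polar_energy:
  assumes "open J" "J \<subseteq> I" "polar_coordinates \<gamma> J x y \<alpha>" "s \<in> J"
  shows "energy_at (x s) (\<alpha> s)"
  using energy assms unfolding has_energy_def energy_at_def by blast

lemma polar_hsq:
  assumes "polar_coordinates \<gamma> J x y \<alpha>" "open J" "J \<subseteq> I" "s \<in> J"
  shows "hsq s = (sin (x s))^2" "hsq' s = 2 * sin (x s) * cos (x s) * cos (\<alpha> s)"
    "snd (velocity s) = cos (x s) * cos (\<alpha> s)"
proof -
  have \<gamma>: "snd (\<gamma> r) = sin (x r)" if "r \<in> J" for r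
    using assms(1) that by (simp add: polar_coordinates_def)
  have s: "s \<in> interior I"
    using assms interior_maximal by blast
  have "((\<lambda>s. sin (x s)) has_real_derivative cos (x s) * cos (\<alpha> s)) (at s)"
    using assms(1,4) by (auto simp: polar_coordinates_def intro!: derivative_eq_intros)
  then have "((\<lambda>s. snd (\<gamma> s)) has_real_derivative cos (x s) * cos (\<alpha> s)) (at s)"
    by (rule has_field_derivative_transform_within_open[OF _ assms(2,4)]) (simp add: \<gamma>)
  then show v: "snd (velocity s) = cos (x s) * cos (\<alpha> s)"
    using DERIV_unique component_derivatives(2)[OF s] by blast
  show "hsq s = (sin (x s))^2"
    by (simp add: hsq_def \<gamma> assms(4))
  show "hsq' s = 2 * sin (x s) * cos (x s) * cos (\<alpha> s)"
    by (simp add: hsq'_def v \<gamma> assms(4))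
qed

text \<open>The hypotheses on energy and mean curvature speak about charts on open sets only; this
  supplies a chart inside any prescribed open set around a point off the pole.\<close>

lemma local_polar_coordinates:
  assumes "s \<in> U" "open U" "U \<subseteq> I" "\<gamma> s \<noteq> north_pole"
  obtains J x y \<alpha> where "open J" "is_interval J" "s \<in> J" "J \<subseteq> U" "polar_coordinates \<gamma> J x y \<alpha>"
proof -
  have "open (U \<inter> (\<lambda>s. snd (\<gamma> s)) -` (- {1}))"
    using continuous_gamma assms by (intro continuous_open_preimage) (auto intro!: continuous_intros intro: continuous_on_subset)
  moreover have "s \<in> U \<inter> (\<lambda>s. snd (\<gamma> s)) -` (- {1})"
    using assms north_pole_iff by auto
  ultimately obtain d where d: "d > 0" "ball s d \<subseteq> U \<inter> (\<lambda>s. snd (\<gamma> s)) -` (- {1})"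
    using openE by blast
  have "ball s d \<subseteq> interior I"
    using d(2) assms(3) by (intro interior_maximal) auto
  moreover have "is_interval (ball s d)"
    by (simp add: is_interval_convex_1)
  ultimately have "\<exists>x y \<alpha>. polar_coordinates \<gamma> (ball s d) x y \<alpha>"
    using d(2) by (intro polar_coordinates_exist) auto
  then show ?thesis
    using that[of "ball s d"] d \<open>is_interval (ball s d)\<close> by auto
qed

text \<open>Resting at the pole on an open set would contradict unit speed. Charts are therefore
  available on a dense set of parameters.\<close>

lemma not_constant:
  assumes "open U" "U \<subseteq> I" "U \<noteq> {}"
  shows "\<exists>s\<in>U. \<gamma> s \<noteq> north_pole"
proof (rule ccontr)
  assume "\<not> ?thesis"
  then have const: "\<gamma> s = north_pole" if "s \<in> U" for s
    using that by blast
  obtain s where s: "s \<in> U"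
    using assms(3) by blast
  have "s \<in> interior I"
    using s assms interior_maximal by blast
  moreover have "(\<gamma> has_vector_derivative 0) (at s)"
    by (rule has_vector_derivative_transform_within_open[OF has_vector_derivative_const assms(1) s])
       (simp add: const)
  ultimately have "velocity s = 0"
    using interior_derivatives(1) vector_derivative_unique_at by blast
  then show False
    using norm_velocity[of s] s assms(2) by auto
qed

text \<open>Charts give the inequality on a dense set and continuity carries it to the pole and to
  the ends of I. A violation would spread to an open set, which contains a chart.\<close>

lemma P_hsq_nonneg:
  assumes "s \<in> I"
  shows "P (hsq s) \<ge> 0"
proof (rule ccontr)
  assume neg: "\<not> P (hsq s) \<ge> 0"
  have "continuous_on I (\<lambda>s. P (hsq s))"
    unfolding P_def e_def by (intro continuous_intros continuous_hsq)
  then obtain d where d: "d > 0" "\<And>r. r \<in> I \<Longrightarrow> dist r s < d \<Longrightarrow> dist (P (hsq r)) (P (hsq s)) < - P (hsq s)"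
    using assms neg unfolding continuous_on_iff by (metis linorder_not_le neg_0_less_iff_less)
  define U where "U = interior I \<inter> ball s d"
  have "open U" "U \<subseteq> I"
    using interior_subset by (auto simp: U_def)
  moreover have "s \<in> closure (interior I)"
    using assms closure_subset convex_closure_interior[OF interval_I(2) interior_I] by blast
  then have "U \<noteq> {}"
  proof -
    obtain r where "r \<in> interior I" "dist r s < d"
      using \<open>s \<in> closure (interior I)\<close> d(1) unfolding closure_approachable by blast
    then show ?thesis
      by (auto simp: U_def dist_commute)
  qed
  ultimately obtain r where r: "r \<in> U" "\<gamma> r \<noteq> north_pole"
    using not_constant by blast
  obtain J x y \<alpha> where J: "open J" "r \<in> J" "J \<subseteq> U" "polar_coordinates \<gamma> J x y \<alpha>"
    using local_polar_coordinates[OF r(1) \<open>open U\<close> \<open>U \<subseteq> I\<close> r(2)] by metis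
  have JI: "J \<subseteq> I"
    using J \<open>U \<subseteq> I\<close> by blast
  have x: "0 < x r" "x r < pi / 2"
    using J(2,4) by (auto simp: polar_coordinates_def)
  have "P (hsq r) \<ge> 0"
    using polar_P_nonneg[OF x polar_energy[OF J(1) JI J(4,2)]] polar_hsq(1)[OF J(4,1) JI J(2)] by simp
  moreover have "dist (P (hsq r)) (P (hsq s)) < - P (hsq s)"
    using d(2) r(1) \<open>U \<subseteq> I\<close> by (auto simp: U_def dist_commute)
  ultimately show False
    by (simp add: dist_real_def abs_less_iff)
qed

lemma pole_energy:
  assumes "s \<in> I" "\<gamma> s = north_pole"
  shows "E = - H"
proof -
  have "hsq s = 1"
    using hsq_eq_1_iff assms by blast
  then have "P 1 \<ge> 0"
    using P_hsq_nonneg[OF assms(1)] by simp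
  then have "(E + H)^2 \<le> 0"
    using \<kappa> by (simp add: P_def e_def divide_le_0_iff)
  then show ?thesis
    by simp
qed

lemma axis_energy:
  assumes "s \<in> I" "snd (\<gamma> s) = 0"
  shows "E = 0"
proof -
  have "P 0 \<ge> 0"
    using P_hsq_nonneg[OF assms(1)] assms by (simp add: hsq_def)
  then have "E^2 \<le> 0"
    using \<kappa> by (simp add: P_def e_def divide_le_0_iff)
  then show ?thesis
    by simp
qed

text \<open>Without axis points every point of I is interior, so I is both open and closed.\<close>

lemma I_UNIV:
  assumes "E \<noteq> 0"
  shows "I = UNIV"
proof -
  have "I \<subseteq> interior I"
    using axis_energy axis_iff assms by blast
  then have "open I"
    by (metis interior_subset open_interior subset_antisym)
  then show ?thesis
    using closed_I clopen[of I] interior_I by auto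
qed

lemma disc_nonneg: "disc \<ge> 0"
  using P_hsq_nonneg P_nonneg_disc interior_I interior_in_I by blast

lemma hsq_range: "s \<in> I \<Longrightarrow> hsq s \<in> {mid - rad..mid + rad}"
  using P_nonneg_iff[OF disc_nonneg] P_hsq_nonneg by blast

text \<open>In a chart this is \<open>polar_cos_sq\<close> multiplied out. At the pole both sides
  vanish: t = 1 is a maximum, so t' = 0, and E = - H gives P 1 = 0.\<close>

lemma hsq_ode:
  assumes s: "s \<in> interior I"
  shows "(hsq' s)^2 = (rad^2 - (hsq s - mid)^2) * (speed (hsq s))^2"
proof -
  define t where "t = hsq s"
  have t: "t \<in> {0<..1}" "P t \<ge> 0"
    using hsq_pos[OF s] P_hsq_nonneg interior_in_I[OF s] by (auto simp: t_def)
  have Q: "Q t > 0"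
    using Q_pos t by blast
  have "(hsq' s)^2 = 4 * t * P t / Q t"
  proof (cases "\<gamma> s = north_pole")
    case True
    have "E = - H"
      using pole_energy interior_in_I[OF s] True by blast
    have "t = 1"
      using hsq_eq_1_iff interior_in_I[OF s] True by (simp add: t_def)
    then have "P t = 0"
      using \<open>E = - H\<close> unfolding P_def e_def by simp
    moreover have "hsq' s = 0"
    proof -
      obtain d where d: "d > 0" "ball s d \<subseteq> interior I"
        using s open_interior openE by blast
      have "hsq r \<le> hsq s" if "\<bar>s - r\<bar> < d" for r
        using hsq_in[OF interior_in_I, of r] d(2) that \<open>t = 1\<close> by (auto simp: dist_real_def t_def)
      then show ?thesis
        using DERIV_local_max[OF hsq_derivatives(1)[OF s] d(1)] by blast
    qed
    ultimately show ?thesis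
      by simp
  next
    case False
    obtain J x y \<alpha> where J: "open J" "s \<in> J" "J \<subseteq> interior I" "polar_coordinates \<gamma> J x y \<alpha>"
      using local_polar_coordinates[OF s open_interior interior_subset False] by metis
    have JI: "J \<subseteq> I"
      using J(3) interior_subset by blast
    have x: "0 < x s" "x s < pi / 2"
      using J(2,4) by (auto simp: polar_coordinates_def)
    have t_eq: "t = (sin (x s))^2"
      using polar_hsq(1)[OF J(4,1) JI J(2)] by (simp add: t_def)
    have "(hsq' s)^2 = 4 * (sin (x s))^2 * ((cos (\<alpha> s))^2 * (cos (x s))^2)"
      unfolding polar_hsq(2)[OF J(4,1) JI J(2)] by (simp add: power_mult_distrib mult_ac)
    also have "\<dots> = 4 * t * ((cos (\<alpha> s))^2 * (1 - t))"
      unfolding t_eq by (simp only: cos_squared_eq[of "x s"])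
    also have "(cos (\<alpha> s))^2 * (1 - t) = P t / Q t"
      using polar_cos_sq[OF x polar_energy[OF J(1) JI J(4,2)]] Q unfolding t_eq by (simp add: field_simps)
    finally show ?thesis
      by simp
  qed
  also have "\<dots> = (rad^2 - (t - mid)^2) * (4 * t * (4 * H^2 + \<kappa>) / (\<kappa> * Q t))"
    unfolding P_rad[OF disc_nonneg] by simp
  also have "4 * t * (4 * H^2 + \<kappa>) / (\<kappa> * Q t) = (speed t)^2"
    unfolding speed_def using t Q \<kappa> lead_pos by simp
  finally show ?thesis
    by (simp add: t_def)
qed

text \<open>The only place where the mean curvature is used; everything else follows from the energy.\<close>

lemma stationary_imp_disc_0:
  assumes U: "open U" "U \<subseteq> I" "U \<noteq> {}" and stat: "\<And>s. s \<in> U \<Longrightarrow> hsq' s = 0"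
  shows "disc = 0"
proof -
  obtain s where s: "s \<in> U" "\<gamma> s \<noteq> north_pole"
    using not_constant[OF U] by blast
  obtain J x y \<alpha> where J: "open J" "is_interval J" "s \<in> J" "J \<subseteq> U" and polar: "polar_coordinates \<gamma> J x y \<alpha>"
    using local_polar_coordinates[OF s(1) U(1,2) s(2)] by metis
  have JI: "J \<subseteq> I"
    using J U by blast
  have x: "0 < x r" "x r < pi / 2" if "r \<in> J" for r
    using polar that by (auto simp: polar_coordinates_def)
  have sc: "sin (x r) > 0" "cos (x r) > 0" if "r \<in> J" for r
    using x[OF that] by (auto intro: sin_gt_zero cos_gt_zero)
  have cos0: "cos (\<alpha> r) = 0" if "r \<in> J" for r
    using stat[of r] polar_hsq(2)[OF polar J(1) JI that] sc[OF that] J(4) that by auto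
  have x_const: "x r = x s" if "r \<in> J" for r
  proof (rule open_interval_derivative_zero_constant[OF J(1,2) _ that J(3)])
    show "(x has_vector_derivative 0) (at r)" if "r \<in> J" for r
      using polar cos0[OF that] that unfolding polar_coordinates_def has_real_derivative_iff_has_vector_derivative
      by metis
  qed
  define c b where "c = cos (x s)" and "b = sin (x s)"
  have pos: "c > 0" "b > 0"
    using sc[OF J(3)] by (auto simp: c_def b_def)
  define t where "t = b^2"
  have c2: "c^2 = 1 - t"
    by (simp add: c_def t_def b_def cos_squared_eq)
  define \<epsilon> where "\<epsilon> = sgn \<tau> * sin (\<alpha> s)"
  have "(sin (\<alpha> s))^2 = 1"
    using cos0[OF J(3)] sin_cos_squared_add[of "\<alpha> s"] by simp
  then have \<epsilon>: "\<epsilon>^2 = 1"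
    using \<tau> by (simp add: \<epsilon>_def power_mult_distrib) (simp add: sgn_if)
  have MC: "mean_curvature (berger_metric \<kappa> \<tau>) (immersion_param \<gamma>) (surface_normal \<kappa> \<tau> (x s) (y s) (\<alpha> s) 0) s 0 = H"
    using mean_curv J(1,3) JI polar unfolding has_mean_curvature_def by blast
  \<comment> \<open>The condition cos \<alpha> = 0 leaves a sign in sin \<alpha>. The energy
    determines that sign, so it does not change along J and y' is constant.\<close>
  have y_deriv: "(y has_real_derivative sin (\<alpha> s) / cos (x s)) (at r)" if "r \<in> J" for r
  proof -
    have sq: "(sin (\<alpha> r))^2 = 1" if "r \<in> J" for r
      using cos0[OF that] sin_cos_squared_add[of "\<alpha> r"] by simp
    have e1: "2 * e ((sin (x r))^2) = sgn \<tau> * sin (\<alpha> r) * sqrt \<kappa> * (sin (x r) * cos (x r))" if "r \<in> J" for r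
      by (rule energy_at_torus[OF polar_energy[OF J(1) JI polar that] cos0[OF that]])
    have "sgn \<tau> * sin (\<alpha> r) * sqrt \<kappa> * (b * c) = sgn \<tau> * sin (\<alpha> s) * sqrt \<kappa> * (b * c)"
      using e1[OF that] e1[OF J(3)] unfolding x_const[OF that] b_def c_def by (rule trans[OF sym])
    then have "sin (\<alpha> r) = sin (\<alpha> s)"
      using pos \<kappa> \<tau> by (simp add: sgn_zero_iff)
    then show ?thesis
      using polar that x_const[OF that] unfolding polar_coordinates_def by metis
  qed
  have F: "immersion_param \<gamma> r u = (of_real (cos (x s)) * cis (y r), of_real (sin (x s)) * cis u)" if "r \<in> J" for r u
    using polar that x_const[OF that] by (simp add: immersion_param_def immersion_def polar_coordinates_def)
  have H_eq: "H * (4 * b * c) = \<epsilon> * sqrt \<kappa> * (c^2 - t)"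
    using mean_curvature_torus[OF \<kappa> \<tau> x[OF J(3)] cos0[OF J(3)] J(1,3) F y_deriv, of 0] MC
    by (simp add: b_def c_def t_def \<epsilon>_def)
  have e_eq: "2 * e t = \<epsilon> * sqrt \<kappa> * (b * c)"
    using energy_at_torus[OF polar_energy[OF J(1) JI polar J(3)] cos0[OF J(3)]] by (simp add: t_def b_def c_def \<epsilon>_def)
  \<comment> \<open>Multiplying the energy relation by 4 H brings in the mean curvature relation and
    eliminates b c and \<epsilon>. The result is linear in t with solution \<open>mid\<close>; since
    also P t = 0, the square in \<open>P_disc\<close> leaves disc = 0.\<close>
  have "8 * H * e t = (H * (4 * b * c)) * (\<epsilon> * sqrt \<kappa>)"
    using e_eq by (simp add: algebra_simps)
  also have "\<dots> = \<epsilon>^2 * (sqrt \<kappa>)^2 * (c^2 - t)"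
    unfolding H_eq by (simp add: power2_eq_square mult_ac)
  finally have "8 * H * e t = \<kappa> * (1 - 2 * t)"
    using \<epsilon> \<kappa> c2 by simp
  then have "2 * (4 * H^2 + \<kappa>) * t = \<kappa> - 8 * H * E"
    by (simp add: e_def power2_eq_square algebra_simps)
  then have "t = mid"
    using lead_pos by (simp add: mid_def eq_divide_eq mult_ac)
  moreover have "P t = 0"
    using polar_cos_sq[OF x[OF J(3)] polar_energy[OF J(1) JI polar J(3)]] cos0[OF J(3)] by (simp add: t_def b_def)
  ultimately show ?thesis
    using lead_pos \<kappa> by (simp add: P_disc)
qed

text \<open>Quotient and chain rule written out, because the construction of the phase needs a
  derivative of \<open>speed\<close> that is visibly continuous.\<close>

definition speed' :: "real \<Rightarrow> real" where
  "speed' s = 4 * (4 * H^2 + \<kappa>) / \<kappa> *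
      (hsq' s * Q (hsq s) - hsq s * (hsq' s * (1 - (\<beta> - 1) * (2 * H * e (hsq s)) / \<tau>^2))) / (Q (hsq s))^2
        / (2 * speed (hsq s))"

lemma speed_derivative:
  assumes s: "s \<in> interior I"
  shows "((\<lambda>s. speed (hsq s)) has_real_derivative speed' s) (at s)" "continuous_on (interior I) speed'"
    and "speed (hsq s) \<ge> speed_bound"
proof -
  have Q: "Q (hsq s) > 0" if "s \<in> interior I" for s
    using Q_pos hsq_pos[OF that] P_hsq_nonneg[OF interior_in_I[OF that]] by blast
  have ge: "speed (hsq s) \<ge> speed_bound" if "s \<in> interior I" for s
    using speed_ge hsq_pos[OF that] P_hsq_nonneg[OF interior_in_I[OF that]] by blast
  then show "speed (hsq s) \<ge> speed_bound"
    using s by blast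
  have Q': "((\<lambda>s. Q (hsq s)) has_real_derivative hsq' s * (1 - (\<beta> - 1) * (2 * H * e (hsq s)) / \<tau>^2)) (at s)"
    unfolding Q_def e_def using \<tau>
    by (auto intro!: derivative_eq_intros hsq_derivatives(1)[OF s] simp: field_simps)
  define g where "g s = 4 * (4 * H^2 + \<kappa>) / \<kappa> * (hsq s / Q (hsq s))" for s
  have sp: "speed (hsq r) = sqrt (g r)" for r
    by (simp add: speed_def g_def mult_ac)
  have "g s > 0"
    unfolding g_def using Q[OF s] hsq_pos[OF s] lead_pos \<kappa> by (intro mult_pos_pos divide_pos_pos) auto
  have "((\<lambda>s. hsq s / Q (hsq s)) has_real_derivative
      (hsq' s * Q (hsq s) - hsq s * (hsq' s * (1 - (\<beta> - 1) * (2 * H * e (hsq s)) / \<tau>^2))) / (Q (hsq s) * Q (hsq s))) (at s)"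
    using DERIV_divide[OF hsq_derivatives(1)[OF s] Q'] Q[OF s] by simp
  from DERIV_cmult[OF this, of "4 * (4 * H^2 + \<kappa>) / \<kappa>"]
  have g': "(g has_real_derivative 4 * (4 * H^2 + \<kappa>) / \<kappa> *
      ((hsq' s * Q (hsq s) - hsq s * (hsq' s * (1 - (\<beta> - 1) * (2 * H * e (hsq s)) / \<tau>^2))) / (Q (hsq s) * Q (hsq s)))) (at s)"
    by (simp add: g_def[abs_def])
  have alg: "inverse r / 2 * (k * (n / (q * q))) = k * n / q^2 / (2 * r)" for r k n q :: real
    by (cases "r = 0"; cases "q = 0") (simp_all add: power2_eq_square field_simps)
  from DERIV_chain2[OF DERIV_real_sqrt[OF \<open>g s > 0\<close>] g']
  show "((\<lambda>s. speed (hsq s)) has_real_derivative speed' s) (at s)"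
    unfolding sp speed'_def alg .
  have cont: "continuous_on (interior I) hsq" "continuous_on (interior I) hsq'"
    using continuous_hsq interior_subset continuous_on_subset by blast+
  have cQ: "continuous_on (interior I) (\<lambda>s. Q (hsq s))"
    unfolding Q_def e_def by (intro continuous_intros cont) (use \<tau> in auto)
  have ne: "Q (hsq s) \<noteq> 0" "2 * speed (hsq s) \<noteq> 0" if "s \<in> interior I" for s
    using Q[OF that] ge[OF that] speed_bound_pos by auto
  have cs: "continuous_on (interior I) (\<lambda>s. speed (hsq s))"
    unfolding sp g_def by (intro continuous_intros cont cQ) (use ne in auto)
  show "continuous_on (interior I) speed'"
    unfolding speed'_def e_def by (intro continuous_intros cont cQ cs) (use ne \<tau> \<kappa> in auto)
qed

text \<open>\<open>oscillation_phase\<close> applies: t' vanishes on no nonempty open set, as this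
  would give disc = 0 by \<open>stationary_imp_disc_0\<close>.\<close>

lemma phase_exists:
  assumes "disc > 0"
  obtains \<phi> where "\<And>s. s \<in> interior I \<Longrightarrow> hsq s = mid - rad * cos (\<phi> s)"
    "\<And>s. s \<in> interior I \<Longrightarrow> hsq' s = rad * speed (hsq s) * sin (\<phi> s)"
    "\<And>s. s \<in> interior I \<Longrightarrow> (\<phi> has_real_derivative speed (hsq s)) (at s)"
proof -
  have rad: "rad > 0"
    using assms lead_pos by (simp add: rad_def)
  have "\<exists>s\<in>U. hsq' s \<noteq> 0" if "open U" "U \<subseteq> interior I" "U \<noteq> {}" for U
    using stationary_imp_disc_0[of U] that assms interior_subset by fastforce
  moreover have "0 < speed (hsq s)" if "s \<in> interior I" for s
    using speed_derivative(3)[OF that] speed_bound_pos by linarith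
  moreover obtain s0 where "s0 \<in> interior I"
    using interior_I by blast
  moreover have "continuous_on (interior I) hsq''"
    using continuous_hsq(3) interior_subset continuous_on_subset by blast
  ultimately have "\<exists>\<phi>. \<forall>s\<in>interior I. hsq s = mid - rad * cos (\<phi> s) \<and> hsq' s = rad * speed (hsq s) * sin (\<phi> s) \<and>
           (\<phi> has_real_derivative speed (hsq s)) (at s)"
    using speed_derivative(1,2) rad hsq_ode hsq_derivatives interior_interval
    by (intro oscillation_phase[OF open_interior, where t''=hsq'' and \<rho>'=speed']) auto
  then show ?thesis
    using that by blast
qed

end

section \<open>The period integral\<close>

text \<open>A slope of at least c gives f b - f a \<ge> c (b - a), hence injectivity. Surjectivity
  follows from the intermediate value theorem on the bracket of radius |u - f 0| / c, over which f
  is certain to pass the value u.\<close>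

lemma strictly_increasing_bij:
  fixes f D :: "real \<Rightarrow> real"
  assumes f: "\<And>x. (f has_real_derivative D x) (at x)" and D: "\<And>x. D x \<ge> c" and c: "c > 0"
  shows "strict_mono f" "bij f" "(inv f has_real_derivative inverse (D (inv f u))) (at u)"
proof -
  have growth: "c * (b - a) \<le> f b - f a" if "a \<le> b" for a b
  proof -
    have "f a - c * a \<le> f b - c * b"
    proof (rule DERIV_nonneg_imp_nondecreasing[OF that])
      fix x
      have "((\<lambda>x. f x - c * x) has_real_derivative D x - c) (at x)"
        by (auto intro!: derivative_eq_intros f)
      then show "\<exists>y. ((\<lambda>x. f x - c * x) has_real_derivative y) (at x) \<and> 0 \<le> y"
        using D by (intro exI[of _ "D x - c"]) auto
    qed
    then show ?thesis
      by (simp add: algebra_simps)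
  qed
  show mono: "strict_mono f"
  proof (rule strict_monoI)
    fix a b :: real assume "a < b"
    then have "0 < c * (b - a)"
      using c by simp
    then show "f a < f b"
      using growth[of a b] \<open>a < b\<close> by linarith
  qed
  have cont: "isCont f x" for x
    using f DERIV_isCont by blast
  have "\<exists>x. f x = u" for u
  proof -
    define M where "M = \<bar>u - f 0\<bar> / c"
    have M: "M \<ge> 0" "c * M = \<bar>u - f 0\<bar>"
      using c by (auto simp: M_def)
    have "f (- M) \<le> u" "u \<le> f M"
      using growth[of "- M" 0] growth[of 0 M] M by auto
    then show ?thesis
      using IVT[of f "- M" u M] M cont by auto
  qed
  then show bij: "bij f"
    using mono strict_mono_imp_inj_on by (metis bij_def surj_def)
  show "(inv f has_real_derivative inverse (D (inv f u))) (at u)"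
  proof (rule DERIV_inverse_function[where a="u - 1" and b="u + 1"])
    show "(f has_real_derivative D (inv f u)) (at (inv f u))"
      by (rule f)
    show "D (inv f u) \<noteq> 0"
      using D[of "inv f u"] c by linarith
    show "f (inv f y) = y" for y
      using bij by (simp add: bij_is_surj surj_f_inv_f)
    have "isCont (inv f) (f (inv f u))"
      by (rule isCont_inverse_function2[of "inv f u - 1" _ "inv f u + 1"])
         (use bij cont in \<open>auto simp: bij_is_inj inv_f_f\<close>)
    then show "isCont (inv f) u"
      using bij by (simp add: bij_is_surj surj_f_inv_f)
  qed auto
qed

context cmc_params
begin

text \<open>As functions of \<open>t = sin\<^sup>2 x\<close>, the derivatives \<open>d\<phi>/ds\<close>, \<open>dy/ds\<close> and \<open>dy/d\<phi>\<close> are \<open>speed\<close>,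
  \<open>angular_speed\<close> and \<open>w\<close>.  In \<open>q\<close>, the quotient \<open>e t / (1 - t)\<close> is continued to the north pole.\<close>

definition q :: "real \<Rightarrow> real" where
  "q t = (if E = - H then - H else e t / (1 - t))"

definition w :: "real \<Rightarrow> real" where
  "w t = q t * sqrt (1 - t + \<beta> * t) * sqrt \<kappa> / (2 * \<tau> * sqrt t * sqrt (4 * H^2 + \<kappa>))"

definition angular_speed :: "real \<Rightarrow> real" where
  "angular_speed t = q t * sqrt (1 - t + \<beta> * t) / (\<tau> * sqrt (Q t))"

lemma q: "t \<noteq> 1 \<Longrightarrow> q t = e t / (1 - t)"
proof -
  assume "t \<noteq> 1"
  moreover have "E + H * t = - H * (1 - t)" if "E = - H"
    using that by (simp add: algebra_simps)
  then have "e t = - H * (1 - t)" if "E = - H"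
    using that unfolding e_def by blast
  ultimately show ?thesis
    by (simp add: q_def)
qed

text \<open>The square roots of \<open>Q\<close> in dy/ds and d\<phi>/ds cancel, so dy/d\<phi> no
  longer contains \<open>Q\<close>.\<close>

lemma angular_speed_eq:
  assumes "t \<in> {0<..1}" "P t \<ge> 0"
  shows "angular_speed t * inverse (speed t) = w t"
proof -
  have "Q t > 0"
    using Q_pos assms by blast
  define K where "K = 4 * H^2 + \<kappa>"
  have "K > 0"
    using lead_pos by (simp add: K_def)
  then show ?thesis
    unfolding angular_speed_def speed_def w_def K_def[symmetric] using \<open>Q t > 0\<close> assms(1) \<kappa> \<tau>
    by (simp add: real_sqrt_mult real_sqrt_divide field_simps)
qed

lemma rad_pos: "disc > 0 \<Longrightarrow> rad > 0"
  using lead_pos by (simp add: rad_def)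

lemma x_min_max:
  "x_min \<kappa> H E = arcsin (sqrt (mid - rad))" "x_max \<kappa> H E = arcsin (sqrt (mid + rad))"
  by (simp_all add: x_min_def x_max_def mid_def rad_def disc_def diff_divide_distrib add_divide_distrib)

text \<open>Substituting sin^2 x = mid - rad cos p turns the integrand into dF/dp. The substitution
  arccos ((mid - sin^2 x) / rad) is continuous on the closed interval but its derivative blows up at
  the ends, hence the fundamental theorem with derivatives in the interior only. The bounds on mid -
  rad and mid + rad let the interval touch the axis or the pole.\<close>

lemma T_integral_phase:
  assumes disc: "disc > 0" and lo: "mid - rad \<ge> 0" and hi: "mid + rad \<le> 1"
    and F: "\<And>p. (F has_real_derivative w (mid - rad * cos p)) (at p)"
  shows "T_integral \<kappa> \<tau> H E = 2 * (F pi - F 0)"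
proof -
  note rad = rad_pos[OF disc]
  define x1 x2 where "x1 = arcsin (sqrt (mid - rad))" and "x2 = arcsin (sqrt (mid + rad))"
  have sq: "0 \<le> sqrt (mid - rad)" "sqrt (mid - rad) < sqrt (mid + rad)" "sqrt (mid + rad) \<le> 1"
    using lo hi rad by auto
  have x12: "0 \<le> x1" "x1 < x2" "x2 \<le> pi / 2"
  proof -
    have ge: "-1 \<le> sqrt (mid - rad)" "-1 \<le> sqrt (mid + rad)"
      using sq by linarith+
    show "0 \<le> x1"
      unfolding x1_def by (rule arcsin_nonneg) (use sq in auto)
    show "x1 < x2" "x2 \<le> pi / 2"
      unfolding x1_def x2_def using arcsin_less_arcsin[OF ge(1) sq(2,3)] arcsin_ubound[OF ge(2) sq(3)] .
  qed
  have s1: "(sin x1)^2 = mid - rad" and s2: "(sin x2)^2 = mid + rad"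
  proof -
    have "-1 \<le> sqrt (mid - rad)" "-1 \<le> sqrt (mid + rad)" "sqrt (mid - rad) \<le> 1"
      using sq by linarith+
    then show "(sin x1)^2 = mid - rad" "(sin x2)^2 = mid + rad"
      unfolding x1_def x2_def using sq(3) lo rad by (simp_all only: sin_arcsin) simp_all
  qed
  have mono: "(sin a)^2 < (sin b)^2" if "0 \<le> a" "a < b" "b \<le> pi / 2" for a b
    using that by (intro power_strict_mono sin_monotone_2pi sin_ge_zero) auto
  have in_open: "mid - rad < (sin x)^2" "(sin x)^2 < mid + rad" if "x1 < x" "x < x2" for x
    using mono[of x1 x] mono[of x x2] that x12 s1 s2 by auto
  have in_closed: "mid - rad \<le> (sin x)^2" "(sin x)^2 \<le> mid + rad" if "x \<in> {x1..x2}" for x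
    using in_open[of x] that s1 s2 rad by (cases "x = x1"; cases "x = x2"; auto)+
  define u where "u x = (mid - (sin x)^2) / rad" for x
  have u_closed: "-1 \<le> u x" "u x \<le> 1" if "x \<in> {x1..x2}" for x
    using in_closed[OF that] rad by (auto simp: u_def field_simps)
  have u_open: "-1 < u x" "u x < 1" if "x1 < x" "x < x2" for x
    using in_open[OF that] rad by (auto simp: u_def field_simps)
  define f where "f x = (E + H * (sin x)^2) * sqrt (1 + 4 * \<tau>^2 / \<kappa> * (tan x)^2) /
          (\<tau> * sqrt ((sin x)^2 * (cos x)^2 - 4 / \<kappa> * (E + H * (sin x)^2)^2))" for x
  have "(f has_integral F (arccos (u x2)) - F (arccos (u x1))) {x1..x2}"
  proof (rule fundamental_theorem_of_calculus_interior)
    show "x1 \<le> x2"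
      using x12 by simp
    have "continuous_on UNIV F"
      using F DERIV_isCont by (auto intro!: continuous_at_imp_continuous_on)
    moreover have "continuous_on {x1..x2} u"
      unfolding u_def using rad by (intro continuous_intros) auto
    then have "continuous_on {x1..x2} (\<lambda>x. arccos (u x))"
      by (rule continuous_on_arccos) (use u_closed in auto)
    ultimately show "continuous_on {x1..x2} (\<lambda>x. F (arccos (u x)))"
      by (rule continuous_on_compose2) auto
    fix x assume "x \<in> {x1<..<x2}"
    then have x: "x1 < x" "x < x2" "0 < x" "x < pi / 2"
      using x12 by auto
    define s c t where "s = sin x" and "c = cos x" and "t = s^2"
    have sc: "s > 0" "c > 0"
      using x by (auto simp: s_def c_def intro: sin_gt_zero cos_gt_zero)
    have c2: "c^2 = 1 - t"
      by (simp add: c_def s_def t_def cos_squared_eq)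
    have s_eq: "s = sqrt t" and t1: "1 - t > 0" "t > 0"
      unfolding c2[symmetric] using sc by (auto simp: t_def)
    define L where "L = 4 * H^2 + \<kappa>"
    have L: "L > 0"
      using lead_pos by (simp add: L_def)
    \<comment> \<open>This trades the root sqrt (1 - u^2) from the derivative of arccos for the root
      of \<open>P\<close> in the integrand of T.\<close>
    have Pt: "\<kappa> * P t = L * (rad^2 * (1 - (u x)^2))"
    proof -
      have "rad^2 * (u x)^2 = (t - mid)^2"
        using rad by (simp add: u_def t_def s_def power_divide power2_commute)
      then show ?thesis
        using P_rad[of t] disc \<kappa> by (simp add: L_def right_diff_distrib)
    qed
    have u2: "1 - (u x)^2 > 0"
      using u_open[OF x(1,2)] by (simp add: abs_square_less_1 abs_less_iff)
    then have P_pos: "P t > 0"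
      using Pt L rad \<kappa> by (metis mult_pos_pos zero_less_mult_pos zero_less_power)
    have sqrt_P: "sqrt \<kappa> * sqrt (P t) = sqrt L * (rad * sqrt (1 - (u x)^2))"
      using arg_cong[OF Pt, of sqrt] rad by (simp add: real_sqrt_mult)
    have "((\<lambda>x. arccos (u x)) has_real_derivative inverse (- sqrt (1 - (u x)^2)) * (- (2 * s * c) / rad)) (at x)"
    proof (rule DERIV_chain2[OF DERIV_arccos])
      show "(u has_real_derivative - (2 * s * c) / rad) (at x)"
        unfolding u_def[abs_def] s_def c_def using rad by (auto intro!: derivative_eq_intros)
    qed (use u_open[OF x(1,2)] in auto)
    then have "((\<lambda>x. F (arccos (u x))) has_real_derivative
        w (mid - rad * cos (arccos (u x))) * (inverse (- sqrt (1 - (u x)^2)) * (- (2 * s * c) / rad))) (at x)"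
      by (rule DERIV_chain2[OF F])
    moreover have "mid - rad * cos (arccos (u x)) = t"
      using u_open[OF x(1,2)] rad by (simp add: cos_arccos) (simp add: u_def t_def s_def)
    moreover have "w t * (inverse (- sqrt (1 - (u x)^2)) * (- (2 * s * c) / rad)) = f x"
    proof -
      define r where "r = sqrt (1 - (u x)^2)"
      have r: "r > 0"
        using u2 by (simp add: r_def)
      have "inverse (- r) * (- (2 * s * c) / rad) = 2 * s * c * sqrt L / (sqrt \<kappa> * sqrt (P t))"
        unfolding sqrt_P r_def[symmetric] using r rad L by (simp add: field_simps)
      moreover have "w t = e t / (1 - t) * sqrt (1 - t + \<beta> * t) * sqrt \<kappa> / (2 * \<tau> * s * sqrt L)"
        using q[of t] t1 by (simp add: w_def s_eq L_def)
      moreover have "K * sqrt \<kappa> / (2 * \<tau> * s * sqrt L) * (2 * s * c * sqrt L / (sqrt \<kappa> * sqrt (P t))) = K * c / (\<tau> * sqrt (P t))" for K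
        using sc L \<kappa> \<tau> P_pos by (simp add: field_simps)
      ultimately have "w t * (inverse (- r) * (- (2 * s * c) / rad)) = e t / (1 - t) * sqrt (1 - t + \<beta> * t) * c / (\<tau> * sqrt (P t))"
        by (simp only:)
      also have "\<dots> = e t * (sqrt (1 - t + \<beta> * t) / c) / (\<tau> * sqrt (P t))"
        unfolding c2[symmetric] using sc by (simp add: power2_eq_square)
      also have "sqrt (1 - t + \<beta> * t) / c = sqrt (1 + \<beta> * (tan x)^2)"
      proof -
        have "1 + \<beta> * (tan x)^2 = (1 - t + \<beta> * t) / c^2"
          using sc c2 t1 by (simp add: tan_def t_def s_def c_def power_divide add_divide_distrib)
        then show ?thesis
          using sc by (simp add: real_sqrt_divide)
      qed
      finally show ?thesis
        unfolding r_def f_def by (simp add: e_def t_def s_def \<beta>_def P_def cos_squared_eq[of x])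
    qed
    ultimately show "((\<lambda>x. F (arccos (u x))) has_vector_derivative f x) (at x)"
      by (simp add: has_real_derivative_iff_has_vector_derivative)
  qed
  moreover have "u x1 = 1" "u x2 = - 1"
    using rad by (auto simp: u_def s1 s2)
  ultimately have "integral {x1..x2} f = F pi - F 0"
    by (simp add: integral_unique)
  then show ?thesis
    unfolding T_integral_def x_min_max x1_def[symmetric] x2_def[symmetric] f_def by simp
qed

end

section \<open>Arc length and longitude as functions of the phase; periods and compactness\<close>

locale phase_surface = cmc_surface +
  fixes \<phi> :: "real \<Rightarrow> real"
  assumes UNIV: "I = UNIV" and disc_pos: "disc > 0"
    and phase: "\<And>s. hsq s = mid - rad * cos (\<phi> s)"
      "\<And>s. hsq' s = rad * speed (hsq s) * sin (\<phi> s)"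
      "\<And>s. (\<phi> has_real_derivative speed (hsq s)) (at s)"
begin

text \<open>Arc length as a function of the phase.\<close>

definition S :: "real \<Rightarrow> real" where "S = inv \<phi>"

lemma interior_UNIV [simp]: "interior I = UNIV" "s \<in> I"
  by (simp_all add: UNIV)

lemma rad: "rad > 0"
  using rad_pos disc_pos .

lemma phase_mono: "strict_mono \<phi>" and phase_bij: "bij \<phi>"
  and S_derivative: "(S has_real_derivative inverse (speed (hsq (S p)))) (at p)"
  unfolding S_def
  using strictly_increasing_bij[OF phase(3) _ speed_bound_pos] speed_derivative(3) by auto

lemma \<phi>_S [simp]: "\<phi> (S p) = p" and S_\<phi> [simp]: "S (\<phi> s) = s"
  using phase_bij by (auto simp: S_def bij_is_surj surj_f_inv_f bij_is_inj inv_f_f)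

lemma hsq_S: "hsq (S p) = mid - rad * cos p"
  using phase(1)[of "S p"] by simp

lemma t_lo_pos: "mid - rad > 0" and t_hi_le_1: "mid + rad \<le> 1"
  using hsq_pos[of "S 0"] hsq_pos[of "S pi"] by (auto simp: hsq_S)

lemma t_range: "mid - rad * cos p \<in> {0<..1}" "P (mid - rad * cos p) \<ge> 0"
  using hsq_pos[of "S p"] P_hsq_nonneg[of "S p"] by (simp_all add: hsq_S)

lemma S_less_iff: "S a < S b \<longleftrightarrow> a < b"
  by (metis \<phi>_S phase_mono strict_mono_less)

text \<open>Arc length of one full oscillation of the height.\<close>

definition L :: real where "L = 2 * (S pi - S 0)"

lemma L_pos: "L > 0"
  by (simp add: L_def S_less_iff)

lemma S_derivative': "(S has_real_derivative inverse (speed (mid - rad * cos p))) (at p)"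
  using S_derivative by (simp add: hsq_S)

lemma S_shift: "S (p + 2 * pi * of_int n) = S p + of_int n * L"
  and S_reflect: "S (of_int n * pi + h) + S (of_int n * pi - h) = 2 * S (of_int n * pi)"
  unfolding L_def using even_periodic_primitive[OF S_derivative'] by simp_all

end

text \<open>The signs \<open>\<sigma>\<close> account for the passage through the north pole.\<close>

locale profile_surface = phase_surface +
  fixes F A :: "real \<Rightarrow> real" and \<sigma> :: "int \<Rightarrow> real" and z0 :: complex
  assumes F: "\<And>p. (F has_real_derivative w (mid - rad * cos p)) (at p)"
    and profile: "\<And>p. fst (\<gamma> (S p)) = z0 * of_real (A p) * cis (F p)"
    and A_shift: "\<And>p n. A (p + 2 * pi * of_int n) = \<sigma> n * A p"
    and \<sigma>: "\<And>n. \<bar>\<sigma> n\<bar> = 1" "\<And>n. \<sigma> (2 * n) = 1"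
    and z0: "z0 \<noteq> 0" and A0: "A 0 \<noteq> 0"
begin

abbreviation T :: real where "T \<equiv> T_integral \<kappa> \<tau> H E"

lemma F_shift: "F (p + 2 * pi * of_int n) = F p + of_int n * T"
  and F_reflect: "F (of_int n * pi + h) + F (of_int n * pi - h) = 2 * F (of_int n * pi)"
proof -
  have "T = 2 * (F pi - F 0)"
    using T_integral_phase[OF disc_pos _ t_hi_le_1 F] t_lo_pos by simp
  then show "F (p + 2 * pi * of_int n) = F p + of_int n * T"
    using even_periodic_primitive_shift[OF F, of p n] by simp
  show "F (of_int n * pi + h) + F (of_int n * pi - h) = 2 * F (of_int n * pi)"
    using even_periodic_primitive_reflect[OF F] by simp
qed

lemma gamma_S: "\<gamma> (S p) = (z0 * of_real (A p) * cis (F p), sqrt (mid - rad * cos p))"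
proof -
  have "snd (\<gamma> (S p)) = sqrt (hsq (S p))"
    using gamma_in(2)[of "S p"] by (simp add: hsq_def)
  then show ?thesis
    by (simp add: prod_eq_iff profile hsq_S)
qed

text \<open>A period preserves the height, and the minimal height occurs exactly at phases in 2
  \<pi> times the integers. So d carries phase 0 to some 2 \<pi> n, that is, d consists of n
  oscillations. Comparing first components at phase 0, where they do not vanish, gives the condition
  on the turning angle.\<close>

lemma period_imp:
  assumes "\<And>s. \<gamma> (s + d) = \<gamma> s"
  obtains n where "d = of_int n * L" "of_real (\<sigma> n) * cis (of_int n * T) = 1"
proof -
  have "hsq (S 0 + d) = hsq (S 0)"
    using assms by (simp add: hsq_def)
  then have "cos (\<phi> (S 0 + d)) = 1"
    using rad by (simp add: phase(1))
  then obtain n :: int where n: "\<phi> (S 0 + d) = of_int n * (2 * pi)"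
    by (auto simp: cos_one_2pi_int mult_ac)
  then have *: "S 0 + d = S (0 + 2 * pi * of_int n)"
    by (metis S_\<phi> add_0 mult.commute)
  then have "d = of_int n * L"
    using S_shift[of 0 n] by simp
  moreover have "of_real (\<sigma> n) * cis (of_int n * T) = 1"
  proof -
    have "z0 * of_real (\<sigma> n * A 0) * cis (F 0 + of_int n * T) = z0 * of_real (A 0) * cis (F 0)"
      using assms[of "S 0"] unfolding * gamma_S A_shift F_shift by simp
    then have "(z0 * of_real (A 0) * cis (F 0)) * (of_real (\<sigma> n) * cis (of_int n * T)) = z0 * of_real (A 0) * cis (F 0)"
      by (simp add: cis_mult[symmetric] mult_ac)
    then show ?thesis
      using z0 A0 by simp
  qed
  ultimately show ?thesis
    using that by blast
qed

lemma period_if: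
  assumes "of_real (\<sigma> n) * cis (of_int n * T) = 1"
  shows "\<gamma> (s + of_int n * L) = \<gamma> s"
proof -
  have "s + of_int n * L = S (\<phi> s + 2 * pi * of_int n)"
    by (simp add: S_shift)
  then have "\<gamma> (s + of_int n * L) = (z0 * of_real (A (\<phi> s)) * cis (F (\<phi> s)) * (of_real (\<sigma> n) * cis (of_int n * T)),
      sqrt (mid - rad * cos (\<phi> s + 2 * pi * of_int n)))"
    by (simp only: gamma_S A_shift F_shift) (simp add: cis_mult[symmetric] mult_ac)
  also have "cos (\<phi> s + 2 * pi * of_int n) = cos (\<phi> s)"
    by (simp add: cos_add cos_int_2pin sin_int_2pin)
  finally show ?thesis
    using assms gamma_S[of "\<phi> s"] by simp
qed

text \<open>On the line, compactness is periodicity. For a period the number cis (n T) equals a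
  sign, so sin (n T) = 0. Conversely, if T = \<pi> a / b, then 2 b oscillations turn the curve
  through 2 \<pi> a, and their even number makes the sign \<sigma> equal to 1.\<close>

lemma compact_iff: "compact_surface \<gamma> I \<longleftrightarrow> T / pi \<in> \<rat>"
proof
  assume "compact_surface \<gamma> I"
  moreover have "\<not> compact I"
    using compact_imp_bounded by (simp add: UNIV)
  ultimately obtain d where d: "d > 0" "\<And>s. \<gamma> (s + d) = \<gamma> s"
    unfolding compact_surface_def by blast
  obtain n where n: "d = of_int n * L" "of_real (\<sigma> n) * cis (of_int n * T) = 1"
    using period_imp[OF d(2)] by blast
  have "n \<noteq> 0"
    using n d by auto
  have "\<sigma> n * sin (of_int n * T) = 0"
    using arg_cong[OF n(2), of Im] by simp
  then have "sin (of_int n * T) = 0"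
    using \<sigma>(1)[of n] by auto
  then obtain m :: int where "of_int n * T = of_int m * pi"
    by (auto simp: sin_zero_iff_int2)
  then have "T / pi = of_int m / of_int n"
    using \<open>n \<noteq> 0\<close> by (simp add: field_simps)
  then show "T / pi \<in> \<rat>"
    by simp
next
  assume "T / pi \<in> \<rat>"
  then obtain a b :: int where ab: "b > 0" "T / pi = of_int a / of_int b"
    by (metis Rats_cases')
  then have "of_int (2 * b) * T = 2 * pi * of_int a"
    by (simp add: field_simps)
  then have "of_real (\<sigma> (2 * b)) * cis (of_int (2 * b) * T) = 1"
    using \<sigma>(2) by (simp only:) (simp add: cis.ctr complex_eq_iff cos_int_2pin sin_int_2pin)
  then have "\<gamma> (s + of_int (2 * b) * L) = \<gamma> s" for s
    by (rule period_if)
  moreover have "of_int (2 * b) * L > 0"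
    using ab(1) L_pos by simp
  ultimately show "compact_surface \<gamma> I"
    unfolding compact_surface_def UNIV by blast
qed

end

section \<open>Clifford tori and nodoids\<close>

text \<open>On a compact interval \<Psi> is bounded, so it meets only finitely many multiples of
  \<pi>, each at most once by injectivity.\<close>

lemma finite_phase_zeros:
  fixes \<Psi> :: "real \<Rightarrow> real"
  assumes "continuous_on UNIV \<Psi>" "inj \<Psi>"
  shows "finite ({u. sin (\<Psi> u) = 0} \<inter> {a..b})"
proof -
  have "compact (\<Psi> ` {a..b})"
    using assms(1) continuous_on_subset by (intro compact_continuous_image) blast+
  then obtain B where B: "\<And>u. u \<in> {a..b} \<Longrightarrow> \<bar>\<Psi> u\<bar> \<le> B"
    using compact_imp_bounded[OF \<open>compact (\<Psi> ` {a..b})\<close>] unfolding bounded_iff by (metis imageI real_norm_def)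
  define N where "N = \<lceil>B / pi\<rceil>"
  have "\<Psi> ` ({u. sin (\<Psi> u) = 0} \<inter> {a..b}) \<subseteq> (\<lambda>n. of_int n * pi) ` {- N..N}"
  proof clarsimp
    fix u assume u: "sin (\<Psi> u) = 0" "a \<le> u" "u \<le> b"
    then obtain n :: int where n: "\<Psi> u = of_int n * pi"
      by (auto simp: sin_zero_iff_int2)
    then have "\<bar>of_int n\<bar> * pi \<le> B"
      using B[of u] u by (simp add: abs_mult)
    then have "\<bar>of_int n :: real\<bar> \<le> B / pi"
      by (simp add: pos_le_divide_eq)
    then have "\<bar>n\<bar> \<le> N"
      unfolding N_def by linarith
    then show "\<Psi> u \<in> (\<lambda>n. of_int n * pi) ` {- N..N}"
      using n by (auto simp: abs_le_iff)
  qed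
  then have "finite (\<Psi> ` ({u. sin (\<Psi> u) = 0} \<inter> {a..b}))"
    using finite_surj finite_atLeastAtMost_int by blast
  then show ?thesis
    using assms(2) by (metis finite_imageD inj_on_subset subset_UNIV)
qed

lemma cos_reflect: "cos (of_int n * pi + h) = cos (of_int n * pi - (h::real))"
  by (simp add: cos_add cos_diff sin_zero_iff_int2)

lemma cos_even_multiple:
  assumes "even n"
  shows "cos (h - of_int n * pi) = cos (h::real)" "cos (of_int n * pi - h) = cos h"
proof -
  obtain b where "n = 2 * b"
    using assms by (rule evenE)
  then have n: "of_int n * pi = 2 * pi * of_int b"
    by simp
  show "cos (h - of_int n * pi) = cos h" "cos (of_int n * pi - h) = cos h"
    unfolding n cos_diff by (simp_all add: cos_int_2pin sin_int_2pin)
qed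

context cmc_params
begin

lemma disc_factor: "disc = - 16 * \<kappa> * ((E - torus_energy \<kappa> H 1) * (E - torus_energy \<kappa> H (- 1)))"
proof -
  have "(sqrt (4 * H^2 + \<kappa>))^2 = 4 * H^2 + \<kappa>"
    using lead_pos by simp
  then show ?thesis
    unfolding disc_def torus_energy_def by (simp add: power2_eq_square field_simps)
qed

lemma disc_0_iff: "disc = 0 \<longleftrightarrow> (\<exists>\<sigma>\<in>{1, -1}. E = torus_energy \<kappa> H \<sigma>)"
  using \<kappa> by (auto simp: disc_factor)

text \<open>For these energies E + H t keeps the sign of E on the unit interval and stays away from
  0, while the remaining factors are bounded below. The longitude is then monotone in the phase at a
  uniform rate, which makes the curve a graph over the whole line.\<close>

lemma w_bounds:
  assumes E: "E > 0 \<or> E < - H"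
  obtains c where "c > 0" "\<And>t. t \<in> {0<..<1} \<Longrightarrow> c \<le> sgn (\<tau> * E) * w t"
proof -
  define K where "K = sqrt \<kappa> / (2 * \<bar>\<tau>\<bar> * sqrt (4 * H^2 + \<kappa>))"
  have K: "K > 0"
    using \<kappa> \<tau> lead_pos by (simp add: K_def)
  \<comment> \<open>The least value of |E + H t| on the unit interval: at t = 0 if E > 0, at t = 1
    if E < - H.\<close>
  define m where "m = (if E > 0 then E else - (E + H))"
  have m: "m > 0"
    using E H by (auto simp: m_def)
  have lower: "m * sqrt (min 1 \<beta>) * K \<le> sgn (\<tau> * E) * w t" if t: "t \<in> {0<..<1}" for t
  proof -
    have E_e: "m \<le> sgn E * e t"
    proof (cases "E > 0")
      case True
      then show ?thesis
        using H t by (simp add: m_def e_def)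
    next
      case False
      then have "E < - H" "E < 0"
        using E H by auto
      moreover have "H * t \<le> H"
        using H t by (simp add: mult_left_le)
      ultimately show ?thesis
        using False by (simp add: m_def e_def)
    qed
    have 1: "m \<le> sgn E * e t / (1 - t)"
    proof -
      have "m * (1 - t) \<le> m"
        using m t by (simp add: mult_left_le)
      then show ?thesis
        using E_e t by (simp add: pos_le_divide_eq)
    qed
    have 2: "sqrt (min 1 \<beta>) \<le> sqrt (1 - t + \<beta> * t) / sqrt t"
    proof -
      have "min 1 \<beta> = min 1 \<beta> * (1 - t) + min 1 \<beta> * t"
        by (simp add: algebra_simps)
      also have "\<dots> \<le> 1 * (1 - t) + \<beta> * t"
        using t by (intro add_mono mult_right_mono) auto
      finally have "min 1 \<beta> \<le> 1 - t + \<beta> * t"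
        by simp
      then have "sqrt (min 1 \<beta>) \<le> sqrt (1 - t + \<beta> * t)"
        by (rule real_sqrt_le_mono)
      moreover have "sqrt (min 1 \<beta>) * sqrt t \<le> sqrt (min 1 \<beta>)"
        using t \<beta> by (intro mult_left_le) auto
      ultimately have "sqrt (min 1 \<beta>) * sqrt t \<le> sqrt (1 - t + \<beta> * t)"
        by linarith
      then show ?thesis
        using t by (simp add: pos_le_divide_eq)
    qed
    have "m * sqrt (min 1 \<beta>) * K \<le> (sgn E * e t / (1 - t)) * (sqrt (1 - t + \<beta> * t) / sqrt t) * K"
      using 1 2 m K \<beta> t by (intro mult_right_mono mult_mono) auto
    also have "\<dots> = sgn (\<tau> * E) * w t"
    proof -
      have "1 / \<bar>\<tau>\<bar> = sgn \<tau> / \<tau>"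
        using \<tau> by (simp add: sgn_if)
      then have "K = sgn \<tau> * (sqrt \<kappa> / (2 * \<tau> * sqrt (4 * H^2 + \<kappa>)))"
        using \<tau> by (cases "\<tau> > 0") (auto simp: K_def)
      then show ?thesis
        using q[of t] t by (simp add: w_def sgn_mult mult_ac)
    qed
    finally show ?thesis .
  qed
  moreover have "m * sqrt (min 1 \<beta>) * K > 0"
    using m K \<beta> by simp
  ultimately show ?thesis
    using that by blast
qed

end

context cmc_surface
begin

text \<open>In every chart y has the same derivative, a function of the height. Charts thus differ
  by constants in y, which is what allows them to be joined.\<close>

lemma polar_angular_speed:
  assumes "polar_coordinates \<gamma> J x y \<alpha>" "open J" "J \<subseteq> I" "s \<in> J"
  shows "sin (\<alpha> s) / cos (x s) = angular_speed (hsq s)" "(y has_real_derivative angular_speed (hsq s)) (at s)"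
proof -
  have x: "0 < x s" "x s < pi / 2"
    using assms by (auto simp: polar_coordinates_def)
  define t where "t = (sin (x s))^2"
  have "cos (x s) > 0"
    using x by (auto intro: cos_gt_zero)
  then have "1 - t > 0"
    unfolding t_def using cos_squared_eq[of "x s"] by (metis zero_less_power)
  then have "t \<noteq> 1"
    by auto
  then show *: "sin (\<alpha> s) / cos (x s) = angular_speed (hsq s)"
    using polar_sin[OF x polar_energy[OF assms(2,3,1,4)]] q
    unfolding polar_hsq(1)[OF assms] t_def[symmetric] angular_speed_def by (simp add: mult_ac)
  show "(y has_real_derivative angular_speed (hsq s)) (at s)"
    using assms(1,4) unfolding *[symmetric] by (simp add: polar_coordinates_def)
qed

lemma global_polar_coordinates:
  assumes "E \<noteq> 0" "E \<noteq> - H"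
  obtains x y \<alpha> where "polar_coordinates \<gamma> UNIV x y \<alpha>"
proof -
  have I: "I = UNIV"
    using I_UNIV assms by blast
  have "\<exists>x y \<alpha>. polar_coordinates \<gamma> UNIV x y \<alpha>"
    using pole_energy assms north_pole_iff by (intro polar_coordinates_exist) (auto simp: I)
  then show ?thesis
    using that by blast
qed

text \<open>Here disc = 0, so rad = 0 and the height is constant. The longitude is affine in s with
  nonzero slope, so every longitude is attained and the surface is the entire torus, not just a part
  of it.\<close>

lemma clifford_torus_if:
  assumes \<sigma>: "\<sigma> \<in> {1, -1}" and E: "E = torus_energy \<kappa> H \<sigma>"
  shows "surface_set \<gamma> I = clifford_torus (sqrt (1 / 2 + \<sigma> * H / sqrt (4 * H^2 + \<kappa>)))"
proof -
  define R where "R = sqrt (4 * H^2 + \<kappa>)"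
  have R: "R > 0" "R^2 = 4 * H^2 + \<kappa>"
    using lead_pos by (auto simp: R_def)
  have "(2 * H)^2 < R^2"
    using R \<kappa> by (simp add: power_mult_distrib)
  then have R2: "2 * H < R"
    using R(1) by (rule power2_less_imp_less[OF _ less_imp_le])
  have E': "4 * E = - 2 * H + \<sigma> * R"
    using E by (simp add: torus_energy_def R_def)
  \<comment> \<open>Because 2 H < R, the number 4 E = - 2 H + \<sigma> R is positive for \<sigma> =
    1 and less than - 4 H for \<sigma> = - 1.\<close>
  have E0: "E \<noteq> 0" and EH: "E \<noteq> - H"
    using E' R2 H R(1) \<sigma> by auto
  have I: "I = UNIV"
    using I_UNIV[OF E0] .
  have "disc = 0"
    using disc_0_iff \<sigma> E by blast
  then have hsq_mid: "hsq s = mid" for s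
    using hsq_range[of s] by (simp add: I rad_def)
  have mid: "mid = 1 / 2 - \<sigma> * H / R"
  proof -
    have "\<sigma>^2 = 1"
      using \<sigma> by auto
    have "\<kappa> - 8 * H * E = R^2 - 2 * \<sigma> * H * R"
    proof -
      have "\<kappa> - 8 * H * E = \<kappa> - 2 * H * (4 * E)"
        by simp
      then show ?thesis
        unfolding E' using R(2) by (simp add: power2_eq_square algebra_simps)
    qed
    then have "mid = (R^2 - 2 * \<sigma> * H * R) / (2 * R^2)"
      unfolding mid_def R(2)[symmetric] by simp
    also have "\<dots> = 1 / 2 - \<sigma> * H / R"
      using R(1) by (simp add: power2_eq_square field_simps)
    finally show ?thesis .
  qed
  obtain x y \<alpha> where polar: "polar_coordinates \<gamma> UNIV x y \<alpha>"
    using global_polar_coordinates[OF E0 EH] .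
  have x: "0 < x s" "x s < pi / 2" and \<gamma>: "\<gamma> s = (of_real (cos (x s)) * cis (y s), sin (x s))" for s
    using polar by (auto simp: polar_coordinates_def)
  have sc: "sin (x s) > 0" "cos (x s) > 0" for s
    using x by (auto intro: sin_gt_zero2 cos_gt_zero)
  have sin_x: "sin (x s) = sqrt mid" and cos_x: "cos (x s) = sqrt (1 - mid)" for s
  proof -
    have s2: "(sin (x s))^2 = mid"
      using hsq_mid polar_hsq(1)[OF polar, of s] I by simp
    then show "sin (x s) = sqrt mid"
      using sc by (simp add: real_sqrt_unique less_imp_le)
    have "(cos (x s))^2 = 1 - mid"
      using s2 by (simp add: cos_squared_eq)
    then show "cos (x s) = sqrt (1 - mid)"
      using sc by (simp add: real_sqrt_unique less_imp_le)
  qed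
  define k where "k = angular_speed mid"
  have y: "(y has_real_derivative k) (at s)" for s
    using polar_angular_speed(2)[OF polar, of s] I by (simp add: hsq_mid k_def)
  \<comment> \<open>Constant height gives cos \<alpha> = 0; if k vanished, so would sin
    \<alpha>.\<close>
  have "k \<noteq> 0"
  proof
    assume "k = 0"
    then have "sin (\<alpha> 0) = 0"
      using polar_angular_speed(1)[OF polar, of 0] sc[of 0] I by (simp add: hsq_mid k_def)
    moreover have "hsq' 0 = 0"
    proof -
      have "(hsq has_real_derivative 0) (at 0)"
        using hsq_mid by (simp add: fun_eq_iff[symmetric] ext[of hsq "\<lambda>_. mid"])
      then show ?thesis
        using hsq_derivatives(1)[of 0] DERIV_unique by (auto simp: I)
    qed
    then have "cos (\<alpha> 0) = 0"
      using polar_hsq(2)[OF polar, of 0] sc[of 0] I by auto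
    ultimately show False
      using sin_cos_squared_add[of "\<alpha> 0"] by simp
  qed
  have y_eq: "y s = y 0 + k * s" for s
  proof -
    have "((\<lambda>s. y s - k * s) has_real_derivative 0) (at x)" for x
      by (auto intro!: derivative_eq_intros y)
    from DERIV_isconst_all[of "\<lambda>s. y s - k * s" s 0] this show ?thesis
      by simp
  qed
  have "(z, cmod v) \<in> \<gamma> ` I \<longleftrightarrow> (z, v) \<in> S3 \<and> (cmod z)^2 = 1 - mid \<and> (cmod v)^2 = mid" for z v
  proof
    assume "(z, cmod v) \<in> \<gamma> ` I"
    then obtain s where s: "z = of_real (cos (x s)) * cis (y s)" "cmod v = sin (x s)"
      using \<gamma> by auto
    have "sin (x s) > 0" "cos (x s) > 0"
      by (rule sc)+
    then have "(cmod z)^2 = 1 - mid" "(cmod v)^2 = mid"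
      unfolding s norm_mult norm_of_real norm_cis
      using hsq_mid[of s] polar_hsq(1)[OF polar, of s] I by (auto simp: cos_squared_eq)
    then show "(z, v) \<in> S3 \<and> (cmod z)^2 = 1 - mid \<and> (cmod v)^2 = mid"
      by (simp add: S3_def)
  next
    assume a: "(z, v) \<in> S3 \<and> (cmod z)^2 = 1 - mid \<and> (cmod v)^2 = mid"
    then have cz: "cmod z = sqrt (1 - mid)" and cv: "cmod v = sqrt mid"
      by (metis norm_ge_zero real_sqrt_unique)+
    define s where "s = (Arg z - y 0) / k"
    have "y s = Arg z"
      using \<open>k \<noteq> 0\<close> y_eq[of s] by (simp add: s_def)
    moreover have "z = of_real (cmod z) * cis (Arg z)"
      using rcis_cmod_Arg[of z] by (simp add: rcis_def)
    ultimately have "(z, cmod v) = \<gamma> s"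
      using \<gamma>[of s] sin_x[of s] cos_x[of s] cz cv by simp
    then show "(z, cmod v) \<in> \<gamma> ` I"
      by (simp add: I)
  qed
  moreover have "1 / 2 + \<sigma> * H / R = 1 - mid" "1 - mid \<ge> 0"
    using mid sc(2)[of 0] cos_x[of 0] by auto
  ultimately show ?thesis
    unfolding surface_set_def clifford_torus_def R_def[symmetric] by auto
qed

end

section \<open>Curves with global polar coordinates\<close>

locale polar_surface = phase_surface +
  fixes x y \<alpha> :: "real \<Rightarrow> real"
  assumes polar: "polar_coordinates \<gamma> UNIV x y \<alpha>"
begin

lemma polar_at:
  "\<gamma> s = (of_real (cos (x s)) * cis (y s), sin (x s))" "0 < x s" "x s < pi / 2"
  "(x has_real_derivative cos (\<alpha> s)) (at s)" "sin (x s) > 0" "cos (x s) > 0"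
  using polar by (auto simp: polar_coordinates_def intro: sin_gt_zero2 cos_gt_zero)

lemma polar_at':
  "hsq s = (sin (x s))^2" "hsq' s = 2 * sin (x s) * cos (x s) * cos (\<alpha> s)"
  "sin (\<alpha> s) / cos (x s) = angular_speed (hsq s)" "(y has_real_derivative angular_speed (hsq s)) (at s)"
  using polar_hsq[OF polar] polar_angular_speed[OF polar] by (simp_all add: UNIV)

lemma hsq_less_1: "hsq s < 1"
proof -
  have "1 - hsq s > 0"
    unfolding polar_at' using polar_at(6)[of s] cos_squared_eq[of "x s"] by (metis zero_less_power)
  then show ?thesis
    by simp
qed

lemma t_hi_less_1: "mid + rad < 1"
  using hsq_less_1[of "S pi"] by (simp add: hsq_S)

lemma t_open: "mid - rad * cos p \<in> {0<..<1}"
  using hsq_less_1[of "S p"] t_range(1)[of p] by (simp add: hsq_S)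

lemma cos_x: "cos (x s) = sqrt (1 - hsq s)" and sin_x: "sin (x s) = sqrt (hsq s)"
proof -
  have "(cos (x s))^2 = 1 - hsq s"
    by (simp add: polar_at' cos_squared_eq)
  then show "cos (x s) = sqrt (1 - hsq s)"
    using polar_at(6)[of s] by (simp add: real_sqrt_unique less_imp_le)
  show "sin (x s) = sqrt (hsq s)"
    using polar_at(5)[of s] by (simp add: polar_at')
qed

text \<open>\<open>F\<close> is the longitude and \<open>g\<close> the latitude as a function of the
  phase.\<close>

definition F :: "real \<Rightarrow> real" where "F p = y (S p)"
definition g :: "real \<Rightarrow> real" where "g p = arcsin (sqrt (mid - rad * cos p))"

lemma y_eq: "y s = F (\<phi> s)" and x_eq: "x s = g (\<phi> s)"
proof -
  show "y s = F (\<phi> s)"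
    by (simp add: F_def)
  have "x s = arcsin (sin (x s))"
    using polar_at(2,3)[of s] by (simp add: arcsin_sin)
  then show "x s = g (\<phi> s)"
    by (simp add: g_def sin_x phase(1)[of s])
qed

lemma F_derivative: "(F has_real_derivative w (mid - rad * cos p)) (at p)"
proof -
  have "(F has_real_derivative angular_speed (hsq (S p)) * inverse (speed (hsq (S p)))) (at p)"
    unfolding F_def[abs_def] by (rule DERIV_chain2[OF polar_at'(4) S_derivative])
  then show ?thesis
    using angular_speed_eq[OF t_range] by (simp add: hsq_S)
qed

end

text \<open>With no pole on the curve the factor \<open>A\<close> is |z| itself, which is 2
  \<pi>-periodic, so all signs \<sigma> are 1.\<close>

sublocale polar_surface \<subseteq> profile_surface \<gamma> I \<kappa> \<tau> H E \<phi> F "\<lambda>p. sqrt (1 - (mid - rad * cos p))" "\<lambda>_. 1" 1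
proof unfold_locales
  fix p :: real and n :: int
  show "(F has_real_derivative w (mid - rad * cos p)) (at p)"
    by (rule F_derivative)
  show "fst (\<gamma> (S p)) = 1 * complex_of_real (sqrt (1 - (mid - rad * cos p))) * cis (F p)"
    by (simp only: polar_at(1)[of "S p"] cos_x[of "S p"] hsq_S F_def fst_conv mult_1_left)
  show "sqrt (1 - (mid - rad * cos (p + 2 * pi * real_of_int n))) = 1 * sqrt (1 - (mid - rad * cos p))"
    by (simp add: cos_add cos_int_2pin sin_int_2pin)
  show "sqrt (1 - (mid - rad * cos 0)) \<noteq> 0"
    using t_open[of 0] by simp
qed auto

context polar_surface
begin

lemma g_range: "range g = {x_min \<kappa> H E..x_max \<kappa> H E}" "x_min \<kappa> H E < x_max \<kappa> H E"
proof -
  have lo: "0 < mid - rad" and hi: "mid + rad < 1"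
    using t_lo_pos t_hi_less_1 by auto
  have rt: "sqrt (mid - rad * cos p) \<in> {0<..<1}" for p
    using t_open[of p] by simp
  have mono: "arcsin (sqrt a) \<le> arcsin (sqrt b)" if "0 \<le> a" "a \<le> b" "b \<le> 1" for a b
  proof (rule arcsin_le_arcsin)
    show "-1 \<le> sqrt a"
      using that(1) real_sqrt_ge_zero[of a] by linarith
  qed (use that in auto)
  have "g p \<in> {arcsin (sqrt (mid - rad))..arcsin (sqrt (mid + rad))}" for p
  proof -
    have "rad * cos p \<le> rad * 1" "rad * (- 1) \<le> rad * cos p"
      using rad by (intro mult_left_mono; simp)+
    then show ?thesis
      unfolding g_def using lo hi by (auto intro!: mono)
  qed
  moreover have "v \<in> range g" if v: "v \<in> {arcsin (sqrt (mid - rad))..arcsin (sqrt (mid + rad))}" for v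
  proof -
    have ge0: "0 \<le> sqrt (mid - rad)" "0 \<le> sqrt (mid + rad)"
      using lo rad by auto
    have "-1 \<le> sqrt (mid - rad)" "sqrt (mid - rad) \<le> 1" "-1 \<le> sqrt (mid + rad)" "sqrt (mid + rad) \<le> 1"
      using ge0 rt[of 0] rt[of pi] by (linarith, simp, linarith, simp)
    note si = sin_arcsin[OF this(1,2)] sin_arcsin[OF this(3,4)] arcsin_bounded[OF this(1,2)] arcsin_bounded[OF this(3,4)]
    have v0: "0 \<le> v" "v \<le> pi / 2" "- (pi / 2) \<le> v"
      using v si arcsin_nonneg[of "sqrt (mid - rad)"] rt[of 0] by auto
    have "sin (arcsin (sqrt (mid - rad))) \<le> sin v" "sin v \<le> sin (arcsin (sqrt (mid + rad)))"
      using v v0 si by (intro sin_monotone_2pi_le; simp)+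
    then have "sqrt (mid - rad) \<le> sin v" "sin v \<le> sqrt (mid + rad)"
      using si by auto
    moreover have s0: "0 \<le> sin v"
      using v0 by (simp add: sin_ge_zero)
    ultimately have "mid - rad \<le> (sin v)^2" "(sin v)^2 \<le> mid + rad"
      using lo by (auto simp: real_le_lsqrt sqrt_le_D) (smt (verit) power2_le_imp_le real_sqrt_pow2 power_mono rad)
    then have u: "-1 \<le> (mid - (sin v)^2) / rad" "(mid - (sin v)^2) / rad \<le> 1"
      using rad by (auto simp: field_simps)
    have "g (arccos ((mid - (sin v)^2) / rad)) = v"
      unfolding g_def cos_arccos[OF u] using rad s0 v0 by (simp add: arcsin_sin)
    then show ?thesis
      by (metis rangeI)
  qed
  ultimately show "range g = {x_min \<kappa> H E..x_max \<kappa> H E}"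
    unfolding x_min_max by blast
  show "x_min \<kappa> H E < x_max \<kappa> H E"
    unfolding x_min_max
  proof (rule arcsin_less_arcsin)
    show "-1 \<le> sqrt (mid - rad)"
      using lo by (intro order_trans[OF _ real_sqrt_ge_zero]) auto
  qed (use rad lo hi in auto)
qed

lemma g_even: "g (of_int n * pi + h) = g (of_int n * pi - h)"
  unfolding g_def cos_reflect[of n h] ..

lemma g_shift: "g (p + 2 * pi * of_int n) = g p"
  by (simp add: g_def cos_add cos_int_2pin sin_int_2pin)

lemma g_extremal: "sin p = 0 \<Longrightarrow> g p \<in> {x_min \<kappa> H E, x_max \<kappa> H E}"
  "g 0 = x_min \<kappa> H E" "g pi = x_max \<kappa> H E"
proof -
  show "g 0 = x_min \<kappa> H E" "g pi = x_max \<kappa> H E"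
    by (simp_all add: g_def x_min_max)
  assume "sin p = 0"
  then have "cos p = 1 \<or> cos p = -1"
    using sin_zero_abs_cos_one abs_1 by (metis abs_eq_iff)
  then show "g p \<in> {x_min \<kappa> H E, x_max \<kappa> H E}"
    by (auto simp: g_def x_min_max)
qed

text \<open>Zeros of x' are the parameters of phase n \<pi>, and the reflections there come from
  \<open>g_even\<close> and \<open>F_reflect\<close>. The sign of sin \<alpha> is that of \<tau> (t
  - t0), with t0 the root of E + H t. Since t is monotone over each half turn of the phase, that
  root is crossed once.\<close>

lemma nodoid:
  assumes E: "- H < E" "E < 0"
  shows "nodoid_type \<gamma> I (x_min \<kappa> H E) (x_max \<kappa> H E)"
proof -
  define K where "K = {s. deriv x s = 0}"
  have K: "K = {s. sin (\<phi> s) = 0}"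
  proof -
    have "deriv x s = 0 \<longleftrightarrow> sin (\<phi> s) = 0" for s
    proof -
      have "deriv x s = cos (\<alpha> s)"
        using DERIV_imp_deriv[OF polar_at(4)] .
      also have "cos (\<alpha> s) = 0 \<longleftrightarrow> hsq' s = 0"
        using polar_at(5,6)[of s] by (auto simp: polar_at'(2))
      also have "\<dots> \<longleftrightarrow> sin (\<phi> s) = 0"
        using rad speed_derivative(3)[of s] speed_bound_pos by (auto simp: phase(2))
      finally show ?thesis .
    qed
    then show ?thesis
      by (simp add: K_def)
  qed
  have K_S: "s \<in> K \<longleftrightarrow> (\<exists>n::int. s = S (of_int n * pi))" for s
  proof -
    have "s \<in> K \<longleftrightarrow> (\<exists>n::int. \<phi> s = of_int n * pi)"
      unfolding K mem_Collect_eq by (rule sin_zero_iff_int2)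
    also have "\<dots> \<longleftrightarrow> (\<exists>n::int. s = S (of_int n * pi))"
      by (rule ex_cong1) (metis S_\<phi> \<phi>_S)
    finally show ?thesis .
  qed
  have "range x = {x_min \<kappa> H E..x_max \<kappa> H E}"
  proof -
    have "range x = g ` range \<phi>"
      using x_eq by auto
    then show ?thesis
      using phase_bij g_range(1) by (simp add: bij_is_surj)
  qed
  moreover have "x ` K = {x_min \<kappa> H E, x_max \<kappa> H E}"
  proof
    show "x ` K \<subseteq> {x_min \<kappa> H E, x_max \<kappa> H E}"
      using g_extremal(1) by (auto simp: K x_eq)
    have "S 0 \<in> K" "S pi \<in> K" "x (S 0) = x_min \<kappa> H E" "x (S pi) = x_max \<kappa> H E"
      by (simp_all add: K x_eq g_extremal)
    then show "{x_min \<kappa> H E, x_max \<kappa> H E} \<subseteq> x ` K"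
      by (metis bot_least imageI insert_subset)
  qed
  moreover have "finite (K \<inter> {a..b})" for a b
    unfolding K using phase_bij phase(3) DERIV_isCont
    by (intro finite_phase_zeros) (auto simp: bij_is_inj intro!: continuous_at_imp_continuous_on)
  moreover have "x (c + h) = x (c - h) \<and> y (c + h) - y c = - (y (c - h) - y c)" if cK: "c \<in> K" for c h
  proof -
    obtain n :: int where c: "c = S (of_int n * pi)"
      using cK K_S[of c] by blast
    define k where "k = \<phi> (c + h) - of_int n * pi"
    have ch: "c + h = S (of_int n * pi + k)"
      by (simp add: k_def)
    then have ch': "c - h = S (of_int n * pi - k)"
      using S_reflect[of n k] c by simp
    have "x (c + h) = x (c - h)"
      unfolding ch ch' x_eq \<phi>_S by (rule g_even)
    moreover have "y (c + h) + y (c - h) = 2 * y c"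
      unfolding ch ch' unfolding c F_def[symmetric] by (rule F_reflect)
    ultimately show ?thesis
      by simp
  qed
  moreover have "\<exists>c\<in>{a<..<b}.
       (\<forall>s\<in>{a..<c}. sin (\<alpha> s) < 0) \<and> (\<forall>s\<in>{c<..b}. sin (\<alpha> s) > 0) \<or>
       (\<forall>s\<in>{a..<c}. sin (\<alpha> s) > 0) \<and> (\<forall>s\<in>{c<..b}. sin (\<alpha> s) < 0)"
    if ab: "a \<in> K" "b \<in> K" "a < b" "K \<inter> {a<..<b} = {}" for a b
  proof -
    obtain n m :: int where n: "a = S (of_int n * pi)" and m: "b = S (of_int m * pi)"
      using ab K_S by meson
    have "n < m"
      using ab(3) by (simp add: n m S_less_iff)
    moreover have "\<not> n + 1 < m"
    proof
      assume "n + 1 < m"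
      then have "S (of_int (n + 1) * pi) \<in> {a<..<b}"
        unfolding n m greaterThanLessThan_iff S_less_iff by simp
      moreover have "S (of_int (n + 1) * pi) \<in> K"
        using K_S by blast
      ultimately show False
        using ab(4) by blast
    qed
    ultimately have "m = n + 1"
      by simp
    have H_pos: "H > 0"
      using E by simp
    \<comment> \<open>At this height P t0 = t0 (1 - t0) > 0, which puts t0 strictly between the
      extreme heights, so its phase p0 lies strictly between 0 and \<pi>.\<close>
    define t0 where "t0 = - E / H"
    have t0: "0 < t0" "t0 < 1"
      using E H_pos by (auto simp: t0_def field_simps)
    have e_t0: "e t = H * (t - t0)" for t
      using H_pos by (simp add: e_def t0_def field_simps)
    have "P t0 > 0"
      using t0 by (simp add: P_def e_t0)
    have "(t0 - mid)^2 < rad^2"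
    proof -
      have "(4 * H^2 + \<kappa>) / \<kappa> > 0"
        using lead_pos \<kappa> by simp
      then show ?thesis
        using \<open>P t0 > 0\<close> unfolding P_rad[OF disc_nonneg] by (simp only: zero_less_mult_iff) auto
    qed
    then have "\<bar>t0 - mid\<bar>^2 < rad^2"
      by simp
    then have "\<bar>t0 - mid\<bar> < rad"
      by (rule power2_less_imp_less[OF _ less_imp_le[OF rad]])
    define p0 where "p0 = arccos ((mid - t0) / rad)"
    have u: "-1 < (mid - t0) / rad" "(mid - t0) / rad < 1"
      using \<open>\<bar>t0 - mid\<bar> < rad\<close> rad by (auto simp: field_simps abs_less_iff)
    have p0: "0 < p0" "p0 < pi" "mid - rad * cos p0 = t0"
      using u rad arccos_lt_bounded[of "(mid - t0) / rad"] by (auto simp: p0_def cos_arccos)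
    define k where "k = sgn \<tau>"
    have sin_sgn: "sgn (sin (\<alpha> s)) = k * sgn (hsq s - t0)" for s
    proof -
      have t: "hsq s \<in> {0<..<1}" "hsq s \<noteq> 1" "P (hsq s) \<ge> 0"
        using hsq_pos[of s] hsq_less_1[of s] P_hsq_nonneg[of s] by auto
      have Q: "Q (hsq s) > 0"
        using Q_pos t by auto
      have "1 - hsq s + \<beta> * hsq s > 0"
        using t \<beta> by (intro add_pos_pos) auto
      then have "sgn (angular_speed (hsq s)) = sgn \<tau> * sgn (e (hsq s))"
        unfolding angular_speed_def q[OF t(2)] using t Q by (simp add: sgn_mult sgn_divide)
      also have "sgn (e (hsq s)) = sgn (hsq s - t0)"
        using H_pos by (simp add: e_t0 sgn_mult)
      also have "sgn (angular_speed (hsq s)) = sgn (sin (\<alpha> s))"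
        using polar_at(6)[of s] by (simp add: polar_at'(3)[symmetric] sgn_divide)
      finally show ?thesis
        by (simp add: k_def)
    qed
    have k: "k = 1 \<or> k = -1"
      using \<tau> by (auto simp: k_def sgn_if)
    have cos_mono: "cos p0 < cos \<theta>" if "0 \<le> \<theta>" "\<theta> < p0" for \<theta>
      using that p0 by (intro cos_monotone_0_pi) auto
    have cos_mono': "cos \<theta> < cos p0" if "p0 < \<theta>" "\<theta> \<le> pi" for \<theta>
      using that p0 by (intro cos_monotone_0_pi) auto
    have hsq_sgn: "sgn (mid - rad * cos \<theta> - t0) = sgn (cos p0 - cos \<theta>)" for \<theta>
    proof -
      have "mid - rad * cos \<theta> - t0 = rad * (cos p0 - cos \<theta>)"
        using p0(3) by (simp add: algebra_simps)
      then show ?thesis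
        using rad by (simp add: sgn_mult)
    qed
    \<comment> \<open>From phase n \<pi> to m \<pi> = (n + 1) \<pi> the height rises for even n and
      falls for odd n. It meets t0 at a phase distance p0 from the even end, and \<epsilon> records
      the direction.\<close>
    define c where "c = S (if even n then of_int n * pi + p0 else of_int m * pi - p0)"
    define \<epsilon> :: real where "\<epsilon> = (if even n then 1 else -1)"
    have \<phi>_mono: "\<phi> s < \<phi> r \<longleftrightarrow> s < r" "\<phi> s \<le> \<phi> r \<longleftrightarrow> s \<le> r" for s r
      using phase_mono strict_mono_less strict_mono_less_eq by blast+
    have ends: "\<phi> a = of_int n * pi" "\<phi> b = of_int n * pi + pi"
      by (simp_all add: n m \<open>m = n + 1\<close> algebra_simps)
    have before: "sgn (hsq s - t0) = - \<epsilon>" if "s \<in> {a..<c}" for s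
    proof (cases "even n")
      case True
      define \<theta> where "\<theta> = \<phi> s - of_int n * pi"
      have "0 \<le> \<theta>" "\<theta> < p0"
        using that True \<phi>_mono(2)[of a s] \<phi>_mono(1)[of s c] ends by (auto simp: \<theta>_def c_def)
      moreover have "cos (\<phi> s) = cos \<theta>"
        using True by (simp add: \<theta>_def cos_even_multiple)
      ultimately show ?thesis
        using True cos_mono[of \<theta>] hsq_sgn[of \<theta>] by (simp add: phase(1) \<epsilon>_def sgn_if)
    next
      case False
      define \<theta> where "\<theta> = of_int m * pi - \<phi> s"
      have "p0 < \<theta>" "\<theta> \<le> pi"
        using that False \<phi>_mono(2)[of a s] \<phi>_mono(1)[of s c] ends
        by (auto simp: \<theta>_def c_def \<open>m = n + 1\<close> algebra_simps)
      moreover have "even m"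
        using False \<open>m = n + 1\<close> by simp
      then have "cos (\<phi> s) = cos \<theta>"
        by (simp add: \<theta>_def cos_even_multiple)
      ultimately show ?thesis
        using False cos_mono'[of \<theta>] hsq_sgn[of \<theta>] by (simp add: phase(1) \<epsilon>_def sgn_if)
    qed
    have after: "sgn (hsq s - t0) = \<epsilon>" if "s \<in> {c<..b}" for s
    proof (cases "even n")
      case True
      define \<theta> where "\<theta> = \<phi> s - of_int n * pi"
      have "p0 < \<theta>" "\<theta> \<le> pi"
        using that True \<phi>_mono(2)[of s b] \<phi>_mono(1)[of c s] ends by (auto simp: \<theta>_def c_def)
      moreover have "cos (\<phi> s) = cos \<theta>"
        using True by (simp add: \<theta>_def cos_even_multiple)
      ultimately show ?thesis
        using True cos_mono'[of \<theta>] hsq_sgn[of \<theta>] by (simp add: phase(1) \<epsilon>_def sgn_if)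
    next
      case False
      define \<theta> where "\<theta> = of_int m * pi - \<phi> s"
      have "0 \<le> \<theta>" "\<theta> < p0"
        using that False \<phi>_mono(2)[of s b] \<phi>_mono(1)[of c s] ends
        by (auto simp: \<theta>_def c_def \<open>m = n + 1\<close> algebra_simps)
      moreover have "even m"
        using False \<open>m = n + 1\<close> by simp
      then have "cos (\<phi> s) = cos \<theta>"
        by (simp add: \<theta>_def cos_even_multiple)
      ultimately show ?thesis
        using False cos_mono[of \<theta>] hsq_sgn[of \<theta>] by (simp add: phase(1) \<epsilon>_def sgn_if)
    qed
    have "c \<in> {a<..<b}"
      using p0 \<phi>_mono(1)[of a c] \<phi>_mono(1)[of c b] ends by (auto simp: c_def \<open>m = n + 1\<close> algebra_simps)
    moreover have "(\<forall>s\<in>{a..<c}. sgn (sin (\<alpha> s)) = - (k * \<epsilon>)) \<and> (\<forall>s\<in>{c<..b}. sgn (sin (\<alpha> s)) = k * \<epsilon>)"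
      using before after sin_sgn by simp
    moreover have "k * \<epsilon> = 1 \<or> k * \<epsilon> = -1"
      using k by (auto simp: \<epsilon>_def)
    ultimately show ?thesis
      by (intro bexI[of _ c]) (auto simp: sgn_1_pos sgn_1_neg)
  qed
  ultimately show ?thesis
    unfolding nodoid_type_def using polar g_range(2) UNIV K_def
    by (intro conjI exI[of _ x] exI[of _ y] exI[of _ \<alpha>]) (simp_all add: Let_def)
qed

end

section \<open>Unduloids\<close>

context polar_surface
begin

context
  assumes E: "E > 0 \<or> E < - H"
begin

text \<open>The longitude may decrease with the phase. Multiplying by k = sgn (\<tau> E) gives an
  increasing function to which \<open>strictly_increasing_bij\<close> applies; since k is a sign,
  undoing it preserves bijectivity and the nonzero derivative of the inverse.\<close>

lemma F_bij: "bij F" and F_inverse: "\<exists>d. d \<noteq> 0 \<and> (inv F has_real_derivative d) (at u)"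
proof -
  obtain c where c: "c > 0" "\<And>t. t \<in> {0<..<1} \<Longrightarrow> c \<le> sgn (\<tau> * E) * w t"
    using w_bounds[OF E] by blast
  define k where "k = sgn (\<tau> * E)"
  have k: "k * k = 1"
    using E H \<tau> by (auto simp: k_def sgn_mult sgn_if)
  have kF: "((\<lambda>p. k * F p) has_real_derivative k * w (mid - rad * cos p)) (at p)" for p
    by (intro DERIV_cmult F_derivative)
  have ge: "c \<le> k * w (mid - rad * cos p)" for p
    unfolding k_def by (rule c(2)[OF t_open])
  note bij = strictly_increasing_bij[OF kF ge c(1)]
  have F_k: "F = (\<lambda>v. k * v) \<circ> (\<lambda>p. k * F p)"
    using k by (auto simp: mult.assoc[symmetric])
  have bij_k: "bij (\<lambda>v. k * v)"
    by (rule o_bij[of "\<lambda>v. k * v"]) (use k in \<open>auto simp: mult.assoc[symmetric]\<close>)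
  show "bij F"
    by (subst F_k) (rule bij_comp[OF bij(2) bij_k])
  have inv_F: "inv F u = inv (\<lambda>p. k * F p) (k * u)" for u
  proof (rule inv_f_eq)
    show "inj F"
      using \<open>bij F\<close> bij_is_inj by blast
    have "k * F (inv (\<lambda>p. k * F p) (k * u)) = k * u"
      using surj_f_inv_f[OF bij_is_surj[OF bij(2)]] by blast
    then show "F (inv (\<lambda>p. k * F p) (k * u)) = u"
      using k by auto
  qed
  have "((\<lambda>u. inv (\<lambda>p. k * F p) (k * u)) has_real_derivative
      inverse (k * w (mid - rad * cos (inv (\<lambda>p. k * F p) (k * u)))) * k) (at u)"
    by (rule DERIV_chain2[OF bij(3)]) (auto intro!: derivative_eq_intros)
  then have "(inv F has_real_derivative inverse (k * w (mid - rad * cos (inv F u))) * k) (at u)"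
    by (simp add: inv_F[abs_def])
  moreover have "inverse (k * w (mid - rad * cos (inv F u))) * k \<noteq> 0"
    using ge[of "inv F u"] c(1) k by auto
  ultimately show "\<exists>d. d \<noteq> 0 \<and> (inv F has_real_derivative d) (at u)"
    by blast
qed

lemma F_inv [simp]: "F (inv F u) = u" "inv F (F p) = p"
  using F_bij by (simp_all add: bij_is_surj surj_f_inv_f bij_is_inj inv_f_f)

text \<open>The height stays strictly between 0 and 1, so the square root and arcsin are
  differentiable with positive slope and the only zeros come from sin p.\<close>

lemma g_derivative:
  "\<exists>d. (g has_real_derivative d) (at p) \<and> (d = 0 \<longleftrightarrow> sin p = 0)"
proof -
  define t where "t = mid - rad * cos p"
  have t: "0 < t" "t < 1"
    using t_open[of p] by (auto simp: t_def)
  have "((\<lambda>p. mid - rad * cos p) has_real_derivative rad * sin p) (at p)"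
    by (auto intro!: derivative_eq_intros)
  from DERIV_chain2[OF DERIV_real_sqrt this]
  have "((\<lambda>p. sqrt (mid - rad * cos p)) has_real_derivative inverse (sqrt t) / 2 * (rad * sin p)) (at p)"
    using t by (simp add: t_def)
  moreover have "0 < sqrt t"
    using t by simp
  then have "-1 < sqrt t"
    by linarith
  ultimately have "(g has_real_derivative inverse (sqrt (1 - (sqrt t)^2)) * (inverse (sqrt t) / 2 * (rad * sin p))) (at p)"
  proof -
    assume d: "((\<lambda>p. sqrt (mid - rad * cos p)) has_real_derivative inverse (sqrt t) / 2 * (rad * sin p)) (at p)"
      and "-1 < sqrt t"
    moreover have "sqrt t < 1"
      using t by simp
    ultimately have "DERIV arcsin (sqrt (mid - rad * cos p)) :> inverse (sqrt (1 - (sqrt t)^2))"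
      unfolding t_def by (intro DERIV_arcsin)
    from DERIV_chain2[OF this d] show ?thesis
      unfolding g_def[abs_def] .
  qed
  moreover have "inverse (sqrt (1 - (sqrt t)^2)) * (inverse (sqrt t) / 2 * (rad * sin p)) = 0 \<longleftrightarrow> sin p = 0"
    using t rad by auto
  ultimately show ?thesis
    by blast
qed

text \<open>Since y = F o \<phi> is a bijection, the latitude becomes the function g o inv F of the
  longitude. Periodicity, critical points and reflections are those of \<open>g\<close>, transported
  by \<open>F_shift\<close> and \<open>F_reflect\<close>; the period is |T|.\<close>

lemma unduloid: "unduloid_type \<gamma> I (x_min \<kappa> H E) (x_max \<kappa> H E)"
proof -
  define f where "f u = g (inv F u)" for u
  define K where "K = {u. deriv f u = 0}"
  have f: "\<exists>d. (f has_real_derivative d) (at u) \<and> (d = 0 \<longleftrightarrow> sin (inv F u) = 0)" for u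
  proof -
    obtain d1 where d1: "(g has_real_derivative d1) (at (inv F u))" "d1 = 0 \<longleftrightarrow> sin (inv F u) = 0"
      using g_derivative by blast
    obtain d2 where d2: "(inv F has_real_derivative d2) (at u)" "d2 \<noteq> 0"
      using F_inverse by blast
    show ?thesis
      unfolding f_def[abs_def] using DERIV_chain2[OF d1(1) d2(1)] d1(2) d2(2) by auto
  qed
  have f_diff: "f differentiable at u" for u
    using f real_differentiable_def by blast
  have f_cont: "continuous_on A f" for A
    using f DERIV_isCont by (metis continuous_at_imp_continuous_on)
  have K: "K = {u. sin (inv F u) = 0}"
    unfolding K_def using f DERIV_imp_deriv by (metis (lifting))
  have bij_y: "bij y"
  proof -
    have "y = F \<circ> \<phi>"
      using y_eq by auto
    then show ?thesis
      using bij_comp[OF phase_bij F_bij] by simp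
  qed
  have x_f: "x s = f (y s)" for s
    by (simp add: f_def x_eq[of s] y_eq[of s])
  have f_F: "f (F p) = g p" for p
    by (simp add: f_def)
  have f_shift: "f (u + of_int n * T) = f u" for u n
  proof -
    have "f (F (inv F u + 2 * pi * of_int n)) = f (F (inv F u))"
      unfolding f_F by (rule g_shift)
    then show ?thesis
      by (simp only: F_shift F_inv)
  qed
  have "T \<noteq> 0"
  proof
    assume "T = 0"
    then have "F (2 * pi) = F 0"
      using F_shift[of 0 1] by simp
    then have "inv F (F (2 * pi)) = inv F (F 0)"
      by simp
    then show False
      by simp
  qed
  then have period: "\<exists>p>0. \<forall>u. f (u + p) = f u"
    using f_shift[of _ 1] f_shift[of _ "-1"] by (cases "T > 0") (auto intro: exI[of _ T] exI[of _ "- T"])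
  have range_f: "range f = {x_min \<kappa> H E..x_max \<kappa> H E}"
  proof -
    have "range f = g ` range (inv F)"
      by (auto simp: f_def)
    then show ?thesis
      using bij_is_surj[OF bij_imp_bij_inv[OF F_bij]] g_range(1) by simp
  qed
  have extremal: "f ` K = {x_min \<kappa> H E, x_max \<kappa> H E}"
  proof
    show "f ` K \<subseteq> {x_min \<kappa> H E, x_max \<kappa> H E}"
      using g_extremal(1) by (auto simp: K f_def)
    have "F 0 \<in> K" "F pi \<in> K" "f (F 0) = x_min \<kappa> H E" "f (F pi) = x_max \<kappa> H E"
      by (simp_all add: K f_F g_extremal)
    then show "{x_min \<kappa> H E, x_max \<kappa> H E} \<subseteq> f ` K"
      by (metis bot_least imageI insert_subset)
  qed
  have fin: "finite (K \<inter> {a..b})" for a b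
    unfolding K
  proof (rule finite_phase_zeros)
    show "continuous_on UNIV (inv F)"
      using F_inverse DERIV_isCont by (metis continuous_at_imp_continuous_on)
    show "inj (inv F)"
      using bij_is_inj[OF bij_imp_bij_inv[OF F_bij]] .
  qed
  \<comment> \<open>By Rolle two equal values would produce a critical point in between, so f is
    injective; a continuous injective function on an interval is strictly monotone.\<close>
  have mono: "strict_mono_on {a..b} f \<or> strict_antimono_on {a..b} f" if ab: "K \<inter> {a<..<b} = {}" for a b
  proof -
    have "inj_on f {a..b}"
    proof (rule linorder_inj_onI)
      fix u v assume uv: "u < v" "u \<in> {a..b}" "v \<in> {a..b}"
      show "f u \<noteq> f v"
      proof
        assume "f u = f v"
        then obtain z where z: "u < z" "z < v" "DERIV f z :> 0"
          using Rolle[OF uv(1) _ f_cont] f_diff by blast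
        then have "z \<in> K \<inter> {a<..<b}"
          using uv DERIV_imp_deriv[OF z(3)] by (auto simp: K_def)
        then show False
          using ab by blast
      qed
    qed auto
    then show ?thesis
      using injective_eq_monotone_map[of "{a..b}" f] f_cont by (simp add: is_interval_cc)
  qed
  have sym: "f (2 * c - u) = f u" if c: "c \<in> K" for c u
  proof -
    obtain n :: int where "inv F c = of_int n * pi"
      using c by (auto simp: K sin_zero_iff_int2)
    then have c_eq: "c = F (of_int n * pi)"
      by (metis F_inv(1))
    define h where "h = inv F u - of_int n * pi"
    have u: "u = F (of_int n * pi + h)"
      by (simp add: h_def)
    have "2 * c - u = F (of_int n * pi - h)"
      using F_reflect[of n h] unfolding c_eq u by simp
    then show ?thesis
      unfolding u by (simp only: f_F g_even[of n h])
  qed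
  show ?thesis
    unfolding unduloid_type_def
  proof (rule conjI[OF UNIV], rule exI[of _ x], rule exI[of _ y], rule exI[of _ \<alpha>], rule exI[of _ f], intro conjI)
    show "polar_coordinates \<gamma> UNIV x y \<alpha>"
      by (rule polar)
    show "let K = {u. deriv f u = 0}
        in f ` K = {x_min \<kappa> H E, x_max \<kappa> H E} \<and> (\<forall>a b. finite (K \<inter> {a..b})) \<and>
           (\<forall>a\<in>K. \<forall>b\<in>K. a < b \<and> K \<inter> {a<..<b} = {} \<longrightarrow>
              strict_mono_on {a..b} f \<or> strict_antimono_on {a..b} f) \<and>
           (\<forall>c\<in>K. \<forall>u. f (2 * c - u) = f u)"
      unfolding Let_def K_def[symmetric] using extremal fin mono sym by blast
    show "\<forall>s. x s = f (y s)"
      using x_f by blast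
    show "\<forall>u. f differentiable at u"
      using f_diff by blast
    show "\<exists>p>0. \<forall>u. f (u + p) = f u"
      by (rule period)
  qed (use bij_y range_f g_range(2) in auto)
qed

text \<open>The two points of the generating graph at \<open>y = c - \<pi>\<close> and \<open>y = c + \<pi>\<close>, with \<open>c\<close> a critical
  point, have the same image, so that embeddedness forces \<open>2\<pi>\<close> to be a period.\<close>

lemma embedded_iff:
  "compact_surface \<gamma> I \<and> embedded_surface \<gamma> I \<longleftrightarrow> (\<exists>k::int. k \<noteq> 0 \<and> T = 2 * pi / of_int k)"
proof
  assume emb: "compact_surface \<gamma> I \<and> embedded_surface \<gamma> I"
  define h where "h = inv F (F 0 + pi)"
  have Fh: "F h = F 0 + pi"
    by (simp add: h_def)
  then have Fh': "F (- h) = F 0 - pi"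
    using F_reflect[of 0 h] by simp
  have "h \<noteq> 0"
    using Fh by auto
  have "cis (F 0 + pi) = cis (F 0 - pi)"
    by (simp add: complex_eq_iff)
  then have "\<gamma> (S (- h)) = \<gamma> (S h)"
    unfolding gamma_S Fh Fh' by simp
  moreover have "S (- h) \<noteq> S h"
    using \<open>h \<noteq> 0\<close> by (metis \<phi>_S neg_equal_0_iff_equal equal_neg_zero)
  ultimately have "\<forall>s. \<gamma> (s + (S h - S (- h))) = \<gamma> s"
    using emb UNIV unfolding embedded_surface_def by blast
  then obtain n where n: "S h - S (- h) = of_int n * L"
    using period_imp by blast
  then have "S h = S (- h + 2 * pi * of_int n)"
    using S_shift[of "- h" n] by linarith
  then have "h = - h + 2 * pi * of_int n"
    by (metis \<phi>_S)
  then have "F h = F (- h) + of_int n * T"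
    using F_shift[of "- h" n] by simp
  then have nT: "of_int n * T = 2 * pi"
    using Fh Fh' by simp
  then have "n \<noteq> 0"
    by auto
  then show "\<exists>k::int. k \<noteq> 0 \<and> T = 2 * pi / of_int k"
    using nT by (intro exI[of _ n]) (simp add: field_simps)
next
  assume "\<exists>k::int. k \<noteq> 0 \<and> T = 2 * pi / of_int k"
  then obtain k :: int where k: "k \<noteq> 0" "T = 2 * pi / of_int k"
    by blast
  have kT: "of_int k * T = 2 * pi"
    using k by simp
  have "T / pi = of_int 2 / of_int k"
    using k by simp
  then have "T / pi \<in> \<rat>"
    by (metis Rats_divide Rats_of_int)
  moreover have "embedded_surface \<gamma> I"
    unfolding embedded_surface_def
  proof (intro ballI impI disjI2 conjI UNIV)
    fix s1 s2 assume eq: "\<gamma> s1 = \<gamma> s2"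
    define p1 p2 where "p1 = \<phi> s1" and "p2 = \<phi> s2"
    have s: "s1 = S p1" "s2 = S p2"
      by (simp_all add: p1_def p2_def)
    have c: "rad * cos p1 = rad * cos p2"
      using eq unfolding s gamma_S by simp
    have "sqrt (1 - (mid - rad * cos p2)) \<noteq> 0"
      using t_open[of p2] by auto
    then have "cis (F p2) = cis (F p1)"
      using eq unfolding s gamma_S c by simp
    \<comment> \<open>Equal heights give equal |z|, so the longitudes agree modulo 2 \<pi>. As 2
      \<pi> = k T, such a difference is also produced by the phase shift 2 \<pi> j k, and
      injectivity of \<open>F\<close> identifies p2 with p1 shifted by it.\<close>
    then obtain j :: int where "F p2 = F p1 + 2 * pi * of_int j"
      using sin_cos_eq_iff[of "F p2" "F p1"] by (auto simp: complex_eq_iff)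
    then have "F p2 = F p1 + of_int (j * k) * T"
      using kT by (simp add: mult_ac)
    then have "F p2 = F (p1 + 2 * pi * of_int (j * k))"
      by (simp only: F_shift)
    then have "p2 = p1 + 2 * pi * of_int (j * k)"
      by (metis F_inv(2))
    then have "S p2 = S p1 + of_int (j * k) * L"
      by (simp only: S_shift)
    then have "s2 - s1 = of_int (j * k) * L"
      unfolding s by simp
    moreover have "of_int (j * k) * T = 2 * pi * of_int j"
      using kT by (simp add: mult_ac)
    then have "of_real 1 * cis (of_int (j * k) * T) = 1"
      by (simp only:) simp
    ultimately show "\<forall>s. \<gamma> (s + (s2 - s1)) = \<gamma> s"
      using period_if[of "j * k"] by simp
  qed
  ultimately show "compact_surface \<gamma> I \<and> embedded_surface \<gamma> I"
    using compact_iff by blast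
qed

end

end

section \<open>Spheres and the north pole\<close>

text \<open>The round sphere in real times complex is mapped by stretching its height affinely onto
  the interval and rescaling each horizontal circle to radius \<rho>. A continuous injection on a
  compact set is a homeomorphism onto its image.\<close>

lemma revolution_homeomorphic_sphere:
  fixes \<rho> :: "real \<Rightarrow> real"
  assumes ab: "a < b" and cont: "continuous_on {a..b} \<rho>" and ends: "\<rho> a = 0" "\<rho> b = 0"
    and pos: "\<And>s. s \<in> {a<..<b} \<Longrightarrow> \<rho> s > 0"
  shows "{(s, v::complex). s \<in> {a..b} \<and> cmod v = \<rho> s} homeomorphic sphere (0::real^3) 1"
proof -
  define l where "l h = (a + b) / 2 + h * ((b - a) / 2)" for h
  define G where "G q = (l (fst q), \<rho> (l (fst q)) *\<^sub>R sgn (snd q))" for q :: "real \<times> complex"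
  define X where "X = sphere (0::real \<times> complex) 1"
  have X: "q \<in> X \<longleftrightarrow> (fst q)^2 + (cmod (snd q))^2 = 1" for q
    by (cases q) (auto simp: X_def dist_norm norm_Pair)
  have h: "\<bar>fst q\<bar> \<le> 1" if "q \<in> X" for q
    using that[unfolded X] by (metis abs_square_le_1 le_add_same_cancel1 zero_le_power2)
  have l_in: "l t \<in> {a..b}" if "\<bar>t\<bar> \<le> 1" for t
  proof -
    have "\<bar>t * ((b - a) / 2)\<bar> \<le> 1 * ((b - a) / 2)"
      unfolding abs_mult using that ab by (intro mult_mono) auto
    then show ?thesis
      by (auto simp: l_def abs_le_iff field_simps)
  qed
  have l_ends: "l 1 = b" "l (- 1) = a"
    by (auto simp: l_def field_simps)
  have \<rho>0: "\<rho> (l (fst q)) = 0" if "q \<in> X" "snd q = 0" for q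
  proof -
    have "fst q = 1 \<or> fst q = -1"
      using that X[of q] by (auto simp: power2_eq_1_iff)
    then show ?thesis
      using l_ends ends by auto
  qed
  have l_diff: "l t - l r = (t - r) * ((b - a) / 2)" for t r
    by (simp add: l_def left_diff_distrib)
  have \<rho>_pos: "\<rho> (l (fst q)) > 0" if "q \<in> X" "snd q \<noteq> 0" for q
  proof (rule pos)
    have "(fst q)^2 < 1"
      using that X[of q] by (smt (verit) zero_less_norm_iff zero_less_power)
    then have "-1 < fst q" "fst q < 1"
      by (auto simp: abs_square_less_1 abs_less_iff)
    then have "0 < l (fst q) - l (- 1)" "0 < l 1 - l (fst q)"
      unfolding l_diff using ab by auto
    then show "l (fst q) \<in> {a<..<b}"
      by (simp add: l_ends)
  qed
  have "continuous_on X G"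
  proof -
    have cl: "continuous_on X (\<lambda>q. l (fst q))"
      unfolding l_def by (intro continuous_intros) auto
    then have c\<rho>: "continuous_on X (\<lambda>q. \<rho> (l (fst q)))"
      using l_in h by (intro continuous_on_compose2[OF cont]) auto
    have "continuous_on X (\<lambda>q. \<rho> (l (fst q)) *\<^sub>R sgn (snd q))"
      unfolding continuous_on_def
    proof
      fix q assume q: "q \<in> X"
      have lim: "((\<lambda>q. \<rho> (l (fst q))) \<longlongrightarrow> \<rho> (l (fst q))) (at q within X)"
        using c\<rho> q unfolding continuous_on_def by blast
      show "((\<lambda>q. \<rho> (l (fst q)) *\<^sub>R sgn (snd q)) \<longlongrightarrow> \<rho> (l (fst q)) *\<^sub>R sgn (snd q)) (at q within X)"
      proof (cases "snd q = 0")
        case True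
        \<comment> \<open>At the two poles \<open>sgn\<close> is discontinuous but bounded by 1, and
          the factor \<rho> tends to 0.\<close>
        have "((\<lambda>q. \<rho> (l (fst q)) *\<^sub>R sgn (snd q)) \<longlongrightarrow> 0) (at q within X)"
        proof (rule Lim_null_comparison)
          show "((\<lambda>q. \<bar>\<rho> (l (fst q))\<bar>) \<longlongrightarrow> 0) (at q within X)"
            using tendsto_rabs[OF lim] \<rho>0[OF q True] by simp
          show "\<forall>\<^sub>F q in at q within X. norm (\<rho> (l (fst q)) *\<^sub>R sgn (snd q)) \<le> \<bar>\<rho> (l (fst q))\<bar>"
            by (auto simp: norm_sgn)
        qed
        then show ?thesis
          using True by simp
      next
        case False
        have "(snd \<longlongrightarrow> snd q) (at q within X)"
          by (intro tendsto_intros)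
        then show ?thesis
          by (intro tendsto_scaleR lim tendsto_sgn False)
      qed
    qed
    then show ?thesis
      unfolding G_def by (intro continuous_on_Pair cl)
  qed
  moreover have "G ` X = {(s, v). s \<in> {a..b} \<and> cmod v = \<rho> s}"
  proof
    show "G ` X \<subseteq> {(s, v). s \<in> {a..b} \<and> cmod v = \<rho> s}"
    proof (rule image_subsetI)
      fix q assume q: "q \<in> X"
      show "G q \<in> {(s, v). s \<in> {a..b} \<and> cmod v = \<rho> s}"
        using l_in[OF h[OF q]] \<rho>0[OF q] \<rho>_pos[OF q] by (cases "snd q = 0") (auto simp: G_def norm_sgn)
    qed
    show "{(s, v). s \<in> {a..b} \<and> cmod v = \<rho> s} \<subseteq> G ` X"
    proof clarify
      fix s v assume s: "s \<in> {a..b}" and v: "cmod v = \<rho> s"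
      define t where "t = (2 * s - a - b) / (b - a)"
      have lt: "l t = s"
        using ab by (simp add: l_def t_def field_simps)
      have t1: "\<bar>t\<bar> \<le> 1"
        using s ab by (auto simp: t_def abs_le_iff field_simps)
      define q where "q = (t, sqrt (1 - t^2) *\<^sub>R sgn v)"
      show "(s, v) \<in> G ` X"
      proof (cases "v = 0")
        case True
        then have "s = a \<or> s = b"
          using v pos[of s] s by force
        then have "t = 1 \<or> t = -1"
          using ab by (auto simp: t_def field_simps)
        then have "q \<in> X" "G q = (s, v)"
          using True lt by (auto simp: X q_def G_def)
        then show ?thesis
          by (metis imageI)
      next
        case False
        then have "s \<noteq> a" "s \<noteq> b"
          using v ends by auto
        then have "\<bar>t\<bar> \<noteq> 1"
          using ab by (auto simp: t_def field_simps abs_if split: if_splits)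
        then have t3: "1 - t^2 > 0"
          using t1 by (simp add: abs_square_less_1)
        then have "q \<in> X"
          using False by (simp add: X q_def norm_sgn)
        moreover have "sgn (snd q) = sgn v"
          using t3 by (simp add: q_def sgn_scaleR sgn_sgn)
        moreover have "fst q = t"
          by (simp add: q_def)
        ultimately have "G q = (s, \<rho> s *\<^sub>R sgn v)" "q \<in> X"
          using lt by (simp_all only: G_def)
        moreover have "\<rho> s *\<^sub>R sgn v = v"
          unfolding v[symmetric] using False by (simp add: sgn_div_norm)
        ultimately show ?thesis
          by (metis imageI)
      qed
    qed
  qed
  moreover have "inj_on G X"
  proof (rule inj_onI)
    fix q r assume q: "q \<in> X" and r: "r \<in> X" and eq: "G q = G r"
    then have "l (fst q) - l (fst r) = 0"
      by (simp add: G_def)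
    then have f: "fst q = fst r"
      unfolding l_diff using ab by auto
    then have n: "cmod (snd q) = cmod (snd r)"
    proof -
      have "(cmod (snd q))^2 = (cmod (snd r))^2"
        using q r f unfolding X by (metis add_left_cancel)
      then show ?thesis
        by (simp add: power2_eq_iff_nonneg)
    qed
    have "snd q = snd r"
    proof (cases "snd q = 0")
      case False
      then have "sgn (snd q) = sgn (snd r)"
        using eq f \<rho>_pos[OF q] by (simp add: G_def)
      then show ?thesis
        using n by (simp add: sgn_div_norm) (metis False n norm_eq_zero)
    qed (use n in auto)
    then show "q = r"
      using f by (simp add: prod_eq_iff)
  qed
  ultimately have "X homeomorphic {(s, v). s \<in> {a..b} \<and> cmod v = \<rho> s}"
    by (intro homeomorphic_compact) (auto simp: X_def)
  moreover have "X homeomorphic sphere (0::real^3) 1"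
    unfolding X_def by (rule homeomorphic_spheres_gen) auto
  ultimately show ?thesis
    using homeomorphic_sym homeomorphic_trans by blast
qed

context cmc_surface
begin

text \<open>Through the north pole: with \<open>u = z cis (- Y)\<close> and \<open>c = cos (\<phi> / 2)\<close>, the quotient \<open>u / c\<close> is
  locally constant away from the pole; \<open>Z = c u - 2 sin (\<phi> / 2) u' / \<phi>'\<close> is its continuous extension.\<close>

lemma pole_profile:
  assumes E: "E = - H" and disc: "disc > 0"
    and phase: "\<And>s. s \<in> interior I \<Longrightarrow> hsq s = mid - rad * cos (\<phi> s)"
      "\<And>s. s \<in> interior I \<Longrightarrow> (\<phi> has_real_derivative speed (hsq s)) (at s)"
  obtains Y \<zeta> where "\<zeta> \<noteq> 0"
    "\<And>s. s \<in> interior I \<Longrightarrow> (Y has_real_derivative angular_speed (hsq s)) (at s)"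
    "\<And>s. s \<in> interior I \<Longrightarrow> fst (\<gamma> s) = \<zeta> * of_real (cos (\<phi> s / 2)) * cis (Y s)"
proof -
  define J where "J = interior I"
  have J: "open J" "is_interval J" "J \<subseteq> I"
    using interior_interval interior_subset by (auto simp: J_def)
  have rad: "rad > 0"
    using rad_pos[OF disc] .
  have sum: "mid + rad = 1"
  proof -
    have "disc = \<kappa>^2"
      unfolding disc_def by (simp add: E)
    then have "rad = \<kappa> / (2 * (4 * H^2 + \<kappa>))"
      using \<kappa> by (simp add: rad_def)
    moreover have "mid = (\<kappa> + 8 * H^2) / (2 * (4 * H^2 + \<kappa>))"
      unfolding mid_def by (simp add: E power2_eq_square)
    ultimately have "mid + rad = (2 * (4 * H^2 + \<kappa>)) / (2 * (4 * H^2 + \<kappa>))"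
      by (simp add: add_divide_distrib[symmetric])
    then show ?thesis
      using lead_pos by simp
  qed
  define c where "c s = cos (\<phi> s / 2)" for s
  \<comment> \<open>As mid + rad = 1, the half-angle formula exhibits |z|^2 = 1 - t as a square, so
    sqrt (2 rad) * c is a smooth signed square root of it that changes sign at the pole.\<close>
  have c_sq: "1 - hsq s = 2 * rad * (c s)^2" if "s \<in> J" for s
  proof -
    have "cos (\<phi> s) = 2 * (c s)^2 - 1"
      using cos_double_cos[of "\<phi> s / 2"] by (simp add: c_def)
    then have "hsq s = mid + rad - 2 * rad * (c s)^2"
      using phase(1)[of s] that by (simp add: J_def right_diff_distrib)
    then show ?thesis
      using sum by simp
  qed
  have speed: "speed (hsq s) > 0" if "s \<in> J" for s
    using speed_derivative(3)[of s] speed_bound_pos that by (simp add: J_def)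
  have cont: "continuous_on J hsq" "continuous_on J \<phi>"
    using continuous_hsq(1) continuous_on_subset J(3) apply blast
    using phase(2) DERIV_isCont unfolding J_def by (metis continuous_at_imp_continuous_on)
  have Q: "Q (hsq s) > 0" if "s \<in> J" for s
    using Q_pos[OF hsq_pos P_hsq_nonneg] that J(3) by (auto simp: J_def)
  have cont_speed: "continuous_on J (\<lambda>s. speed (hsq s))"
    using speed_derivative(1) DERIV_isCont unfolding J_def by (metis (lifting) continuous_at_imp_continuous_on)
  have cont_ang: "continuous_on J (\<lambda>s. angular_speed (hsq s))"
  proof -
    have ang: "angular_speed t = - H * sqrt (1 - t + \<beta> * t) / (\<tau> * sqrt (Q t))" for t
      unfolding angular_speed_def q_def using E by simp
    have "continuous_on J (\<lambda>s. Q (hsq s))"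
      unfolding Q_def e_def by (intro continuous_intros cont) (use \<tau> in auto)
    then show ?thesis
      unfolding ang using Q \<tau> by (intro continuous_intros cont) (auto, metis less_irrefl)
  qed
  obtain Y where Y: "\<And>s. s \<in> J \<Longrightarrow> (Y has_real_derivative angular_speed (hsq s)) (at s)"
    using open_interval_antiderivative[OF J(1,2) cont_ang] by blast
  define u where "u s = fst (\<gamma> s) * cis (- Y s)" for s
  define u1 where "u1 s = fst (\<gamma> s) * (of_real (- angular_speed (hsq s)) * \<i> * cis (- Y s))
      + fst (velocity s) * cis (- Y s)" for s
  have u: "(u has_vector_derivative u1 s) (at s)" if "s \<in> J" for s
  proof -
    have "((\<lambda>s. - Y s) has_real_derivative - angular_speed (hsq s)) (at s)"
      by (intro derivative_intros Y that)
    then show ?thesis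
      unfolding u_def[abs_def] u1_def using component_derivatives(1)[of s] that
      by (intro has_vector_derivative_mult has_vector_derivative_cis) (auto simp: J_def)
  qed
  have c: "(c has_real_derivative - sin (\<phi> s / 2) * (speed (hsq s) / 2)) (at s)" if "s \<in> J" for s
    unfolding c_def[abs_def] using phase(2)[of s] that by (auto intro!: derivative_eq_intros simp: J_def)
  define Z where "Z s = of_real (c s) * u s - of_real (2 * sin (\<phi> s / 2) / speed (hsq s)) * u1 s" for s
  have cont_Z: "continuous_on J Z"
  proof -
    have cY: "continuous_on J Y"
      using Y DERIV_isCont by (metis continuous_at_imp_continuous_on)
    have c\<gamma>: "continuous_on J \<gamma>" "continuous_on J velocity"
      using continuous_gamma continuous_velocity J(3) continuous_on_subset by blast+
    have "speed (hsq s) \<noteq> 0" if "s \<in> J" for s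
      using speed[OF that] by simp
    then show ?thesis
      unfolding Z_def u_def u1_def c_def by (intro continuous_intros cont cont_ang cont_speed cY c\<gamma>) auto
  qed
  have local: "\<exists>V. open V \<and> s \<in> V \<and> V \<subseteq> J \<and> (\<forall>r\<in>V. Z r = Z s) \<and> Z s \<noteq> 0 \<and> u s = Z s * of_real (c s)"
    if s: "s \<in> J" and cs: "c s \<noteq> 0" for s
  proof -
    \<comment> \<open>On U the function c keeps its sign at s, so cos x is a fixed multiple k of c
      there.\<close>
    define U where "U = J \<inter> (\<lambda>r. c r * c s) -` {0<..}"
    have "continuous_on J (\<lambda>r. c r * c s)"
      unfolding c_def by (intro continuous_intros cont) auto
    then have "open U"
      unfolding U_def using J(1) by (intro continuous_open_preimage) auto
    moreover have "s \<in> U" "U \<subseteq> I"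
      using s cs J(3) by (auto simp: U_def) (metis not_real_square_gt_zero)
    moreover have "\<gamma> s \<noteq> north_pole"
      using c_sq[OF s] cs rad hsq_eq_1_iff[of s] s J(3) by auto
    ultimately obtain V x y \<alpha> where V: "open V" "is_interval V" "s \<in> V" "V \<subseteq> U"
      and polar: "polar_coordinates \<gamma> V x y \<alpha>"
      using local_polar_coordinates by metis
    have VI: "V \<subseteq> I" "V \<subseteq> J"
      using V \<open>U \<subseteq> I\<close> by (auto simp: U_def)
    define k where "k = sgn (c s) * sqrt (2 * rad)"
    have cos_x: "cos (x r) = k * c r" if r: "r \<in> V" for r
    proof -
      have "c r * c s > 0"
        using r V(4) by (auto simp: U_def)
      then have "sgn (c s) * c r > 0"
        by (auto simp: zero_less_mult_iff sgn_if)
      moreover have "sqrt (2 * rad) > 0"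
        using rad by simp
      ultimately have "sqrt (2 * rad) * (sgn (c s) * c r) > 0"
        by (rule mult_pos_pos[rotated])
      then have "k * c r > 0"
        unfolding k_def by (simp only: mult_ac)
      have "(cos (x r))^2 = 1 - hsq r"
        using polar_hsq(1)[OF polar V(1) VI(1) r] by (simp add: cos_squared_eq)
      also have "\<dots> = (k * c r)^2"
        using c_sq[of r] VI(2) r cs rad by (auto simp: k_def power_mult_distrib sgn_if)
      finally have "(cos (x r))^2 = (k * c r)^2" .
      moreover have "cos (x r) > 0"
        using polar r by (auto simp: polar_coordinates_def intro: cos_gt_zero)
      ultimately show ?thesis
        using \<open>k * c r > 0\<close> by (simp add: power2_eq_iff_nonneg)
    qed
    define \<delta> where "\<delta> r = y r - Y r" for r
    have "\<delta> r = \<delta> s" if "r \<in> V" for r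
    proof (rule open_interval_derivative_zero_constant[OF V(1,2) _ that V(3)])
      fix r assume r: "r \<in> V"
      have "(\<delta> has_real_derivative angular_speed (hsq r) - angular_speed (hsq r)) (at r)"
        unfolding \<delta>_def[abs_def]
        using polar_angular_speed(2)[OF polar V(1) VI(1) r] Y[of r] r VI(2) by (intro DERIV_diff) auto
      then show "(\<delta> has_vector_derivative 0) (at r)"
        by (simp add: has_real_derivative_iff_has_vector_derivative)
    qed
    define \<zeta> where "\<zeta> = of_real k * cis (\<delta> s)"
    have u_eq: "u r = \<zeta> * of_real (c r)" if r: "r \<in> V" for r
    proof -
      have "fst (\<gamma> r) = of_real (cos (x r)) * cis (y r)"
        using polar r by (simp add: polar_coordinates_def)
      then have "u r = of_real (k * c r) * (cis (y r) * cis (- Y r))"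
        unfolding u_def cos_x[OF r] by simp
      also have "cis (y r) * cis (- Y r) = cis (\<delta> s)"
        using \<open>\<And>r. r \<in> V \<Longrightarrow> \<delta> r = \<delta> s\<close>[OF r] by (simp add: cis_mult \<delta>_def)
      finally show ?thesis
        by (simp add: \<zeta>_def)
    qed
    have Z: "Z r = \<zeta>" if r: "r \<in> V" for r
    proof -
      define \<sigma> where "\<sigma> = sin (\<phi> r / 2)"
      have rJ: "r \<in> J"
        using r VI by blast
      have "(u has_vector_derivative \<zeta> * of_real (- \<sigma> * (speed (hsq r) / 2))) (at r)"
      proof (rule has_vector_derivative_transform_within_open[OF _ V(1) r])
        show "((\<lambda>r. \<zeta> * of_real (c r)) has_vector_derivative \<zeta> * of_real (- \<sigma> * (speed (hsq r) / 2))) (at r)"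
          unfolding \<sigma>_def by (intro has_vector_derivative_mult_right has_vector_derivative_of_real c rJ)
      qed (simp add: u_eq)
      then have u1_eq: "u1 r = \<zeta> * of_real (- \<sigma> * (speed (hsq r) / 2))"
        using u[OF rJ] vector_derivative_unique_at by blast
      \<comment> \<open>Inserting u = \<zeta> c and its derivative leaves \<zeta> (cos^2 + sin^2) at
        the angle \<phi> / 2.\<close>
      have "Z r = \<zeta> * of_real ((c r)^2 + (2 * \<sigma> / speed (hsq r)) * (\<sigma> * (speed (hsq r) / 2)))"
        unfolding Z_def u1_eq u_eq[OF r] \<sigma>_def[symmetric] by (simp add: power2_eq_square algebra_simps)
      also have "(2 * \<sigma> / speed (hsq r)) * (\<sigma> * (speed (hsq r) / 2)) = \<sigma>^2"
        using speed[OF rJ] by (simp add: power2_eq_square)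
      also have "(c r)^2 + \<sigma>^2 = 1"
        by (simp add: c_def \<sigma>_def)
      finally show ?thesis
        by simp
    qed
    have "\<zeta> \<noteq> 0"
      using cs rad by (simp add: \<zeta>_def k_def sgn_zero_iff)
    then show ?thesis
      using V Z u_eq VI by (intro exI[of _ V]) auto
  qed
  have inj: "inj_on \<phi> J"
  proof (rule linorder_inj_onI)
    fix a b assume ab: "a < b" "a \<in> J" "b \<in> J"
    have "\<phi> a < \<phi> b"
    proof (rule DERIV_pos_imp_increasing[OF ab(1)])
      fix r assume "a \<le> r" "r \<le> b"
      then have "r \<in> J"
        using mem_is_interval_1_I[OF J(2)] ab by blast
      then show "\<exists>d. (\<phi> has_real_derivative d) (at r) \<and> d > 0"
        using phase(2) speed J_def by blast
    qed
    then show "\<phi> a \<noteq> \<phi> b"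
      by simp
  qed auto
  have Z_const: "Z b = Z a" if ab: "a < b" "a \<in> J" "b \<in> J" for a b
  proof -
    have sub: "{a..b} \<subseteq> J"
      using mem_is_interval_1_I[OF J(2) ab(2,3)] by (simp add: subset_iff)
    \<comment> \<open>The passages through the pole between a and b. They are finitely many, and a
      continuous function with derivative 0 off a finite set is constant.\<close>
    define K where "K = {s \<in> {a..b}. c s = 0}"
    have "finite K"
    proof -
      have "compact (\<phi> ` {a..b})"
        using cont(2) sub continuous_on_subset by (intro compact_continuous_image) blast+
      then obtain B where B: "\<And>s. s \<in> {a..b} \<Longrightarrow> \<bar>\<phi> s\<bar> \<le> B"
        using compact_imp_bounded[of "\<phi> ` {a..b}"] unfolding bounded_iff by (metis imageI real_norm_def)
      have "\<phi> ` K \<subseteq> {v. sin v = 0} \<inter> {- B..B}"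
      proof clarify
        fix s assume "s \<in> K"
        then have "s \<in> {a..b}" "cos (\<phi> s / 2) = 0"
          by (auto simp: K_def c_def)
        then show "\<phi> s \<in> {v. sin v = 0} \<inter> {- B..B}"
          using B[of s] sin_double[of "\<phi> s / 2"] by (auto simp: abs_le_iff)
      qed
      moreover have "finite ({v::real. sin v = 0} \<inter> {- B..B})"
        using finite_phase_zeros[of "\<lambda>v. v"] by simp
      ultimately have "finite (\<phi> ` K)"
        using finite_subset by blast
      moreover have "inj_on \<phi> K"
        by (rule inj_on_subset[OF inj]) (use sub in \<open>auto simp: K_def\<close>)
      ultimately show ?thesis
        using finite_imageD by blast
    qed
    moreover have "continuous_on {a..b} Z"
      using cont_Z sub continuous_on_subset by blast
    moreover have "(Z has_derivative (\<lambda>h. 0)) (at s within {a..b})" if s: "s \<in> {a..b} - K" for s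
    proof -
      have "s \<in> J" "c s \<noteq> 0"
        using s sub by (auto simp: K_def)
      from local[OF this] obtain V where V: "open V" "s \<in> V" "\<forall>r\<in>V. Z r = Z s"
        by (elim exE conjE)
      have "(Z has_vector_derivative 0) (at s)"
        by (rule has_vector_derivative_transform_within_open[OF has_vector_derivative_const V(1,2)])
           (rule V(3)[rule_format, symmetric])
      then show ?thesis
        using has_vector_derivative_at_within[of Z 0 s] by (simp add: has_vector_derivative_def)
    qed
    ultimately show ?thesis
      using has_derivative_zero_unique_strong_interval[of K a b Z "Z a" b] ab by simp
  qed
  obtain s1 where s1: "s1 \<in> J" "c s1 \<noteq> 0"
  proof -
    obtain s where "s \<in> J" "\<gamma> s \<noteq> north_pole"
      using not_constant[OF J(1,3)] interior_I by (auto simp: J_def)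
    moreover have "c s \<noteq> 0"
    proof
      assume "c s = 0"
      then have "hsq s = 1"
        using c_sq[OF \<open>s \<in> J\<close>] by simp
      then show False
        using hsq_eq_1_iff[of s] \<open>\<gamma> s \<noteq> north_pole\<close> \<open>s \<in> J\<close> J(3) by blast
    qed
    ultimately show ?thesis
      using that by blast
  qed
  define \<zeta> where "\<zeta> = Z s1"
  have Z_eq: "Z s = \<zeta>" if "s \<in> J" for s
    using Z_const[of s s1] Z_const[of s1 s] s1(1) that by (cases s s1 rule: linorder_cases) (auto simp: \<zeta>_def)
  have "fst (\<gamma> s) = \<zeta> * of_real (c s) * cis (Y s)" if s: "s \<in> J" for s
  proof -
    have "u s = \<zeta> * of_real (c s)"
    proof (cases "c s = 0")
      case True
      then have "\<gamma> s = north_pole"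
        using c_sq[OF s] hsq_eq_1_iff[of s] s J(3) by auto
      then show ?thesis
        using True by (simp add: u_def north_pole_def)
    next
      case False
      then show ?thesis
        using local[OF s] Z_eq[OF s] by auto
    qed
    moreover have "fst (\<gamma> s) = u s * cis (Y s)"
      by (simp add: u_def mult.assoc cis_mult)
    ultimately show ?thesis
      by simp
  qed
  moreover have "\<zeta> \<noteq> 0"
    using local[OF s1] by (auto simp: \<zeta>_def)
  ultimately show ?thesis
    using that[of \<zeta> Y] Y by (simp add: J_def c_def)
qed

end

section \<open>The individual cases of the classification\<close>

context cmc_surface
begin

lemma phase_surface_exists:
  assumes "E \<noteq> 0" "disc \<noteq> 0"
  obtains \<phi> where "phase_surface \<gamma> I \<kappa> \<tau> H E \<phi>"
proof -
  have I: "I = UNIV"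
    using I_UNIV assms by blast
  have "disc > 0"
    using disc_nonneg assms(2) by simp
  then obtain \<phi> where "\<And>s. s \<in> interior I \<Longrightarrow> hsq s = mid - rad * cos (\<phi> s)"
    "\<And>s. s \<in> interior I \<Longrightarrow> hsq' s = rad * speed (hsq s) * sin (\<phi> s)"
    "\<And>s. s \<in> interior I \<Longrightarrow> (\<phi> has_real_derivative speed (hsq s)) (at s)"
    using phase_exists by blast
  then have "phase_surface \<gamma> I \<kappa> \<tau> H E \<phi>"
    using I \<open>disc > 0\<close> by unfold_locales auto
  then show ?thesis
    using that by blast
qed

lemma polar_surface_exists:
  assumes "E \<noteq> 0" "E \<noteq> - H" "disc \<noteq> 0"
  obtains \<phi> x y \<alpha> where "polar_surface \<gamma> I \<kappa> \<tau> H E \<phi> x y \<alpha>"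
proof -
  obtain \<phi> where \<phi>: "phase_surface \<gamma> I \<kappa> \<tau> H E \<phi>"
    using phase_surface_exists assms by blast
  obtain x y \<alpha> where "polar_coordinates \<gamma> UNIV x y \<alpha>"
    using global_polar_coordinates assms by blast
  then have "polar_surface \<gamma> I \<kappa> \<tau> H E \<phi> x y \<alpha>"
    using \<phi> by (simp add: polar_surface_def polar_surface_axioms_def)
  then show ?thesis
    using that by blast
qed

lemma unduloid_case:
  assumes "E > 0 \<or> E < - H" "disc \<noteq> 0"
  shows "unduloid_type \<gamma> I (x_min \<kappa> H E) (x_max \<kappa> H E)"
    and "compact_surface \<gamma> I \<longleftrightarrow> T_integral \<kappa> \<tau> H E / pi \<in> \<rat>"
    and "compact_surface \<gamma> I \<and> embedded_surface \<gamma> I \<longleftrightarrow>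
      (\<exists>k::int. k \<noteq> 0 \<and> T_integral \<kappa> \<tau> H E = 2 * pi / of_int k)"
proof -
  have "E \<noteq> 0" "E \<noteq> - H"
    using assms(1) H by auto
  then obtain \<phi> x y \<alpha> where "polar_surface \<gamma> I \<kappa> \<tau> H E \<phi> x y \<alpha>"
    using polar_surface_exists assms(2) by blast
  then interpret polar_surface \<gamma> I \<kappa> \<tau> H E \<phi> x y \<alpha> .
  show "unduloid_type \<gamma> I (x_min \<kappa> H E) (x_max \<kappa> H E)"
    by (rule unduloid[OF assms(1)])
  show "compact_surface \<gamma> I \<longleftrightarrow> T / pi \<in> \<rat>"
    by (rule compact_iff)
  show "compact_surface \<gamma> I \<and> embedded_surface \<gamma> I \<longleftrightarrow> (\<exists>k::int. k \<noteq> 0 \<and> T = 2 * pi / of_int k)"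
    by (rule embedded_iff[OF assms(1)])
qed

lemma nodoid_case:
  assumes "- H < E" "E < 0"
  shows "nodoid_type \<gamma> I (x_min \<kappa> H E) (x_max \<kappa> H E)"
    and "compact_surface \<gamma> I \<longleftrightarrow> T_integral \<kappa> \<tau> H E / pi \<in> \<rat>"
proof -
  have "E * (H + E) < 0"
    using assms by (intro mult_neg_pos) auto
  then have "16 * \<kappa> * (E * (H + E)) < 0"
    using \<kappa> mult_pos_neg[of "16 * \<kappa>" "E * (H + E)"] by simp
  then have "disc > 0"
    unfolding disc_def using zero_le_power2[of \<kappa>] by (simp only: mult.assoc)
  then obtain \<phi> x y \<alpha> where "polar_surface \<gamma> I \<kappa> \<tau> H E \<phi> x y \<alpha>"
    using polar_surface_exists assms by fastforce
  then interpret polar_surface \<gamma> I \<kappa> \<tau> H E \<phi> x y \<alpha> .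
  show "nodoid_type \<gamma> I (x_min \<kappa> H E) (x_max \<kappa> H E)"
    by (rule nodoid[OF assms])
  show "compact_surface \<gamma> I \<longleftrightarrow> T / pi \<in> \<rat>"
    by (rule compact_iff)
qed

text \<open>By \<open>pole_profile\<close> the signed radius is a multiple of cos (p / 2), and a
  turn of 2 \<pi> multiplies it by -1. The signs are therefore cos (\<pi> n), and compactness is
  again a condition on T. The pole is met exactly at the odd multiples of \<pi>.\<close>

lemma north_pole_case:
  assumes E: "E = - H" and H0: "H \<noteq> 0"
  shows "north_pole_type \<gamma> I"
    and "compact_surface \<gamma> I \<longleftrightarrow> T_integral \<kappa> \<tau> H E / pi \<in> \<rat>"
proof -
  have disc: "disc > 0"
    unfolding disc_def using \<kappa> E by simp
  have "E \<noteq> 0"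
    using E H0 by simp
  then obtain \<phi> where "phase_surface \<gamma> I \<kappa> \<tau> H E \<phi>"
    using phase_surface_exists disc by auto
  then interpret phase_surface \<gamma> I \<kappa> \<tau> H E \<phi> .
  obtain Y \<zeta> where \<zeta>: "\<zeta> \<noteq> 0"
    and Y': "\<And>s. s \<in> interior I \<Longrightarrow> (Y has_real_derivative angular_speed (hsq s)) (at s)"
    and \<gamma>': "\<And>s. s \<in> interior I \<Longrightarrow> fst (\<gamma> s) = \<zeta> * of_real (cos (\<phi> s / 2)) * cis (Y s)"
    by (rule pole_profile[OF E disc phase(1) phase(3)], rule that) iprover+
  have Y: "(Y has_real_derivative angular_speed (hsq s)) (at s)"
    and \<gamma>: "fst (\<gamma> s) = \<zeta> * of_real (cos (\<phi> s / 2)) * cis (Y s)" for s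
    using Y'[of s] \<gamma>'[of s] by simp_all
  interpret profile_surface \<gamma> I \<kappa> \<tau> H E \<phi> "\<lambda>p. Y (S p)" "\<lambda>p. cos (p / 2)" "\<lambda>n. cos (pi * of_int n)" \<zeta>
  proof unfold_locales
    fix p :: real and n :: int
    have "((\<lambda>p. Y (S p)) has_real_derivative angular_speed (hsq (S p)) * inverse (speed (hsq (S p)))) (at p)"
      by (rule DERIV_chain2[OF Y S_derivative])
    then show "((\<lambda>p. Y (S p)) has_real_derivative w (mid - rad * cos p)) (at p)"
      using angular_speed_eq[OF t_range] by (simp add: hsq_S)
    show "fst (\<gamma> (S p)) = \<zeta> * of_real (cos (p / 2)) * cis (Y (S p))"
      using \<gamma>[of "S p"] by simp
    have "(p + 2 * pi * of_int n) / 2 = p / 2 + pi * of_int n"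
      by simp
    then show "cos ((p + 2 * pi * of_int n) / 2) = cos (pi * of_int n) * cos (p / 2)"
      by (simp only: cos_add sin_npi_int) simp
    show "cos (pi * of_int (2 * n)) = 1"
      by (simp only: cos_npi_int) simp
  qed (use \<zeta> in auto)
  show "compact_surface \<gamma> I \<longleftrightarrow> T / pi \<in> \<rat>"
    by (rule compact_iff)
  have pole_iff: "\<gamma> (S p) = north_pole \<longleftrightarrow> cos (p / 2) = 0" for p
  proof -
    have "\<gamma> (S p) = north_pole \<longleftrightarrow> fst (\<gamma> (S p)) = 0"
      using hsq_eq_1_iff[of "S p"] gamma_in(1)[of "S p"] by (auto simp: hsq_def north_pole_def)
    also have "\<dots> \<longleftrightarrow> cos (p / 2) = 0"
      using \<zeta> \<gamma>[of "S p"] by simp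
    finally show ?thesis .
  qed
  show "north_pole_type \<gamma> I"
    unfolding north_pole_type_def
  proof (intro conjI allI)
    show "I = UNIV"
      by (rule UNIV)
    fix s
    \<comment> \<open>Makes p1 the largest odd multiple of \<pi> not exceeding the phase of s; the
      arc through s runs from p1 to p1 + 2 \<pi>.\<close>
    define n where "n = \<lfloor>(\<phi> s + pi) / (2 * pi)\<rfloor>"
    define p1 where "p1 = - pi + of_int n * (2 * pi)"
    have "of_int n \<le> (\<phi> s + pi) / (2 * pi)" "(\<phi> s + pi) / (2 * pi) < of_int n + 1"
      unfolding n_def by linarith+
    then have n: "p1 \<le> \<phi> s" "\<phi> s < p1 + 2 * pi"
      by (simp_all add: p1_def field_simps)
    have p1: "p1 / 2 = of_int (2 * n - 1) * (pi / 2)" "(p1 + 2 * pi) / 2 = of_int (2 * n + 1) * (pi / 2)"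
      by (simp_all add: p1_def field_simps)
    have S_le: "S a \<le> S b \<longleftrightarrow> a \<le> b" for a b
      using S_less_iff by (simp add: not_less[symmetric])
    show "\<exists>a b. a < b \<and> s \<in> {a..b} \<and> \<gamma> a = north_pole \<and> \<gamma> b = north_pole \<and>
        (\<forall>u\<in>{a<..<b}. \<gamma> u \<noteq> north_pole)"
    proof (intro exI conjI ballI)
      show "S p1 < S (p1 + 2 * pi)"
        by (simp add: S_less_iff)
      show "s \<in> {S p1..S (p1 + 2 * pi)}"
        using S_le[of p1 "\<phi> s"] S_le[of "\<phi> s" "p1 + 2 * pi"] n by simp
      show "\<gamma> (S p1) = north_pole" "\<gamma> (S (p1 + 2 * pi)) = north_pole"
        unfolding pole_iff p1 cos_zero_iff_int by (metis even_mult_iff even_numeral odd_add odd_one even_diff odd_one dvd_triv_left)+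
      fix u assume u: "u \<in> {S p1<..<S (p1 + 2 * pi)}"
      then have pu: "p1 < \<phi> u" "\<phi> u < p1 + 2 * pi"
        using S_less_iff[of p1 "\<phi> u"] S_less_iff[of "\<phi> u" "p1 + 2 * pi"] by auto
      have "cos (\<phi> u / 2) \<noteq> 0"
      proof
        assume "cos (\<phi> u / 2) = 0"
        then obtain i :: int where i: "odd i" "\<phi> u / 2 = of_int i * (pi / 2)"
          unfolding cos_zero_iff_int by blast
        have "of_int (2 * n - 1) * (pi / 2) < of_int i * (pi / 2)" "of_int i * (pi / 2) < of_int (2 * n + 1) * (pi / 2)"
          using pu unfolding p1[symmetric] i(2)[symmetric] by auto
        then have "2 * n - 1 < i" "i < 2 * n + 1"
          by (simp_all only: mult_less_cancel_right_pos[OF half_gt_zero[OF pi_gt_zero]] of_int_less_iff)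
        then have "i = 2 * n"
          by simp
        then show False
          using i(1) by simp
      qed
      then show "\<gamma> u \<noteq> north_pole"
        using pole_iff[of "\<phi> u"] by simp
    qed
  qed
qed

text \<open>For E = 0 one has mid = rad, so cos \<phi> = 1 means being on the axis. The positive
  lower bound on the speed turns the confinement of the phase into a bound 2 \<pi> /
  \<open>speed_bound\<close> on the length of I.\<close>

lemma axis_phase:
  assumes E: "E = 0"
  obtains a b where "a < b" "I = {a..b}"
proof -
  have disc: "disc > 0"
    unfolding disc_def using \<kappa> E by simp
  obtain \<phi> where \<phi>: "\<And>s. s \<in> interior I \<Longrightarrow> hsq s = mid - rad * cos (\<phi> s)"
    "\<And>s. s \<in> interior I \<Longrightarrow> (\<phi> has_real_derivative speed (hsq s)) (at s)"
    by (rule phase_exists[OF disc], rule that) iprover+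
  have "mid = rad"
    unfolding mid_def rad_def disc_def using \<kappa> E by simp
  then have cos_ne: "cos (\<phi> s) \<noteq> 1" if "s \<in> interior I" for s
    using \<phi>(1)[OF that] hsq_pos[OF that] by auto
  have short: "speed_bound * (r - s) \<le> 2 * pi" if sr: "s < r" "s \<in> interior I" "r \<in> interior I" for s r
  proof (rule ccontr)
    assume long: "\<not> ?thesis"
    have sub: "v \<in> interior I" if "s \<le> v" "v \<le> r" for v
      using mem_is_interval_1_I[OF interior_interval] sr that by blast
    have "\<phi> s - speed_bound * s \<le> \<phi> r - speed_bound * r"
    proof (rule DERIV_nonneg_imp_nondecreasing[where f="\<lambda>v. \<phi> v - speed_bound * v"])
      show "s \<le> r"
        using sr by simp
      fix v assume "s \<le> v" "v \<le> r"
      then have v: "v \<in> interior I"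
        by (rule sub)
      have "((\<lambda>v. \<phi> v - speed_bound * v) has_real_derivative speed (hsq v) - speed_bound) (at v)"
        by (auto intro!: derivative_eq_intros \<phi>(2)[OF v])
      then show "\<exists>d. ((\<lambda>v. \<phi> v - speed_bound * v) has_real_derivative d) (at v) \<and> 0 \<le> d"
        using speed_derivative(3)[OF v] by (intro exI[of _ "speed (hsq v) - speed_bound"]) auto
    qed
    then have big: "\<phi> s + 2 * pi \<le> \<phi> r"
      using long by (simp add: algebra_simps)
    \<comment> \<open>The first multiple of 2 \<pi> not below the phase of s; an increase of 2 \<pi>
      cannot avoid it.\<close>
    define n where "n = \<lceil>\<phi> s / (2 * pi)\<rceil>"
    have "\<phi> s / (2 * pi) \<le> of_int n" "of_int n < \<phi> s / (2 * pi) + 1"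
      unfolding n_def by linarith+
    then have "\<phi> s \<le> of_int n * (2 * pi)" "of_int n * (2 * pi) \<le> \<phi> r"
      using big by (simp_all add: field_simps)
    moreover have "isCont \<phi> v" if "s \<le> v" "v \<le> r" for v
      using \<phi>(2)[OF sub[OF that]] DERIV_isCont by blast
    ultimately obtain v where v: "s \<le> v" "v \<le> r" "\<phi> v = of_int n * (2 * pi)"
      using IVT[of \<phi> s "of_int n * (2 * pi)" r] sr(1) by auto
    have "cos (\<phi> v) = 1"
      unfolding v(3) cos_one_2pi_int by (intro exI[of _ n]) simp
    then show False
      using cos_ne sub v by blast
  qed
  obtain p where p: "p \<in> interior I"
    using interior_I by blast
  define B where "B = 2 * pi / speed_bound"
  have "\<bar>r - p\<bar> \<le> B" if "r \<in> interior I" for r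
    using short[of p r] short[of r p] p that speed_bound_pos
    by (cases r p rule: linorder_cases) (auto simp: B_def field_simps)
  then have "interior I \<subseteq> cball p B"
    by (auto simp: dist_real_def abs_minus_commute)
  then have "closure (interior I) \<subseteq> cball p B"
    by (rule closure_minimal[OF _ closed_cball])
  then have "I \<subseteq> cball p B"
    unfolding convex_closure_interior[OF interval_I(2) interior_I] using closure_subset[of I] by (rule order_trans[rotated])
  then have "compact I"
    using closed_I bounded_subset[OF bounded_cball] by (simp add: compact_eq_bounded_closed)
  then obtain a b where I: "I = {a..b}"
    using connected_compact_interval_1 interval_I is_interval_connected by metis
  then have "a < b"
    using interior_I by auto
  then show ?thesis
    using that I by blast
qed

lemma sphere_case:
  assumes "E = 0"
  shows "sphere_type \<gamma> I"
proof -
  obtain a b where ab: "a < b" and I: "I = {a..b}"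
    using axis_phase[OF assms] .
  have int: "interior I = {a<..<b}"
    by (simp add: I)
  have "{(s, v::complex). s \<in> {a..b} \<and> cmod v = snd (\<gamma> s)} homeomorphic sphere (0::real^3) 1"
  proof (rule revolution_homeomorphic_sphere[OF ab])
    show "continuous_on {a..b} (\<lambda>s. snd (\<gamma> s))"
      using continuous_gamma I by (intro continuous_intros) simp
    show "snd (\<gamma> a) = 0" "snd (\<gamma> b) = 0"
      using axis_iff[of a] axis_iff[of b] ab by (auto simp: I)
    show "snd (\<gamma> s) > 0" if "s \<in> {a<..<b}" for s
      using height_pos int that by blast
  qed
  then show ?thesis
    unfolding sphere_type_def surface_domain_def I by simp
qed

text \<open>Here E = 0 and E = - H hold together: the arc runs from axis to axis through the pole.
  \<open>pole_profile\<close>, stated on the interior of I, covers it. Since e = 0, the phase has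
  constant speed 2 and the longitude is constant, which leaves half a great circle.\<close>

lemma great_circle:
  assumes E: "E = 0" and H0: "H = 0"
  obtains a \<zeta> where "I = {a..a + pi}" "cmod \<zeta> = 1"
    "\<And>s. s \<in> I \<Longrightarrow> \<gamma> s = (\<zeta> * of_real (cos (s - a)), sin (s - a))"
proof -
  have EH: "E = - H"
    using E H0 by simp
  have disc: "disc > 0"
    unfolding disc_def using \<kappa> E by simp
  obtain \<phi> where \<phi>: "\<And>s. s \<in> interior I \<Longrightarrow> hsq s = mid - rad * cos (\<phi> s)"
    "\<And>s. s \<in> interior I \<Longrightarrow> (\<phi> has_real_derivative speed (hsq s)) (at s)"
    by (rule phase_exists[OF disc], rule that) iprover+
  obtain Y \<zeta>0 where Y: "\<And>s. s \<in> interior I \<Longrightarrow> (Y has_real_derivative angular_speed (hsq s)) (at s)"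
    and z: "\<And>s. s \<in> interior I \<Longrightarrow> fst (\<gamma> s) = \<zeta>0 * of_real (cos (\<phi> s / 2)) * cis (Y s)"
    by (rule pole_profile[OF EH disc \<phi>], assumption, assumption, rule that) iprover+
  obtain a b where ab: "a < b" and I: "I = {a..b}"
    using axis_phase[OF E] .
  have int: "interior I = {a<..<b}"
    by (simp add: I)
  define m where "m = (a + b) / 2"
  have m: "m \<in> interior I"
    using ab by (simp add: int m_def)
  have mid: "mid = 1 / 2" "rad = 1 / 2"
    unfolding mid_def rad_def disc_def using \<kappa> E H0 by simp_all
  have sp: "speed (hsq s) = 2" if "s \<in> interior I" for s
    unfolding speed_def Q_def e_def using hsq_pos[OF that] \<kappa> E H0 by simp
  have Y_const: "Y s = Y m" if "s \<in> interior I" for s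
  proof (rule open_interval_derivative_zero_constant[OF open_interior interior_interval _ that m])
    fix s assume s: "s \<in> interior I"
    have "angular_speed (hsq s) = 0"
      unfolding angular_speed_def q_def using E H0 by simp
    then show "(Y has_vector_derivative 0) (at s)"
      using Y[OF s] by (simp add: has_real_derivative_iff_has_vector_derivative)
  qed
  define c where "c = \<phi> m / 2 - m"
  have phase: "\<phi> s / 2 = s + c" if "s \<in> interior I" for s
  proof -
    have "\<phi> s / 2 - s = \<phi> m / 2 - m"
    proof (rule open_interval_derivative_zero_constant[OF open_interior interior_interval _ that m])
      fix s assume s: "s \<in> interior I"
      have "((\<lambda>s. \<phi> s / 2 - s) has_real_derivative 0) (at s)"
        using \<phi>(2)[OF s] sp[OF s] by (auto intro!: derivative_eq_intros)
      then show "((\<lambda>s. \<phi> s / 2 - s) has_vector_derivative 0) (at s)"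
        by (simp add: has_real_derivative_iff_has_vector_derivative)
    qed
    then show ?thesis
      by (simp add: c_def)
  qed
  define \<zeta>1 where "\<zeta>1 = \<zeta>0 * cis (Y m)"
  have closed_form: "\<gamma> s = (\<zeta>1 * of_real (cos (s + c)), \<bar>sin (s + c)\<bar>)" if s: "s \<in> interior I" for s
  proof -
    have "fst (\<gamma> s) = \<zeta>1 * of_real (cos (s + c))"
      using z[OF s] phase[OF s] Y_const[OF s] by (simp add: \<zeta>1_def mult_ac)
    moreover have "cos (\<phi> s) = 1 - 2 * (sin (\<phi> s / 2))^2"
      using cos_double_sin[of "\<phi> s / 2"] by simp
    then have "(snd (\<gamma> s))^2 = (sin (s + c))^2"
      using \<phi>(1)[OF s] unfolding phase[OF s] hsq_def mid by (simp add: diff_divide_distrib)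
    then have "snd (\<gamma> s) = \<bar>sin (s + c)\<bar>"
      using height_pos[OF s] by (metis abs_of_pos power2_eq_iff abs_minus_cancel)
    ultimately show ?thesis
      by (simp add: prod_eq_iff)
  qed
  \<comment> \<open>The formula passes from the interior to the two axis points by
    continuity.\<close>
  have ext: "\<gamma> s = (\<zeta>1 * of_real (cos (s + c)), \<bar>sin (s + c)\<bar>)" if s: "s \<in> I" for s
  proof -
    define f where "f s = \<gamma> s - (\<zeta>1 * of_real (cos (s + c)), \<bar>sin (s + c)\<bar>)" for s
    have cl: "closure {a<..<b} = I"
      using ab by (simp add: I)
    have "f s = 0"
    proof (rule continuous_constant_on_closure[of "{a<..<b}"])
      show "continuous_on (closure {a<..<b}) f"
        unfolding cl f_def by (intro continuous_intros continuous_gamma)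
      show "f x = 0" if "x \<in> {a<..<b}" for x
        using closed_form[of x] that by (simp add: int f_def)
      show "s \<in> closure {a<..<b}"
        using s cl by simp
    qed
    then show ?thesis
      by (simp add: f_def)
  qed
  have zero: "sin (s + c) = 0 \<longleftrightarrow> s = a \<or> s = b" if "s \<in> I" for s
    using axis_iff[OF that] ext[OF that] that ab by (auto simp: I)
  have "sin (a + c) = 0" "sin (b + c) = 0"
    using zero[of a] zero[of b] ab by (auto simp: I)
  then obtain n k :: int where n: "a + c = of_int n * pi" and k: "b + c = of_int k * pi"
    by (auto simp: sin_zero_iff_int2)
  have "of_int n * pi < of_int k * pi"
    using ab n k by linarith
  then have "n < k"
    by simp
  moreover have "\<not> n + 1 < k"
  proof
    assume less: "n + 1 < k"
    define s where "s = of_int (n + 1) * pi - c"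
    have "of_int n * pi < of_int (n + 1) * pi" "of_int (n + 1) * pi < of_int k * pi"
      using less by (intro mult_strict_right_mono; simp)+
    then have "a < s" "s < b"
      unfolding s_def using n k by linarith+
    moreover have "sin (s + c) = 0"
      unfolding s_def sin_zero_iff_int2 by (intro exI[of _ "n + 1"]) simp
    ultimately show False
      using zero[of s] by (simp add: I)
  qed
  ultimately have "k = n + 1"
    by simp
  then have b: "b = a + pi"
    using n k by (simp add: algebra_simps)
  \<comment> \<open>The sign left over from moving the phase to start at a; it is absorbed into the
    unit factor \<zeta>.\<close>
  define \<epsilon> :: real where "\<epsilon> = cos (pi * of_int n)"
  have \<epsilon>: "\<bar>\<epsilon>\<bar> = 1"
    by (simp add: \<epsilon>_def)
  have form: "\<gamma> s = (\<zeta>1 * of_real \<epsilon> * of_real (cos (s - a)), sin (s - a))" if s: "s \<in> I" for s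
  proof -
    have sc: "s + c = (s - a) + pi * of_int n"
      using n by (simp add: algebra_simps)
    have "cos (s + c) = \<epsilon> * cos (s - a)" "sin (s + c) = \<epsilon> * sin (s - a)"
      unfolding sc cos_add sin_add sin_npi_int \<epsilon>_def by simp_all
    moreover have "sin (s - a) \<ge> 0"
      using s b by (intro sin_ge_zero) (auto simp: I)
    ultimately show ?thesis
      using ext[OF s] \<epsilon> by (simp add: abs_mult)
  qed
  have "a \<in> I"
    using ab by (simp add: I)
  then have "cmod (\<zeta>1 * of_real \<epsilon>) = 1"
    using gamma_in(1)[of a] form[of a] norm_ge_zero[of "\<zeta>1 * of_real \<epsilon>"] by (simp add: power2_eq_1_iff)
  then show ?thesis
    using that[of a "\<zeta>1 * of_real \<epsilon>"] form I b by simp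
qed

text \<open>Rotating by minus the argument of \<zeta> makes the first component real, and arccos
  recovers the parameter of a given point. Injectivity of cos on {0..\<pi>} gives
  embeddedness.\<close>

lemma great_sphere_case:
  assumes E: "E = 0" and H0: "H = 0"
  shows "\<exists>\<theta>. (\<lambda>(z, w). (cis \<theta> * z, w)) ` surface_set \<gamma> I = {(z, w) \<in> S3. Im z = 0}"
    and "embedded_surface \<gamma> I"
proof -
  obtain a \<zeta> where I: "I = {a..a + pi}" and \<zeta>: "cmod \<zeta> = 1"
    and form: "\<And>s. s \<in> I \<Longrightarrow> \<gamma> s = (\<zeta> * of_real (cos (s - a)), sin (s - a))"
    using great_circle[OF assms] by metis
  have "\<zeta> \<noteq> 0"
    using \<zeta> by auto
  show "embedded_surface \<gamma> I"
    unfolding embedded_surface_def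
  proof (intro ballI impI disjI1)
    fix s1 s2 assume s: "s1 \<in> I" "s2 \<in> I" "\<gamma> s1 = \<gamma> s2"
    then have c: "cos (s1 - a) = cos (s2 - a)"
      using form \<open>\<zeta> \<noteq> 0\<close> by simp
    have "s1 - a = s2 - a"
      by (rule cos_inj_pi[OF _ _ _ _ c]) (use s(1,2) in \<open>auto simp: I\<close>)
    then show "s1 = s2"
      by simp
  qed
  define \<theta> where "\<theta> = - Arg \<zeta>"
  have "\<zeta> = cis (Arg \<zeta>)"
    using rcis_cmod_Arg[of \<zeta>] \<zeta> by (simp add: rcis_def)
  then have rot: "cis \<theta> * \<zeta> = 1"
    by (metis \<theta>_def cis_mult cis_zero add.left_inverse)
  have "(\<lambda>(z, w). (cis \<theta> * z, w)) ` surface_set \<gamma> I = {(z, w) \<in> S3. Im z = 0}"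
  proof (intro subset_antisym subsetI)
    fix q assume "q \<in> (\<lambda>(z, w). (cis \<theta> * z, w)) ` surface_set \<gamma> I"
    then obtain z v s where q: "q = (cis \<theta> * z, v)" and s: "s \<in> I" "(z, cmod v) = \<gamma> s"
      by (auto simp: surface_set_def)
    then have "cis \<theta> * z = cis \<theta> * \<zeta> * of_real (cos (s - a))" "cmod v = sin (s - a)"
      using form by auto
    then show "q \<in> {(z, w) \<in> S3. Im z = 0}"
      unfolding q rot by (simp add: S3_def)
  next
    fix q assume "q \<in> {(z, w) \<in> S3. Im z = 0}"
    then have "(cmod (fst q))^2 + (cmod (snd q))^2 = 1" "Im (fst q) = 0"
      by (auto simp: S3_def)
    moreover define r v where "r = Re (fst q)" and "v = snd q"
    ultimately have q: "q = (complex_of_real r, v)" and r: "r^2 + (cmod v)^2 = 1"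
      by (auto simp: prod_eq_iff complex_eq_iff cmod_power2)
    have "r^2 \<le> 1"
      using r by (metis le_add_same_cancel1 zero_le_power2)
    then have r1: "-1 \<le> r" "r \<le> 1"
      by (auto simp: abs_square_le_1 abs_le_iff)
    define s where "s = a + arccos r"
    have "s \<in> I"
      using r1 arccos_lbound[of r] arccos_ubound[of r] by (simp add: I s_def)
    moreover have "sin (arccos r) = cmod v"
      using r r1 by (simp add: sin_arccos real_sqrt_unique)
    ultimately have "(\<zeta> * of_real r, cmod v) \<in> \<gamma> ` I"
      using form[of s] r1 by (intro image_eqI[of _ _ s]) (auto simp: s_def cos_arccos)
    then have "(\<zeta> * of_real r, v) \<in> surface_set \<gamma> I"
      by (simp add: surface_set_def)
    moreover have "q = (\<lambda>(z, w). (cis \<theta> * z, w)) (\<zeta> * of_real r, v)"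
      using rot by (simp add: q mult.assoc[symmetric])
    ultimately show "q \<in> (\<lambda>(z, w). (cis \<theta> * z, w)) ` surface_set \<gamma> I"
      by blast
  qed
  then show "\<exists>\<theta>. (\<lambda>(z, w). (cis \<theta> * z, w)) ` surface_set \<gamma> I = {(z, w) \<in> S3. Im z = 0}"
    by blast
qed

end

theorem theorem1:
  fixes \<kappa> \<tau> H E :: real
    and \<gamma> :: "real \<Rightarrow> complex \<times> real" and I :: "real set"
  assumes "\<kappa> > 0" and "\<tau> \<noteq> 0" and "H \<ge> 0"
    and "invariant_surface \<gamma> I"
    and "complete_surface \<kappa> \<tau> \<gamma> I"
    and "has_mean_curvature \<kappa> \<tau> \<gamma> I H"
    and "has_energy \<kappa> \<tau> \<gamma> I H E"
  shows
    "(E = 0 \<longrightarrow>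
        sphere_type \<gamma> I \<and>
        (H = 0 \<longrightarrow>
           (\<exists>\<theta>. (\<lambda>(z, w). (cis \<theta> * z, w)) ` surface_set \<gamma> I = {(z, w) \<in> S3. Im z = 0}) \<and>
           embedded_surface \<gamma> I)) \<and>
     (\<forall>\<sigma>\<in>{1, -1}. E = torus_energy \<kappa> H \<sigma> \<longrightarrow>
        surface_set \<gamma> I = clifford_torus (sqrt (1 / 2 + \<sigma> * H / sqrt (4 * H^2 + \<kappa>)))) \<and>
     ((E > 0 \<or> E < - H) \<and> (\<forall>\<sigma>\<in>{1, -1}. E \<noteq> torus_energy \<kappa> H \<sigma>) \<longrightarrow>
        unduloid_type \<gamma> I (x_min \<kappa> H E) (x_max \<kappa> H E)) \<and>
     (- H < E \<and> E < 0 \<longrightarrow>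
        nodoid_type \<gamma> I (x_min \<kappa> H E) (x_max \<kappa> H E)) \<and>
     (E = - H \<and> H \<noteq> 0 \<longrightarrow> north_pole_type \<gamma> I) \<and>
     ((E > 0 \<or> E < - H) \<and> (\<forall>\<sigma>\<in>{1, -1}. E \<noteq> torus_energy \<kappa> H \<sigma>) \<or>
      - H < E \<and> E < 0 \<or> E = - H \<and> H \<noteq> 0 \<longrightarrow>
        (compact_surface \<gamma> I \<longleftrightarrow> T_integral \<kappa> \<tau> H E / pi \<in> \<rat>)) \<and>
     ((E > 0 \<or> E < - H) \<and> (\<forall>\<sigma>\<in>{1, -1}. E \<noteq> torus_energy \<kappa> H \<sigma>) \<longrightarrow>
        (compact_surface \<gamma> I \<and> embedded_surface \<gamma> I \<longleftrightarrow>
           (\<exists>k::int. k \<noteq> 0 \<and> T_integral \<kappa> \<tau> H E = 2 * pi / of_int k)))"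
proof -
  interpret rot_surface \<gamma> I
    using assms by unfold_locales
  interpret cmc_surface \<gamma> I \<kappa> \<tau> H E
    using assms complete_imp_closed by unfold_locales auto
  \<comment> \<open>Excluding the two torus energies is what makes the oscillation of the height
    nondegenerate.\<close>
  have disc: "disc = 0 \<longleftrightarrow> (\<exists>\<sigma>\<in>{1, -1}. E = torus_energy \<kappa> H \<sigma>)"
    by (rule disc_0_iff)
  have "sphere_type \<gamma> I \<and>
        (H = 0 \<longrightarrow>
           (\<exists>\<theta>. (\<lambda>(z, w). (cis \<theta> * z, w)) ` surface_set \<gamma> I = {(z, w) \<in> S3. Im z = 0}) \<and>
           embedded_surface \<gamma> I)" if "E = 0"
    using sphere_case[OF that] great_sphere_case[OF that] by blast
  moreover have "\<forall>\<sigma>\<in>{1, -1}. E = torus_energy \<kappa> H \<sigma> \<longrightarrow>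
        surface_set \<gamma> I = clifford_torus (sqrt (1 / 2 + \<sigma> * H / sqrt (4 * H^2 + \<kappa>)))"
    using clifford_torus_if by blast
  moreover have "unduloid_type \<gamma> I (x_min \<kappa> H E) (x_max \<kappa> H E)
      \<and> (compact_surface \<gamma> I \<longleftrightarrow> T_integral \<kappa> \<tau> H E / pi \<in> \<rat>)
      \<and> (compact_surface \<gamma> I \<and> embedded_surface \<gamma> I \<longleftrightarrow>
           (\<exists>k::int. k \<noteq> 0 \<and> T_integral \<kappa> \<tau> H E = 2 * pi / of_int k))"
    if "(E > 0 \<or> E < - H) \<and> (\<forall>\<sigma>\<in>{1, -1}. E \<noteq> torus_energy \<kappa> H \<sigma>)"
  proof -
    have "disc \<noteq> 0"
      using that disc by blast
    then show ?thesis
      using unduloid_case that by blast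
  qed
  moreover have "nodoid_type \<gamma> I (x_min \<kappa> H E) (x_max \<kappa> H E)
      \<and> (compact_surface \<gamma> I \<longleftrightarrow> T_integral \<kappa> \<tau> H E / pi \<in> \<rat>)" if "- H < E \<and> E < 0"
    using nodoid_case that by blast
  moreover have "north_pole_type \<gamma> I \<and> (compact_surface \<gamma> I \<longleftrightarrow> T_integral \<kappa> \<tau> H E / pi \<in> \<rat>)"
    if "E = - H \<and> H \<noteq> 0"
    using north_pole_case that by blast
  ultimately show ?thesis
    by (intro conjI impI) (blast+)
qed

end
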